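(* Let $\Gamma$ be a finite, simple, strongly connected digraph with at least $2$ vertices which is vertex-transitive. Then $\dim(\Gamma)=1$ if and only if $\Gamma$ is isomorphic to one of the following Cayley digraphs: (i) $\mathrm{Cay}(\mathbb{Z}_n,\{1\})$, where $n\geq 2$; (ii) $\mathrm{Cay}(\mathbb{Z}_{2n},\{1,2\})$, where $n\geq 2$; (iii) $\mathrm{Cay}(\mathbb{Z}_2\oplus\mathbb{Z}_n,\{(1,0),(0,1)\})$, where $n\geq 3$; (iv) $\mathrm{Cay}(\mathbb{Z}_2\oplus\mathbb{Z}_{2n},\{(1,0),(0,1),(0,2)\})$, where $n\geq 3$.
   Context: All digraphs are finite, simple (no loops, at most one arc from $x$ to $y$ for each ordered pair) and strongly connected. For vertices $x,y$, $\partial(x,y)$ is the length of a shortest directed path from $x$ to $y$, and the two way distance is $\tilde\partial(x,y)=(\partial(x,y),\partial(y,x))$. A subset $\{w_1,\dots,w_m\}\subseteq V(\Gamma)$ is a weakly resolving set if $(\tilde\partial(w_1,u),\dots,\tilde\partial(w_m,u))\neq(\tilde\partial(w_1,v),\dots,\tilde\partial(w_m,v))$ for all distinct $u,v\in V(\Gamma)$; the weak metric dimension $\dim(\Gamma)$ is the minimum cardinality of a weakly resolving set. $\Gamma$ is vertex-transitive if its full automorphism group acts transitively on $V(\Gamma)$. For a finite (additive) group $G$ and a generating subset $S$ not containing $0$, the Cayley digraph $\mathrm{Cay}(G,S)$ has vertex set $G$ and arc set $\{(x,x+s)\mid x\in G,s\in S\}$. $\mathbb{Z}_n$ is the additive group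 of integers modulo $n$. *)

theory Defs
  imports
    "Graph_Theory.Digraph_Isomorphism"
    "HOL-Algebra.Elementary_Groups"
begin

definition digraph_dist :: "('a, 'b) pre_digraph \<Rightarrow> 'a \<Rightarrow> 'a \<Rightarrow> nat" where
  "digraph_dist G x y = (LEAST k. \<exists>p. pre_digraph.apath G x p y \<and> length p = k)"

definition two_way_dist :: "('a, 'b) pre_digraph \<Rightarrow> 'a \<Rightarrow> 'a \<Rightarrow> nat \<times> nat" where
  "two_way_dist G x y = (digraph_dist G x y, digraph_dist G y x)"

definition weakly_resolving :: "('a, 'b) pre_digraph \<Rightarrow> 'a set \<Rightarrow> bool" where
  "weakly_resolving G W \<longleftrightarrow> finite W \<and> W \<subseteq> verts G \<and>
     (\<forall>u \<in> verts G. \<forall>v \<in> verts G. u \<noteq> v \<longrightarrow>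
        (\<exists>w \<in> W. two_way_dist G w u \<noteq> two_way_dist G w v))"

definition weak_metric_dim :: "('a, 'b) pre_digraph \<Rightarrow> nat" where
  "weak_metric_dim G = (LEAST m. \<exists>W. weakly_resolving G W \<and> card W = m)"

definition digraph_automorphism ::
    "('a, 'b) pre_digraph \<Rightarrow> ('a, 'b, 'a, 'b) digraph_isomorphism \<Rightarrow> bool" where
  "digraph_automorphism G f \<longleftrightarrow>
     pre_digraph.digraph_isomorphism G f \<and> app_iso f G = G"

definition vertex_transitive :: "('a, 'b) pre_digraph \<Rightarrow> bool" where
  "vertex_transitive G \<longleftrightarrow>
     (\<forall>u \<in> verts G. \<forall>v \<in> verts G. \<exists>f. digraph_automorphism G f \<and> iso_verts f u = v)"

text \<open>
  Groups are written multiplicatively in HOL-Algebra, so the arc \<open>(x, x + s)\<close> of an additive group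
  becomes \<open>(x, x \<otimes> s)\<close>. The usual side conditions on \<open>S\<close> (it generates the group and does not
  contain the neutral element) are not built into the definition.
\<close>

definition Cay :: "('g, 'm) monoid_scheme \<Rightarrow> 'g set \<Rightarrow> ('g, 'g \<times> 'g) pre_digraph" where
  "Cay A S = \<lparr> verts = carrier A,
               arcs = {(x, x \<otimes>\<^bsub>A\<^esub> s) | x s. x \<in> carrier A \<and> s \<in> S},
               tail = fst, head = snd \<rparr>"

end

theory Submission
  imports Defs
begin

text \<open>
  If some vertex \<open>z\<close> resolves \<open>G\<close>, an automorphism fixing \<open>z\<close> fixes every vertex, so the automorphism
  group acts regularly and \<open>G\<close> is its Cayley digraph over the set \<open>S\<close> of automorphisms moving \<open>z\<close> to an
  out-neighbour. Writing \<open>d g\<close> for the word length of \<open>g\<close> over \<open>S\<close> and \<open>e g = d (- g)\<close>, the map \<open>g \<mapsto> (d g, e g)\<close>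
  is injective; call \<open>S\<close> thin.

  Closed words correspond to circuits. In a shortest closed word through a letter \<open>y\<close>, neighbouring letters \<open>a\<close>, \<open>b\<close>
  with one of them \<open>y\<close> have \<open>e (a + b) = e y - 1\<close>, so by thinness all such sums with \<open>d (a + b) = 2\<close> coincide. This
  forces the word to consist of copies of \<open>y\<close> only, or \<open>y + y\<close> is again a letter and the word
  consists of copies of \<open>y\<close> and \<open>y + y\<close>. A letter of order two turns out to be central. Apply the same
  coincidence principle to a shortest closed word among those containing two letters that are distinct, not of
  order two, and not related by doubling: that word is a relation \<open>rep p u + rep q w = \<sigma>\<close> between two commuting letters, where \<open>\<sigma>\<close> is
  \<open>0\<close> or the letter of order two, and comparing \<open>u + u + w\<close> with \<open>u + w + w\<close> (and similar elements) refutes every such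
  relation. Hence \<open>S\<close> is \<open>{x}\<close> or \<open>{y, y + y}\<close>, possibly together with a letter of order two. Conversely,
  distances in the four families are verified by exhibiting potential functions.
\<close>

section \<open>Words in a group\<close>

text \<open>The coincidence principle only speaks about sums of length exactly 2, whereas the sum of
  two neighbouring letters might itself be a letter. Excluding that is the main obstacle at both
  levels. For circuits through one letter \<open>y\<close> it is met by induction on
  \<open>e y\<close>: an offending letter \<open>l\<close> has \<open>e l = e y - 1\<close>, so the
  shape of its shortest circuits is already known. For mixed words that shape is known outright.
  Commutativity has to be earned: two letters commute once the left and the right neighbour in a
  circuit are seen to produce the same sum. The pairs that do not count as mixed are those that
  survive in the families: \<open>y\<close> with \<open>y + y\<close>, and a letter of order two
  with anything. The bound n \<ge> 3 in the last two families arises because, for n = 2, the new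
  letter of order two and a letter of the cyclic factor would both lie at two way distance (1, 1)
  from the neutral element.\<close>

lemma add_eq_zero_commute: "a + b = 0 \<Longrightarrow> b + a = (0 :: 'g :: group_add)"
  using eq_neg_iff_add_eq_0[of a b] by auto

lemma group_add_cancel_zero [simp]:
  fixes a b :: "'g :: group_add"
  shows "a + b = a \<longleftrightarrow> b = 0" "a + b = b \<longleftrightarrow> a = 0" "a = a + b \<longleftrightarrow> b = 0" "b = a + b \<longleftrightarrow> a = 0"
proof -
  show 1: "a + b = a \<longleftrightarrow> b = 0" using add_left_cancel[of a b 0] by simp
  show 2: "a + b = b \<longleftrightarrow> a = 0" using add_right_cancel[of a b 0] by simp
  show "a = a + b \<longleftrightarrow> b = 0" using 1 by (simp only: eq_commute[of a])
  show "b = a + b \<longleftrightarrow> a = 0" using 2 by (simp only: eq_commute[of b])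
qed

primrec rep :: "nat \<Rightarrow> 'g::group_add \<Rightarrow> 'g" where
  "rep 0 a = 0"
| "rep (Suc n) a = a + rep n a"

lemma sum_list_replicate_rep [simp]: "sum_list (replicate n a) = rep n a"
  by (induction n) auto

lemma rep_add: "rep (m + n) a = rep m a + rep n a"
  by (induction m) (auto simp: add.assoc)

lemma add_commute_rep: "a + b = b + a \<Longrightarrow> a + rep n b = rep n b + a"
proof (induction n)
  case (Suc n)
  then show ?case by (metis add.assoc rep.simps(2))
qed simp

lemma rep_add_self [simp]: "rep n a + a = a + rep n a" "rep n a + (a + b) = a + (rep n a + b)"
  by (simp_all add: add_commute_rep[of a a n] add.assoc[symmetric])

lemma rep_commute_rep: "a + b = b + a \<Longrightarrow> rep m a + rep n b = rep n b + rep m a"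
  by (metis add_commute_rep)

lemma rep_rep: "rep m (rep n a) = rep (m * n) a"
  by (induction m) (auto simp: rep_add)

lemma rep_double: "rep n (a + a) = rep (2 * n) a"
  using rep_rep[of n 2 a] by (simp add: numeral_2_eq_2 mult.commute)

lemma rep_zero [simp]: "rep n 0 = 0"
  by (induction n) auto

lemma rep_mod: "rep n a = 0 \<Longrightarrow> rep (i mod n) a = rep i a"
  by (metis add.left_neutral div_mult_mod_eq rep_add rep_rep rep_zero)

text \<open>Passing to the opposite group turns statements about right neighbours into their mirror images.\<close>

datatype 'g opp = Opp (unopp: 'g)

instantiation opp :: (group_add) group_add
begin

definition "0 = Opp 0"
definition "a + b = Opp (unopp b + unopp a)"
definition "- a = Opp (- unopp a)"
definition "a - b = a + - (b :: 'a opp)"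

instance
  by standard (auto simp: zero_opp_def plus_opp_def uminus_opp_def minus_opp_def add.assoc)

end

lemma Opp_0: "Opp 0 = 0"
  and Opp_add: "Opp (a + b) = Opp b + Opp a"
  and Opp_minus: "Opp (- a) = - Opp a"
  by (auto simp: zero_opp_def plus_opp_def uminus_opp_def)

lemma sum_list_Opp: "sum_list (map Opp W) = Opp (sum_list (rev W))"
  by (induction W) (auto simp: Opp_0 Opp_add)

lemma Opp_words: "(\<exists>V. set V \<subseteq> Opp ` S \<and> length V = n \<and> sum_list V = Opp g) \<longleftrightarrow>
    (\<exists>W. set W \<subseteq> S \<and> length W = n \<and> sum_list W = g)" (is "?L \<longleftrightarrow> ?R")
proof
  assume ?L
  then obtain V where V: "set V \<subseteq> Opp ` S" "length V = n" "sum_list V = Opp g" by blast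
  define W where "W = map unopp V"
  have "V = map Opp W" by (simp add: W_def o_def)
  with V have "set (rev W) \<subseteq> S" "length (rev W) = n" "sum_list (rev W) = g"
    by (auto simp: sum_list_Opp)
  then show ?R by blast
next
  assume ?R
  then obtain W where "set W \<subseteq> S" "length W = n" "sum_list W = g" by blast
  then have "set (map Opp (rev W)) \<subseteq> Opp ` S" "length (map Opp (rev W)) = n"
      "sum_list (map Opp (rev W)) = Opp g"
    unfolding sum_list_Opp by auto
  then show ?L by blast
qed

section \<open>Word length and thin sets of letters\<close>

text \<open>For \<open>g\<close> outside \<open>words_span S\<close> the value is that of
  \<open>LEAST\<close> over an empty predicate, so triangle inequalities are stated on the
  span.\<close>

definition wlen :: "'g::group_add set \<Rightarrow> 'g \<Rightarrow> nat" where
  "wlen S g = (LEAST n. \<exists>W. set W \<subseteq> S \<and> length W = n \<and> sum_list W = g)"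

definition words_span :: "'g::group_add set \<Rightarrow> 'g set" where
  "words_span S = {sum_list W | W. set W \<subseteq> S}"

lemma wlen_Opp [simp]: "wlen (Opp ` S) (Opp g) = wlen S g"
  by (simp add: wlen_def Opp_words)

lemma words_span_Opp [simp]: "Opp g \<in> words_span (Opp ` S) \<longleftrightarrow> g \<in> words_span S"
proof -
  have *: "h \<in> words_span T \<longleftrightarrow> (\<exists>n W. set W \<subseteq> T \<and> length W = n \<and> sum_list W = h)"
    for h :: "'h::group_add" and T
    by (auto simp: words_span_def)
  show ?thesis by (simp only: * Opp_words)
qed

text \<open>\<open>words_span S\<close> is the submonoid generated by \<open>S\<close>. Its closure
  under inverses stands in for finiteness and strong connectedness.\<close>

locale thin =
  fixes S :: "'g::group_add set"
  assumes zero_notin: "0 \<notin> S"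
    and grp_minus: "g \<in> words_span S \<Longrightarrow> - g \<in> words_span S"
    and thin_inj: "\<lbrakk>g \<in> words_span S; h \<in> words_span S; wlen S g = wlen S h; wlen S (- g) = wlen S (- h)\<rbrakk>
      \<Longrightarrow> g = h"

lemma (in thin) thin_Opp: "thin (Opp ` S)"
proof
  show "0 \<notin> Opp ` S"
    using zero_notin by (auto simp: Opp_0[symmetric])
next
  fix g assume "g \<in> words_span (Opp ` S)"
  then show "- g \<in> words_span (Opp ` S)"
    by (cases g) (auto simp: Opp_minus[symmetric] grp_minus)
next
  fix g h assume "g \<in> words_span (Opp ` S)" "h \<in> words_span (Opp ` S)"
    "wlen (Opp ` S) g = wlen (Opp ` S) h" "wlen (Opp ` S) (- g) = wlen (Opp ` S) (- h)"
  then show "g = h"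
    by (cases g; cases h) (auto simp: Opp_minus[symmetric] intro: thin_inj)
qed

context thin
begin

abbreviation "d \<equiv> wlen S"
abbreviation e :: "'g \<Rightarrow> nat" where "e g \<equiv> wlen S (- g)"
abbreviation "grp \<equiv> words_span S"

lemma grp_word: "set W \<subseteq> S \<Longrightarrow> sum_list W \<in> grp"
  by (auto simp: words_span_def)

lemma grp_zero [simp, intro]: "0 \<in> grp"
  using grp_word[of "[]"] by simp

lemma grp_letter [intro]: "a \<in> S \<Longrightarrow> a \<in> grp"
  using grp_word[of "[a]"] by simp

lemma grp_add [intro]: "g \<in> grp \<Longrightarrow> h \<in> grp \<Longrightarrow> g + h \<in> grp"
  unfolding words_span_def by clarsimp (metis Un_least set_append sum_list_append)

lemma grp_rep [intro]: "a \<in> grp \<Longrightarrow> rep n a \<in> grp"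
  by (induction n) auto

lemma d_le: "set W \<subseteq> S \<Longrightarrow> sum_list W = g \<Longrightarrow> d g \<le> length W"
  unfolding wlen_def by (rule Least_le) auto

lemma d_word: "g \<in> grp \<Longrightarrow> \<exists>W. set W \<subseteq> S \<and> length W = d g \<and> sum_list W = g"
  unfolding wlen_def by (rule LeastI_ex) (auto simp: words_span_def)

lemma e_le: "set R \<subseteq> S \<Longrightarrow> g + sum_list R = 0 \<Longrightarrow> e g \<le> length R"
  by (rule d_le) (auto simp: add_eq_0_iff)

lemma e_word: "g \<in> grp \<Longrightarrow> \<exists>R. set R \<subseteq> S \<and> length R = e g \<and> g + sum_list R = 0"
  using d_word[OF grp_minus] by (metis add.right_inverse)

lemma d_add: "g \<in> grp \<Longrightarrow> h \<in> grp \<Longrightarrow> d (g + h) \<le> d g + d h"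
  by (metis d_le d_word length_append set_append sum_list_append Un_least)

lemma e_add_right: "g \<in> grp \<Longrightarrow> h \<in> grp \<Longrightarrow> e g \<le> d h + e (g + h)"
  using d_add[of h "- (g + h)"] grp_minus[OF grp_add, of g h] add_minus_cancel[of h "- g"]
  by (simp add: minus_add)

lemma e_add_left: "g \<in> grp \<Longrightarrow> h \<in> grp \<Longrightarrow> e h \<le> e (g + h) + d g"
  using d_add[of "- (g + h)" g] grp_minus[OF grp_add, of g h] by (simp add: minus_add add.assoc)

lemma d_zero [simp]: "d 0 = 0"
  using d_le[of "[]"] by simp

lemma d_eq_0: "g \<in> grp \<Longrightarrow> d g = 0 \<Longrightarrow> g = 0"
  using d_word[of g] by auto

lemma d_eq_1: "g \<in> grp \<Longrightarrow> d g = 1 \<Longrightarrow> g \<in> S"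
  using d_word[of g] by (auto simp: length_Suc_conv)

lemma d_letter [simp]: "a \<in> S \<Longrightarrow> d a = 1"
  using d_le[of "[a]" a] d_eq_0[of a] zero_notin
  by (metis One_nat_def add.right_neutral empty_subsetI insert_subset le_Suc_eq le_zero_eq length_Cons
      list.set(1) list.set(2) list.size(3) grp_letter sum_list.Cons sum_list.Nil)

lemma e_letter_inj: "a \<in> S \<Longrightarrow> b \<in> S \<Longrightarrow> e a = e b \<Longrightarrow> a = b"
  by (rule thin_inj) auto

lemma e_letter_pos: "a \<in> S \<Longrightarrow> e a \<ge> 1"
  using d_eq_0[of "- a"] zero_notin grp_minus[of a] by (cases "e a") auto

lemma d_pair: "a \<in> S \<Longrightarrow> b \<in> S \<Longrightarrow> a + b \<noteq> 0 \<Longrightarrow> a + b \<notin> S \<Longrightarrow> d (a + b) = 2"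
  using d_le[of "[a, b]" "a + b"] d_eq_0[of "a + b"] d_eq_1[of "a + b"]
  by (cases "d (a + b) = 0"; cases "d (a + b) = 1") auto

text \<open>\<open>d_pair\<close> gives both sums length 2, so thinness asks only for equal values
  of \<open>e\<close>. The price is to show that neither sum is a letter.\<close>

lemma pair_unique:
  assumes "a \<in> S" "b \<in> S" "a + b \<noteq> 0" "a + b \<notin> S" "a' \<in> S" "b' \<in> S" "a' + b' \<noteq> 0" "a' + b' \<notin> S"
    and "e (a + b) = e (a' + b')"
  shows "a + b = a' + b'"
  using assms by (intro thin_inj) (auto simp: d_pair)

lemma d_rep_le: "a \<in> S \<Longrightarrow> d (rep n a) \<le> n"
  using d_le[of "replicate n a" "rep n a"] by (auto simp: subset_iff)

text \<open>Rotating the closed word until \<open>a\<close> comes first leaves a word for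
  \<open>- a\<close> behind it.\<close>

lemma e_le_circuit: "set W \<subseteq> S \<Longrightarrow> sum_list W = 0 \<Longrightarrow> a \<in> set W \<Longrightarrow> Suc (e a) \<le> length W"
proof -
  assume W: "set W \<subseteq> S" "sum_list W = 0" "a \<in> set W"
  then obtain A B where AB: "W = A @ a # B" by (meson split_list)
  with W have "sum_list A + (a + sum_list B) = 0" by simp
  then have "a + sum_list (B @ A) = 0"
    using add_eq_zero_commute by (fastforce simp: add.assoc)
  then have "e a \<le> length (B @ A)"
    using W AB by (intro e_le) auto
  then show ?thesis using AB by simp
qed

lemma e_le_1_if_add_eq_0: "a \<in> S \<Longrightarrow> b \<in> S \<Longrightarrow> a + b = 0 \<Longrightarrow> e a \<le> 1 \<and> e b \<le> 1"
  using e_le_circuit[of "[a, b]" a] e_le_circuit[of "[a, b]" b] by simp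

text \<open>\<open>- a\<close> is \<open>rep (e a) a\<close>; a shorter word for
  \<open>rep j a\<close> would make \<open>- a\<close> shorter than \<open>e a\<close>.\<close>

lemma d_rep_pure:
  assumes "a \<in> S" "rep (Suc (e a)) a = 0" "j \<le> e a"
  shows "d (rep j a) = j"
proof -
  have "- a = rep (e a) a"
    using assms(2) by (metis add.inverse_unique rep.simps(2))
  also have "\<dots> = rep j a + rep (e a - j) a"
    using assms(3) by (simp add: rep_add[symmetric])
  finally have "- a = rep j a + rep (e a - j) a" .
  then have "e a \<le> d (rep j a) + d (rep (e a - j) a)"
    using d_add[of "rep j a" "rep (e a - j) a"] assms(1) by (simp add: grp_letter grp_rep)
  then have "e a \<le> d (rep j a) + (e a - j)"
    using d_rep_le[OF assms(1), of "e a - j"] by linarith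
  then show ?thesis using d_rep_le[OF assms(1), of j] assms(3) by linarith
qed

end

section \<open>Shortest circuits through a letter\<close>

context thin
begin

text \<open>For a letter this means that \<open>a\<close> repeated \<open>Suc (e a)\<close> times is
  a shortest circuit through it.\<close>

definition pure_letter :: "'g \<Rightarrow> bool" where
  "pure_letter a \<longleftrightarrow> rep (Suc (e a)) a = 0"

text \<open>The pattern of the generator 1 in \<open>Cay(Z_2n, {1, 2})\<close>: a shortest circuit
  is two copies of \<open>a\<close> followed by copies of \<open>a + a\<close>, and
  \<open>e a\<close> plays the role of n.\<close>

definition root_letter :: "'g \<Rightarrow> bool" where
  "root_letter a \<longleftrightarrow> a + a \<in> S \<and> Suc (e (a + a)) = e a \<and> rep (e a) (a + a) = 0"

text \<open>If \<open>l = y + u\<close> were a letter, \<open>R\<close> would be a shortest word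
  closing it, so the induction hypothesis describes \<open>l\<close>. Thinness then identifies sums
  formed from \<open>l\<close>, \<open>u\<close> and \<open>y\<close> until \<open>rep 3 l\<close>
  has length 3 and is also the double of a letter.\<close>

lemma neighbour_sum_not_letter:
  assumes IH: "\<And>l. l \<in> S \<Longrightarrow> e l < e y \<Longrightarrow> pure_letter l \<or> root_letter l"
    and y: "y \<in> S" and u: "u \<in> S" "u \<noteq> y"
    and R: "set R \<subseteq> S" "y + u + sum_list R = 0" "Suc (length R) = e y"
  shows "y + u \<notin> S"
proof
  define l where "l = y + u"
  define b where "b = e y"
  assume "y + u \<in> S"
  then have l: "l \<in> S" by (simp add: l_def)
  have b: "length R = b - 1" "b \<ge> 1" using R by (auto simp: b_def)
  have ne: "l \<noteq> y" "l \<noteq> u" "y \<noteq> 0" "u \<noteq> 0" "l \<noteq> 0"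
    using y u l zero_notin by (auto simp: l_def)
  have "e l \<le> b - 1" using e_le[of R l] R b by (simp add: l_def)
  moreover have "b \<le> 1 + e l"
    using e_add_right[of y u] y u by (simp add: l_def b_def grp_letter)
  ultimately have el: "Suc (e l) = b" using b by linarith
  have "Suc (e u) \<le> length (y # u # R)"
    using R y u by (intro e_le_circuit) (auto simp: add.assoc)
  then have "e u \<le> b" using b by simp
  moreover have "e u \<noteq> b" "e u \<noteq> e l" using e_letter_inj y u l ne by (auto simp: b_def)
  ultimately have eu: "e u < e l" using el by linarith
  then have b3: "b \<ge> 3" using e_letter_pos[OF u(1)] el by linarith
  have no0: "l + y \<noteq> 0" "l + l \<noteq> 0" "l + u \<noteq> 0"
    using e_le_1_if_add_eq_0[OF l y] e_le_1_if_add_eq_0[OF l l] e_le_1_if_add_eq_0[OF l u(1)] el b3 by auto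
  have ly_notin: "l + y \<notin> S" if "e (l + y) = e l"
    using e_letter_inj[OF _ l that] ne by auto
  have e_y_ge: "b \<le> 1 + e (a + y)" if "a \<in> S" for a
    using e_add_left[of a y] that y by (simp add: b_def grp_letter)
  \<comment> \<open>If \<open>l\<close> were a root, \<open>l + y\<close> and
    \<open>l + l + y\<close> would share their value of \<open>e\<close> without being letters,
    hence coincide.\<close>
  have "pure_letter l"
  proof (rule ccontr)
    assume "\<not> pure_letter l"
    then have root: "root_letter l" using IH[OF l] el by (auto simp: b_def)
    define x where "x = l + l"
    have x: "x \<in> S" "Suc (e x) = e l" "rep (e l) x = 0"
      using root by (auto simp: root_letter_def x_def)
    have xl: "x + l = l + x" by (simp add: x_def add.assoc)
    obtain k where k: "e l = Suc (Suc k)"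
      using el b3 by (intro that[of "e l - 2"]) simp
    have rot: "y + u + (l + rep (Suc k) x) = 0"
      using x(3) by (simp add: k l_def[symmetric] x_def add.assoc)
    have rot': "y + u + (rep (Suc k) x + l) = 0"
      using rot add_commute_rep[OF xl[symmetric], of "Suc k"] by (simp only:)
    have "l + y + sum_list (u # replicate (Suc k) x) = 0"
      using add_eq_zero_commute[of "y + u + rep (Suc k) x" l] rot' by (simp add: add.assoc)
    then have "e (l + y) \<le> length (u # replicate (Suc k) x)"
      using x u by (intro e_le) auto
    then have ely: "e (l + y) = e l" using e_y_ge[OF l] el k by simp
    have "x + y + sum_list (u # l # replicate k x) = 0"
      using add_eq_zero_commute[of "y + u + (l + rep k x)" x] rot
      by (simp add: add.assoc)
    then have "e (x + y) \<le> length (u # l # replicate k x)"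
      using x u l by (intro e_le) auto
    then have exy: "e (x + y) = e l" using e_y_ge[OF x(1)] el k by simp
    have "x + y \<notin> S"
    proof
      assume "x + y \<in> S"
      then have "x + y = l" using e_letter_inj exy l by blast
      then show False using no0(1) by (simp add: x_def add.assoc)
    qed
    moreover have "x + y \<noteq> 0"
      using e_le_1_if_add_eq_0[OF x(1) y] b3 by (auto simp: b_def)
    ultimately have "x + y = l + y"
      using pair_unique[of x y l y] x y l no0 ly_notin[OF ely] ely exy by simp
    then show False using ne by (simp add: x_def)
  qed
  then have pl: "rep b l = 0" using el by (simp add: pure_letter_def)
  obtain k where k: "b = Suc (Suc (Suc k))"
    using b3 by (intro that[of "b - 3"]) simp
  have rot: "y + u + (l + (l + rep k l)) = 0"
    using pl by (simp add: k l_def add.assoc)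
  have "l + y + sum_list (u # replicate (Suc k) l) = 0"
    using rot add_eq_zero_commute[of "y + u + (l + rep k l)" l] by (simp add: add.assoc)
  then have "e (l + y) \<le> length (u # replicate (Suc k) l)"
    using l u by (intro e_le) auto
  then have ely: "e (l + y) = e l" using e_y_ge[OF l] el k by simp
  have "- y = u + l + rep (Suc k) l"
    using rot minus_unique[of y "u + l + rep (Suc k) l"] by (simp add: add.assoc)
  then have "b \<le> d (u + l) + d (rep (Suc k) l)"
    using d_add[of "u + l" "rep (Suc k) l"] u l
    by (simp add: b_def grp_add grp_letter grp_rep del: rep.simps)
  then have "2 \<le> d (u + l)" using d_rep_le[OF l, of "Suc k"] k by linarith
  moreover have "d (u + l) \<le> 2" using d_le[of "[u, l]"] u l by simp
  ultimately have dul: "d (u + l) = 2" by simp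
  have dll: "d (rep 2 l) = 2"
    using d_rep_pure[OF l, of 2] pl el k by (simp add: numeral_2_eq_2)
  have "u + l + sum_list (replicate (Suc k) l @ [y]) = 0"
    using rot add_eq_zero_commute[of y "u + (l + (l + rep k l))"] by (simp add: add.assoc)
  then have "e (u + l) \<le> length (replicate (Suc k) l @ [y])"
    using l y by (intro e_le) auto
  then have eul: "e (u + l) \<le> e l" using el k by simp
  have eul': "e l \<le> 1 + e (u + l)" using e_add_left[of u l] u l by (simp add: grp_letter)
  have "l + l + sum_list (replicate (Suc k) l) = 0"
    using pl k by (simp add: add.assoc)
  then have "e (l + l) \<le> length (replicate (Suc k) l)"
    using l by (intro e_le) auto
  moreover have "e l \<le> 1 + e (l + l)" using e_add_left[of l l] l by (simp add: grp_letter)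
  ultimately have ell: "Suc (e (l + l)) = e l" using el k by simp
  have ll: "d (l + l) = 2" using dll by (simp add: numeral_2_eq_2)
  have spans: "u + l \<in> grp" "l + l \<in> grp" "l + y \<in> grp" "l + u \<in> grp" using u l y by auto
  \<comment> \<open>Of the two values still possible for \<open>e (u + l)\<close>, the smaller one
    belongs to \<open>l + l\<close>; the larger one is shared with \<open>l + y\<close>.\<close>
  have "e (u + l) \<noteq> e (l + l)"
    using thin_inj[OF spans(1,2)] dul ll ne by auto
  then have "e (u + l) = e l" using eul eul' ell by linarith
  then have ul: "u + l = l + y"
    using thin_inj[OF spans(1,3)] dul d_pair[OF l y no0(1) ly_notin[OF ely]] ely by simp
  \<comment> \<open>Replace \<open>u + l\<close> by \<open>l + y\<close> and read
    \<open>y + u\<close> as \<open>l\<close>.\<close>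
  have lul: "u + l + u = l + l"
    using ul by (simp add: l_def add.assoc)
  have "l + u + sum_list (replicate (Suc k) l @ [u]) = 0"
  proof -
    have "u + (l + u) + rep (Suc k) l = 0"
      using pl lul by (simp add: k add.assoc[symmetric])
    then show ?thesis
      using add_eq_zero_commute[of u "l + u + rep (Suc k) l"] by (simp add: add.assoc)
  qed
  then have "e (l + u) \<le> length (replicate (Suc k) l @ [u])"
    using l u by (intro e_le) auto
  then have elu: "e (l + u) \<le> e l" using el k by simp
  have elu': "e l \<le> 1 + e (l + u)" using e_add_right[of l u] u l by (simp add: grp_letter)
  \<comment> \<open>As a sum of length 2, \<open>l + u\<close> would have to agree with
    \<open>l + l\<close> or with \<open>l + y\<close>.\<close>
  have "l + u \<in> S"
  proof (rule ccontr)
    assume "l + u \<notin> S"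
    then have dlu: "d (l + u) = 2" using d_pair l u no0 by blast
    have "e (l + u) \<noteq> e (l + l)"
      using thin_inj[OF spans(4,2)] dlu ll ne by auto
    then have "e (l + u) = e (l + y)" using elu elu' ell ely by linarith
    then have "l + u = l + y"
      using thin_inj[OF spans(4,3)] dlu d_pair[OF l y no0(1) ly_notin[OF ely]] by simp
    then show False using u by simp
  qed
  moreover have "e (l + u) \<noteq> e l" using e_letter_inj[OF calculation l] ne by auto
  moreover have "e (l + u) \<noteq> e u" using e_letter_inj[OF calculation(1) u(1)] ne by auto
  \<comment> \<open>Now \<open>e (l + u) = e l - 1\<close>, and \<open>e u\<close> is strictly below
    this value and at least 1.\<close>
  ultimately have "e l \<ge> 3" using eu elu elu' e_letter_pos[OF u(1)] by linarith
  then have "d (rep 3 l) = 3"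
    using d_rep_pure[OF l, of 3] pl el k by simp
  moreover have "l + u + (l + u) = rep 3 l"
    using lul by (simp add: numeral_3_eq_3 add.assoc)
  moreover have "d (l + u + (l + u)) \<le> 2"
    using d_add[of "l + u" "l + u"] \<open>l + u \<in> S\<close> by (simp add: grp_letter)
  ultimately show False by simp
qed

end

lemma rep_Opp: "rep n (Opp a) = Opp (rep n a)"
  by (induction n) (simp_all add: Opp_0 Opp_add[symmetric])

lemma sum_list_two_letters:
  assumes "a + b = b + a" "a \<noteq> b" "set W \<subseteq> {a, b}"
  shows "sum_list W = rep (count_list W a) a + rep (count_list W b) (b :: 'g::group_add)"
    and "length W = count_list W a + count_list W b"
proof -
  show "sum_list W = rep (count_list W a) a + rep (count_list W b) b"
    using assms(3)
  proof (induction W)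
    case (Cons c W)
    have "b + (rep n a + g) = rep n a + (b + g)" for n g
      using add_commute_rep[OF assms(1)[symmetric], of n] by (simp add: add.assoc[symmetric])
    then show ?case using Cons assms(2) by (auto simp: add.assoc)
  qed simp
  show "length W = count_list W a + count_list W b"
    using assms(2,3) by (induction W) auto
qed

context thin
begin

lemma neighbour_sum_not_letter_left:
  assumes IH: "\<And>l. l \<in> S \<Longrightarrow> e l < e y \<Longrightarrow> pure_letter l \<or> root_letter l"
    and y: "y \<in> S" and u: "u \<in> S" "u \<noteq> y"
    and R: "set R \<subseteq> S" "u + y + sum_list R = 0" "Suc (length R) = e y"
  shows "u + y \<notin> S"
proof -
  interpret opp: thin "Opp ` S" by (rule thin_Opp)
  have e: "opp.e (Opp a) = e a" for a by (simp add: Opp_minus[symmetric])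
  have "Opp y + Opp u \<notin> Opp ` S"
  proof (rule opp.neighbour_sum_not_letter[where R = "map Opp (rev R)"])
    fix l assume "l \<in> Opp ` S" "opp.e l < opp.e (Opp y)"
    then obtain a where a: "l = Opp a" "a \<in> S" "e a < e y" by (auto simp: e)
    then show "opp.pure_letter l \<or> opp.root_letter l"
      using IH[OF a(2,3)]
      by (auto simp: pure_letter_def root_letter_def opp.pure_letter_def opp.root_letter_def e rep_Opp
          Opp_0[symmetric] Opp_add[symmetric] simp del: rep.simps)
  next
    have "sum_list R + (u + y) = 0" using R(2) by (rule add_eq_zero_commute)
    then show "Opp y + Opp u + sum_list (map Opp (rev R)) = 0"
      by (simp add: sum_list_Opp Opp_0[symmetric] Opp_add[symmetric])
  qed (use y u R in \<open>auto simp: e\<close>)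
  then show ?thesis by (auto simp: Opp_add[symmetric])
qed

text \<open>Copies of a pure letter can be reduced by a full circuit; for a root, two copies merge
  into one letter.\<close>

lemma d_rep_less:
  assumes "u \<in> S" "pure_letter u \<or> root_letter u" "n > e u" "n \<ge> 2"
  shows "d (rep n u) < n"
  using assms(2)
proof
  assume "pure_letter u"
  then have "rep n u = rep (n - Suc (e u)) u"
    using assms(3) rep_add[of "Suc (e u)" "n - Suc (e u)" u] by (simp add: pure_letter_def)
  then show ?thesis using d_rep_le[OF assms(1), of "n - Suc (e u)"] assms(3) by simp
next
  assume "root_letter u"
  then have uu: "u + u \<in> S" by (simp add: root_letter_def)
  obtain k where k: "n = Suc (Suc k)" using assms(4) by (intro that[of "n - 2"]) simp
  have "d (rep n u) \<le> length ((u + u) # replicate k u)"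
    using uu assms(1) by (intro d_le) (auto simp: k add.assoc)
  then show ?thesis by (simp add: k)
qed

text \<open>
  All neighbours of \<open>y\<close> in a shortest circuit give the same sum, so the letters after \<open>y\<close> and before \<open>y\<close> can be
  traded for each other until the circuit is seen to involve only \<open>y\<close> and one further commuting letter.
\<close>

lemma nonpure_circuit:
  assumes IH: "\<And>l. l \<in> S \<Longrightarrow> e l < e y \<Longrightarrow> pure_letter l \<or> root_letter l"
    and y: "y \<in> S" and R: "set R \<subseteq> S" "y + sum_list R = 0" "length R = e y"
    and a: "a \<in> set R" "a \<noteq> y"
  shows "root_letter y \<and> set R \<subseteq> {y, y + y}"
proof -
  define b where "b = e y"
  define C where "C W \<longleftrightarrow> set W \<subseteq> S \<and> sum_list W = 0 \<and> length W = Suc b" for W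
  have C_rot: "C (A @ B) \<Longrightarrow> C (B @ A)" for A B
    using add_eq_zero_commute[of "sum_list A" "sum_list B"] by (auto simp: C_def)
  have e_C: "e c \<le> b" if "C W" "c \<in> set W" for c W
    using e_le_circuit[of W c] that by (auto simp: C_def)
  have CyR: "C (y # R)" using R y by (auto simp: C_def b_def)
  have "e a \<le> b" using e_C[OF CyR] a by auto
  moreover have "e a \<noteq> b" using e_letter_inj[of a y] a y R by (auto simp: b_def)
  ultimately have b2: "b \<ge> 2" using e_letter_pos[of a] a R by fastforce
  have nz: "y + c \<noteq> 0" "c + y \<noteq> 0" if "c \<in> S" for c
    using e_le_1_if_add_eq_0[of y c] e_le_1_if_add_eq_0[of c y] that y b2 by (auto simp: b_def)
  have e_right: "e (y + c) = b - 1" if "C (y # c # Q)" for c Q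
  proof -
    have "e (y + c) \<le> length Q"
      using that by (intro e_le) (auto simp: C_def add.assoc)
    moreover have "b \<le> 1 + e (y + c)"
      using e_add_right[of y c] that by (auto simp: C_def b_def grp_letter)
    ultimately show ?thesis using that by (auto simp: C_def)
  qed
  have e_left: "e (c + y) = b - 1" if "C (c # y # Q)" for c Q
  proof -
    have "e (c + y) \<le> length Q"
      using that by (intro e_le) (auto simp: C_def add.assoc)
    moreover have "b \<le> 1 + e (c + y)"
      using e_add_left[of c y] that by (auto simp: C_def b_def grp_letter)
    ultimately show ?thesis using that by (auto simp: C_def)
  qed
  have right: "y + c \<notin> S" if "C (y # c # Q)" "c \<noteq> y" for c Q
    using that by (intro neighbour_sum_not_letter[OF IH y, where R = Q]) (auto simp: C_def add.assoc b_def)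
  have left: "c + y \<notin> S" if "C (c # y # Q)" "c \<noteq> y" for c Q
    using that by (intro neighbour_sum_not_letter_left[OF IH y, where R = Q]) (auto simp: C_def add.assoc b_def)
  have right_unique: "c = c'" if "C (y # c # Q)" "c \<noteq> y" "C (y # c' # Q')" "c' \<noteq> y" for c c' Q Q'
    using pair_unique[of y c y c'] right[OF that(1,2)] right[OF that(3,4)] that y nz e_right[OF that(1)] e_right[OF that(3)]
    by (auto simp: C_def)
  have left_right: "c' + y = y + c" if "C (y # c # Q)" "c \<noteq> y" "C (c' # y # Q')" "c' \<noteq> y" for c c' Q Q'
    using right[OF that(1,2)] left[OF that(3,4)] that y nz e_right[OF that(1)] e_left[OF that(3)]
    by (intro pair_unique) (auto simp: C_def)
  obtain u Q where uQ: "C (y # u # Q)" "u \<noteq> y"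
  proof -
    obtain A u B where AB: "R = A @ u # B" "u \<noteq> y" "\<forall>c \<in> set A. \<not> c \<noteq> y"
      using split_list_first_prop[of R "\<lambda>c. c \<noteq> y"] a by blast
    have "last (y # A) = y" using last_in_set[of "y # A"] AB(3) by auto
    then have "y # R = butlast (y # A) @ y # u # B"
      using append_butlast_last_id[of "y # A"] AB(1) by (metis append.assoc append_Cons append_Nil list.distinct(1))
    then have "C (y # u # B @ butlast (y # A))" using CyR C_rot[of "butlast (y # A)" "y # u # B"] by simp
    then show ?thesis using AB(2) that by blast
  qed
  obtain w Q' where wQ: "C (w # y # Q')" "w \<noteq> y"
  proof -
    have 1: "C (u # Q @ [y])" using uQ C_rot[of "[y]" "u # Q"] by simp
    obtain A B where AB: "Q @ [y] = A @ y # B" "y \<notin> set A"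
      using split_list_first[of y "Q @ [y]"] by auto
    define w where "w = last (u # A)"
    have w: "w \<noteq> y" using last_in_set[of "u # A"] AB(2) uQ(2) by (auto simp: w_def)
    have "u # Q @ [y] = butlast (u # A) @ w # y # B"
      using append_butlast_last_id[of "u # A"] AB(1) by (metis append.assoc append_Cons append_Nil list.distinct(1) w_def)
    then have "C (w # y # B @ butlast (u # A))" using 1 C_rot[of "butlast (u # A)" "w # y # B"] by simp
    then show ?thesis using w that by blast
  qed
  have wy: "w + y = y + u" by (rule left_right[OF uQ wQ])
  have wS: "w \<in> S" and uS: "u \<in> S" using wQ uQ by (auto simp: C_def)
  \<comment> \<open>Rewriting \<open>y u\<close> as \<open>w y\<close> moves \<open>y\<close> one
    place to the right and leaves a \<open>w\<close> behind. Either another \<open>y\<close> follows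
    the \<open>u\<close>, so that \<open>u\<close> too is a left neighbour of \<open>y\<close>, or
    \<open>y\<close> reaches the end and is followed cyclically by \<open>w\<close>. Both give
    \<open>w = u\<close>.\<close>
  have "w = u" if "C (replicate i w @ y # u # P)" for i P
    using that
  proof (induction P arbitrary: i)
    case Nil
    have "sum_list (replicate (Suc i) w @ [y]) = rep i w + (w + y)"
      by (simp add: add.assoc)
    also have "\<dots> = 0" using Nil.prems unfolding wy by (simp add: C_def add.assoc)
    finally have "C (replicate (Suc i) w @ [y])" using Nil wS by (auto simp: C_def add.assoc)
    then have "C (y # w # replicate i w)" using C_rot[of "replicate (Suc i) w" "[y]"] by simp
    then show ?case using right_unique uQ wQ(2) by blast
  next
    case (Cons q P)
    have "sum_list (replicate (Suc i) w @ y # q # P) = rep i w + (w + y) + q + sum_list P"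
      by (simp add: add.assoc)
    also have "\<dots> = 0" using Cons.prems unfolding wy by (simp add: C_def add.assoc)
    finally have 1: "C (replicate (Suc i) w @ y # q # P)"
      using Cons.prems wS by (auto simp: C_def add.assoc)
    then have 2: "C (y # q # P @ replicate (Suc i) w)" using C_rot[of "replicate (Suc i) w" "y # q # P"] by simp
    show ?case
    proof (cases "q = y")
      case True
      then have "C (u # y # P @ replicate i w @ [y])"
        using Cons.prems C_rot[of "replicate i w @ [y]" "u # q # P"] by simp
      then have "u + y = y + u" using left_right uQ by blast
      then show ?thesis using wy by (metis add_right_cancel)
    next
      case False
      then have "q = u" using right_unique[OF 2 False uQ] by simp
      then show ?thesis using Cons.IH[of "Suc i"] 1 by simp
    qed
  qed
  from this[of 0 Q] uQ(1) wy have uy: "u + y = y + u" by simp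
  \<comment> \<open>As \<open>u\<close> commutes with \<open>y\<close>, each \<open>u\<close> met
    after \<open>y\<close> is moved in front of it, so that every position in turn becomes the
    successor of \<open>y\<close>.\<close>
  have letters: "set P \<subseteq> {y, u}" if "C (A @ y # P)" "set A \<subseteq> {y, u}" for A P
    using that
  proof (induction P arbitrary: A)
    case (Cons q P)
    have "C (y # q # P @ A)" using Cons.prems C_rot[of A "y # q # P"] by simp
    then have q: "q = y \<or> q = u" using right_unique uQ by blast
    then show ?case
    proof
      assume "q = y"
      then show ?thesis using Cons.IH[of "A @ [y]"] Cons.prems by simp
    next
      assume qu: "q = u"
      have "y + (u + g) = u + (y + g)" for g using uy by (metis add.assoc)
      then have "C ((A @ [u]) @ y # P)" using Cons.prems qu by (auto simp: C_def)
      then show ?thesis using Cons.IH[of "A @ [u]"] Cons.prems qu by simp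
    qed
  qed simp
  from letters[of "[]" R] CyR have RR: "set R \<subseteq> {y, u}" by simp
  define q p where "q = count_list (y # u # Q) y" and "p = count_list (y # u # Q) u"
  have W: "set (y # u # Q) \<subseteq> {y, u}" using letters[of "[]" "u # Q"] uQ by auto
  have pq1: "q \<ge> 1" "p \<ge> 1" by (auto simp: q_def p_def)
  have sum: "rep q y + rep p u = 0" and pq: "p + q = Suc b"
    using sum_list_two_letters[of y u, OF uy[symmetric] _ W] uQ unfolding q_def p_def by (auto simp: C_def)
  have eu: "e u < b" using e_C[OF uQ(1), of u] e_letter_inj[of u y] uS y uQ(2) by (force simp: b_def)
  then have du: "pure_letter u \<or> root_letter u" using IH uS by (simp add: b_def)
  \<comment> \<open>With a single \<open>y\<close>, \<open>- y\<close> would be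
    \<open>rep b u\<close>, but more than \<open>e u\<close> copies of \<open>u\<close> can be
    shortened.\<close>
  have q2: "q \<noteq> 1"
  proof
    assume "q = 1"
    then have "y + rep b u = 0" using sum pq by simp
    then have "- y = rep b u" by (rule minus_unique)
    then show False using d_rep_less[OF uS du eu b2] by (simp add: b_def)
  qed
  then obtain k where k: "q = Suc (Suc k)" using pq1(1) by (intro that[of "q - 2"]) simp
  have "e (y + y) = b - 1"
    using sum pq y uS by (intro e_right[of y "replicate k y @ replicate p u"]) (auto simp: C_def k add.assoc)
  \<comment> \<open>Otherwise \<open>y + y\<close> would coincide with \<open>y + u\<close>.\<close>
  then have "y + y \<in> S"
    using pair_unique[of y y y u] right[OF uQ] e_right[OF uQ(1)] y uS nz uQ(2) by auto
  note eyy = \<open>e (y + y) = b - 1\<close>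
  \<comment> \<open>A third \<open>y\<close> would lie on the shorter circuit in which two copies
    are merged into \<open>y + y\<close>.\<close>
  have k0: "k = 0"
  proof (rule ccontr)
    assume "k \<noteq> 0"
    then have "Suc (e y) \<le> length ((y + y) # replicate k y @ replicate p u)"
      using sum y uS \<open>y + y \<in> S\<close> by (intro e_le_circuit) (auto simp: k add.assoc)
    then show False using pq by (simp add: k b_def)
  qed
  \<comment> \<open>If they differed, \<open>e u\<close> would be below \<open>b - 1\<close>, and
    \<open>- (y + y) = rep (b - 1) u\<close> could be shortened below
    \<open>e (y + y)\<close>.\<close>
  have yu: "y + y = u"
  proof (rule ccontr)
    assume ne: "y + y \<noteq> u"
    then have "e u \<noteq> b - 1" using e_letter_inj[of "y + y" u] \<open>y + y \<in> S\<close> eyy uS by auto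
    then have eu': "e u < b - 1" using eu by linarith
    then have "b - 1 \<ge> 2" using e_letter_pos[OF uS] by linarith
    have "y + y + rep (b - 1) u = 0" using sum pq by (auto simp: k k0 add.assoc)
    then have "- (y + y) = rep (b - 1) u" by (rule minus_unique)
    then show False using d_rep_less[OF uS du eu' \<open>b - 1 \<ge> 2\<close>] eyy by simp
  qed
  note \<open>y + y \<in> S\<close>
  moreover have "rep b (y + y) = 0"
    using sum pq b2 yu by (cases b) (auto simp: k k0 add.assoc)
  moreover have "Suc (e (y + y)) = e y" using eyy b2 by (simp add: b_def)
  moreover have "set R \<subseteq> {y, y + y}" using RR unfolding yu .
  ultimately show ?thesis unfolding root_letter_def b_def by blast
qed

lemma pure_if_circuit: "length R = e y \<Longrightarrow> y + sum_list R = 0 \<Longrightarrow> set R \<subseteq> {y} \<Longrightarrow> pure_letter y"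
proof -
  assume R: "length R = e y" "y + sum_list R = 0" "set R \<subseteq> {y}"
  have "R = replicate (e y) y" using R(1,3) by (intro replicate_eqI) auto
  then have "sum_list R = rep (e y) y" by (metis sum_list_replicate_rep)
  then show ?thesis using R(2) by (simp add: pure_letter_def)
qed

lemma pure_or_root: "y \<in> S \<Longrightarrow> pure_letter y \<or> root_letter y"
proof (induction "e y" arbitrary: y rule: less_induct)
  case less
  obtain R where R: "set R \<subseteq> S" "length R = e y" "y + sum_list R = 0"
    using e_word[of y] less.prems by auto
  then show ?case
    using nonpure_circuit[OF less.hyps less.prems R(1,3,2)] pure_if_circuit[OF R(2,3)] by blast
qed

lemma circuit_letters:
  assumes "y \<in> S" "set R \<subseteq> S" "y + sum_list R = 0" "length R = e y"
  shows "set R \<subseteq> {y} \<or> root_letter y \<and> set R \<subseteq> {y, y + y}"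
  using nonpure_circuit[OF pure_or_root assms] by blast

text \<open>Two of the \<open>e y\<close> copies of \<open>y\<close> that make up \<open>- y\<close>
  would merge into one letter.\<close>

lemma not_pure_if_double: "y \<in> S \<Longrightarrow> y + y \<in> S \<Longrightarrow> \<not> pure_letter y"
proof
  assume y: "y \<in> S" "y + y \<in> S" and p: "pure_letter y"
  have "e y \<noteq> 1" using p y(2) zero_notin by (auto simp: pure_letter_def)
  then obtain k where k: "e y = Suc (Suc k)" using e_letter_pos[OF y(1)] by (intro that[of "e y - 2"]) simp
  have "y + sum_list ((y + y) # replicate k y) = 0"
    using p by (simp add: pure_letter_def k add.assoc)
  then have "e y \<le> length ((y + y) # replicate k y)" using y by (intro e_le) auto
  then show False by (simp add: k)
qed

lemma pure_letter_iff: "y \<in> S \<Longrightarrow> pure_letter y \<longleftrightarrow> y + y \<notin> S"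
  using pure_or_root not_pure_if_double by (auto simp: root_letter_def)

lemma root_letter_iff: "y \<in> S \<Longrightarrow> root_letter y \<longleftrightarrow> y + y \<in> S"
  using pure_or_root not_pure_if_double by (auto simp: root_letter_def)

lemma pure_circuit:
  assumes "y \<in> S" "y + y \<notin> S" "set R \<subseteq> S" "y + sum_list R = 0" "length R = e y"
  shows "set R \<subseteq> {y}"
  using circuit_letters[OF assms(1,3,4,5)] assms(2) by (auto simp: root_letter_def)

text \<open>The third fact says that doubling cannot be iterated inside \<open>S\<close>:
  \<open>y + y\<close> is pure because \<open>Suc (e (y + y))\<close> copies of it sum to 0.\<close>

lemma root_props:
  assumes "y \<in> S" "y + y \<in> S"
  shows "Suc (e (y + y)) = e y" "rep (e y) (y + y) = 0" "y + y + (y + y) \<notin> S" "e y \<ge> 2"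
proof -
  show 1: "Suc (e (y + y)) = e y" "rep (e y) (y + y) = 0"
    using assms root_letter_iff[of y] by (auto simp: root_letter_def)
  then have "pure_letter (y + y)" by (simp add: pure_letter_def)
  then show "y + y + (y + y) \<notin> S" using pure_letter_iff assms by blast
  show "e y \<ge> 2" using 1 e_letter_pos[OF assms(2)] by linarith
qed

lemma root_unique: "y \<in> S \<Longrightarrow> y' \<in> S \<Longrightarrow> y + y = y' + y' \<Longrightarrow> y + y \<in> S \<Longrightarrow> y = y'"
  using e_letter_inj[of y y'] root_props(1)[of y] root_props(1)[of y'] by auto

end

section \<open>Letters of order two are central\<close>

lemma add_commute_sum_list:
  "(\<And>b. b \<in> set W \<Longrightarrow> a + b = b + a) \<Longrightarrow> a + sum_list W = sum_list W + (a :: 'g::group_add)"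
proof (induction W)
  case (Cons b W)
  then have "a + (b + sum_list W) = b + (a + sum_list W)"
    by (metis add.assoc list.set_intros(1))
  then show ?case using Cons by (simp add: add.assoc)
qed simp

context thin
begin

text \<open>\<open>- s\<close> is a letter, and its value of \<open>e\<close> is the length of
  \<open>s\<close>, which is 1 as well.\<close>

lemma involution_if_e_eq_1:
  assumes "s \<in> S" "e s = 1"
  shows "s + s = 0"
proof -
  have "- s \<in> S" using assms by (intro d_eq_1 grp_minus) auto
  moreover have "e (- s) = 1" using assms by simp
  ultimately have "- s = s" using assms by (intro e_letter_inj) auto
  then show ?thesis by (metis left_minus)
qed

lemma e_add: "g \<in> grp \<Longrightarrow> h \<in> grp \<Longrightarrow> e (g + h) \<le> e h + e g"
  using d_add[of "- h" "- g"] grp_minus by (simp add: minus_add)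

text \<open>If \<open>e (s + t)\<close> exceeds \<open>e t\<close>, subadditivity suffices.
  Otherwise every letter of a shortest word closing \<open>s + t\<close> commutes with
  \<open>s\<close> or equals \<open>t\<close>. Rotate \<open>s\<close> to the end of that circuit
  and move it left as far as the last \<open>t\<close>; this gives an equally long circuit beginning
  with \<open>t\<close>, \<open>s\<close>.\<close>

lemma e_add_involution_le:
  assumes IH: "\<And>l. l \<in> S \<Longrightarrow> e l < e t \<Longrightarrow> s + l = l + s"
    and s: "s \<in> S" "e s = 1" and t: "t \<in> S" "t \<noteq> s"
  shows "e (t + s) \<le> e (s + t)"
proof (cases "e (s + t) \<le> e t")
  case False
  then show ?thesis using e_add[of t s] s t by (simp add: grp_letter)
next
  case True
  obtain R where R: "set R \<subseteq> S" "length R = e (s + t)" "s + t + sum_list R = 0"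
    using e_word[of "s + t"] s t by auto
  have comm: "s + l = l + s \<or> l = t" if l: "l \<in> set R" for l
  proof -
    have lS: "l \<in> S" using l R by blast
    have "Suc (e l) \<le> length (s # t # R)"
      using R s t l by (intro e_le_circuit) (auto simp: add.assoc)
    then have le: "e l \<le> Suc (e (s + t))" using R by simp
    then consider "e l < e t" | "e l = e t" | "e l = Suc (e t)" "e (s + t) = e t"
      using True by linarith
    then show ?thesis
    proof cases
      \<comment> \<open>The circuit is now a shortest one through \<open>l\<close>, so it contains
        at most \<open>l + l\<close> besides; but \<open>s\<close> and \<open>t\<close> are two
        distinct letters other than \<open>l\<close>.\<close>
      case 3
      obtain A B where AB: "s # t # R = A @ l # B" using l split_list[of l "s # t # R"] by auto
      have "sum_list (s # t # R) = 0" using R by (simp add: add.assoc)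
      then have "sum_list A + (l + sum_list B) = 0" unfolding AB by simp
      then have "l + sum_list (B @ A) = 0"
        using add_eq_zero_commute[of "sum_list A" "l + sum_list B"] by (simp add: add.assoc)
      moreover have "set (s # t # R) \<subseteq> S" using R s t by simp
      then have "set (B @ A) \<subseteq> S" unfolding AB by auto
      moreover have "length (s # t # R) = Suc (e l)" using R 3 by simp
      then have "length (B @ A) = e l" unfolding AB by simp
      ultimately have "set (B @ A) \<subseteq> {l, l + l}" using circuit_letters[OF lS] by blast
      moreover have "s \<noteq> l" "t \<noteq> l" using 3 s e_letter_pos[OF t(1)] by auto
      moreover have "set (s # t # R) = set (A @ l # B)" using AB by simp
      then have "{s, t} \<subseteq> insert l (set (B @ A))" by auto
      ultimately show ?thesis using t by auto
    qed (use IH lS e_letter_inj t in auto)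
  qed
  obtain A B where AB: "t # R = A @ t # B" "t \<notin> set B"
    using split_list_last[of t "t # R"] by auto
  have "length (t # R) = length (A @ t # B)" using AB by simp
  then have len: "length (B @ A) = length R" by simp
  have "set (t # R) = set (A @ t # B)" using AB by simp
  then have sets: "set B \<subseteq> insert t (set R)" "set (B @ A) \<subseteq> S" using R t by auto
  have sB: "s + sum_list B = sum_list B + s"
    using comm sets AB(2) by (intro add_commute_sum_list) auto
  have "sum_list (t # R) = sum_list (A @ t # B)" using AB by simp
  then have "s + (sum_list A + (t + sum_list B)) = 0" using R by (simp add: add.assoc)
  then have "sum_list A + (t + (sum_list B + s)) = 0"
    using add_eq_zero_commute[of s "sum_list A + (t + sum_list B)"] by (simp add: add.assoc)
  then have "sum_list A + (t + (s + sum_list B)) = 0" by (simp add: sB)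
  then have "t + s + sum_list (B @ A) = 0"
    using add_eq_zero_commute[of "sum_list A" "t + (s + sum_list B)"] by (simp add: add.assoc)
  then show ?thesis using e_le[OF sets(2)] len R by simp
qed

text \<open>If the sums differed, \<open>l = s + t\<close> would be a pure letter with
  \<open>e l = Suc (e t)\<close>, and no shortest circuit through it could contain \<open>s\<close>.
  This forces \<open>e (l + s) = e l = e (t + s)\<close>, hence
  \<open>l + s = t + s\<close>.\<close>

lemma commute_if_letter:
  assumes IH: "\<And>l. l \<in> S \<Longrightarrow> e l < e t \<Longrightarrow> s + l = l + s"
    and s: "s \<in> S" "e s = 1" and t: "t \<in> S" "t \<noteq> s"
    and eq: "e (s + t) = e (t + s)" and st: "s + t \<in> S"
  shows "s + t = t + s"
proof (rule ccontr)
  assume nc: "s + t \<noteq> t + s"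
  define l where "l = s + t"
  have l: "l \<in> S" using st by (simp add: l_def)
  have ss: "s + s = 0" using involution_if_e_eq_1 s .
  then have sl: "s + l = t" by (simp add: l_def add.assoc[symmetric])
  have ne: "l \<noteq> t" "l \<noteq> s" "s \<noteq> 0" "t \<noteq> 0" using s t zero_notin by (auto simp: l_def)
  have "e t \<le> 1 + e l" using e_add_left[of s t] s t by (simp add: l_def grp_letter)
  moreover have "e l \<le> 1 + e t" using e_add[of s t] s t by (simp add: l_def grp_letter)
  moreover have "e l \<noteq> e t" using e_letter_inj l t ne by auto
  moreover have "\<not> e l < e t"
  proof
    assume "e l < e t"
    then have "s + l = l + s" using IH l by blast
    then have "t = s + t + s" using sl by (simp add: l_def)
    then have "s + t = s + s + t + s" by (simp add: add.assoc)
    then show False using nc ss by simp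
  qed
  ultimately have el: "e l = Suc (e t)" by linarith
  have ts: "t + s \<notin> S"
  proof
    assume "t + s \<in> S"
    then have "t + s = l" using e_letter_inj l eq by (simp add: l_def)
    then show False using nc by (simp add: l_def)
  qed
  have nz: "a + s \<noteq> 0" if "a \<noteq> s" for a
    using that ss by (metis add_right_cancel)
  have ll: "l + l \<notin> S"
  proof
    assume "l + l \<in> S"
    moreover from this have "e (l + l) = e t" using root_props(1)[OF l] el by simp
    ultimately have "l + l = t" using e_letter_inj t by blast
    then have "l + l = s + l" using sl by simp
    then show False using ne by simp
  qed
  then have "rep (Suc (e l)) l = 0" using pure_letter_iff[OF l] by (simp add: pure_letter_def)
  then have "s + (t + (l + rep (e t) l)) = 0" by (simp add: el l_def[symmetric] add.assoc[symmetric])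
  then have "t + (rep (e t) l + (l + s)) = 0"
    using add_eq_zero_commute[of s "t + (l + rep (e t) l)"] by (simp add: add.assoc)
  then have "l + s + sum_list (t # replicate (e t) l) = 0"
    using add_eq_zero_commute[of "t + rep (e t) l" "l + s"] by (simp add: add.assoc)
  then have "e (l + s) \<le> length (t # replicate (e t) l)" using t l by (intro e_le) auto
  moreover have "e l \<le> 1 + e (l + s)" using e_add_right[of l s] s l by (simp add: grp_letter)
  moreover have "e (l + s) \<noteq> e t"
  proof
    assume "e (l + s) = e t"
    then obtain R where R: "set R \<subseteq> S" "length R = e t" "l + s + sum_list R = 0"
      using e_word[of "l + s"] l s by auto
    then have "set (s # R) \<subseteq> {l}"
      using ll s el by (intro pure_circuit[OF l ll]) (auto simp: add.assoc)
    then show False using ne by auto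
  qed
  ultimately have els: "e (l + s) = e l" using el by simp
  have "l + s \<notin> S" using e_letter_inj[OF _ l els] ne by auto
  then have "l + s = t + s"
    using pair_unique[of l s t s] l s t ts nz ne els eq by (simp add: l_def)
  then show False using ne by simp
qed

text \<open>Applying the inequality in both the group and its opposite gives
  \<open>e (s + t) = e (t + s)\<close>. If neither sum is a letter they coincide by thinness; a
  letter on either side is treated in the group or in its opposite.\<close>

lemma involution_central:
  assumes s: "s \<in> S" "e s = 1"
  shows "t \<in> S \<Longrightarrow> s + t = t + s"
proof (induction "e t" arbitrary: t rule: less_induct)
  case less
  note t = less.prems
  show ?case
  proof (cases "t = s")
    case False
    interpret opp: thin "Opp ` S" by (rule thin_Opp)
    have e: "opp.e (Opp a) = e a" for a by (simp add: Opp_minus[symmetric])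
    have IH: "\<And>l. l \<in> Opp ` S \<Longrightarrow> opp.e l < opp.e (Opp t) \<Longrightarrow> Opp s + l = l + Opp s"
      using less.hyps by (auto simp: e Opp_add[symmetric])
    have os: "Opp s \<in> Opp ` S" "opp.e (Opp s) = 1" "Opp t \<in> Opp ` S" "Opp t \<noteq> Opp s"
      using s t False by (auto simp: e)
    have "e (t + s) \<le> e (s + t)"
      using e_add_involution_le[OF less.hyps s t False] by simp
    moreover have "e (s + t) \<le> e (t + s)"
      using opp.e_add_involution_le[OF IH os] by (simp only: Opp_add[symmetric] e)
    ultimately have eq: "e (s + t) = e (t + s)" by simp
    consider "s + t \<in> S" | "t + s \<in> S" | "s + t \<notin> S" "t + s \<notin> S" by blast
    then show ?thesis
    proof cases
      case 1
      then show ?thesis using commute_if_letter[OF less.hyps s t False eq] by simp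
    next
      case 2
      have "Opp s + Opp t = Opp t + Opp s"
      proof (rule opp.commute_if_letter[OF IH os])
        show "opp.e (Opp s + Opp t) = opp.e (Opp t + Opp s)" using eq by (simp only: Opp_add[symmetric] e)
        show "Opp s + Opp t \<in> Opp ` S" using 2 by (simp add: Opp_add[symmetric])
      qed
      then show ?thesis by (simp add: Opp_add[symmetric])
    next
      case 3
      have ss: "s + s = 0" using involution_if_e_eq_1 s .
      have "s + t \<noteq> 0" "t + s \<noteq> 0" using ss False by (metis add_left_cancel, metis add_right_cancel)
      then show ?thesis using pair_unique[of s t t s] s t 3 eq by simp
    qed
  qed simp
qed

end

section \<open>Shortest mixed words\<close>

lemma set_replicate_subsetI [simp]: "a \<in> A \<Longrightarrow> set (replicate n a) \<subseteq> A"
  by auto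

lemma two_letter_suffix:
  assumes "set X \<subseteq> {u, w}" "u \<noteq> w" "u \<in> set X" "w \<in> set X"
  obtains X' a b i where "X = X' @ a # replicate (Suc i) b" "a = u \<and> b = w \<or> a = w \<and> b = u"
proof -
  have "X \<noteq> []" using assms by auto
  define b where "b = last X"
  define a where "a = (if b = u then w else u)"
  have "b \<in> {u, w}" unfolding b_def using \<open>X \<noteq> []\<close> assms(1) last_in_set[of X] by blast
  then have ab: "a = u \<and> b = w \<or> a = w \<and> b = u" using assms(2) by (auto simp: a_def)
  then have "a \<in> set X" using assms by auto
  then obtain X' Y where XY: "X = X' @ a # Y" "a \<notin> set Y" by (metis split_list_last)
  have "Y \<noteq> []" using XY(1) ab assms(2) by (auto simp: b_def)
  moreover have "Y = replicate (length Y) b"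
    using XY assms(1) ab by (intro replicate_eqI) auto
  ultimately obtain i where "Y = replicate (Suc i) b" by (cases Y) auto
  then show ?thesis using that XY ab by blast
qed

definition apart :: "'g::group_add \<Rightarrow> 'g \<Rightarrow> bool" where
  "apart u w \<longleftrightarrow> u \<noteq> w \<and> u + u \<noteq> w \<and> w + w \<noteq> u"

lemma apart_sym: "apart u w \<Longrightarrow> apart w u"
  by (auto simp: apart_def)

lemma not_apart_commute: "\<not> apart u w \<Longrightarrow> u + w = w + u"
  by (auto simp: apart_def add.assoc)

context thin
begin

text \<open>For a letter, \<open>e a = 1\<close> is equivalent to having order two.\<close>

definition "S0 = {a \<in> S. e a \<noteq> 1}"

definition mixed :: "'g list \<Rightarrow> bool" where
  "mixed W \<longleftrightarrow> set W \<subseteq> S \<and> sum_list W = 0 \<and> (\<exists>u \<in> set W \<inter> S0. \<exists>w \<in> set W \<inter> S0. apart u w)"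

lemma mixedI: "set W \<subseteq> S \<Longrightarrow> sum_list W = 0 \<Longrightarrow> u \<in> set W \<Longrightarrow> w \<in> set W \<Longrightarrow> u \<in> S0 \<Longrightarrow> w \<in> S0 \<Longrightarrow> apart u w
    \<Longrightarrow> mixed W"
  by (auto simp: mixed_def)

lemma S0_subset: "a \<in> S0 \<Longrightarrow> a \<in> S"
  by (simp add: S0_def)

lemma S0_e: "a \<in> S0 \<Longrightarrow> e a \<ge> 2"
  using e_letter_pos[of a] by (simp add: S0_def)

text \<open>Doubling cannot be iterated in \<open>S\<close>, and a letter is the double of at most
  one letter, so classes of letters that are not apart have at most two members.\<close>

lemma apart_trans:
  assumes "a \<in> S" "b \<in> S" "c \<in> S" "\<not> apart a b" "\<not> apart b c"
  shows "\<not> apart a c"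
  using assms root_props(3)[of a] root_props(3)[of c] root_props(3)[of b] root_unique[of a c]
  unfolding apart_def by metis

lemma S0_add_ne_0: "a \<in> S0 \<Longrightarrow> b \<in> S \<Longrightarrow> a + b \<noteq> 0" "a \<in> S0 \<Longrightarrow> b \<in> S \<Longrightarrow> b + a \<noteq> 0"
  using e_le_1_if_add_eq_0[of a b] e_le_1_if_add_eq_0[of b a] S0_e[of a] S0_subset[of a] by auto

lemma adjacent_apart_aux:
  "set (x # W) \<subseteq> S \<Longrightarrow> c \<in> set W \<Longrightarrow> apart x c \<Longrightarrow> \<exists>A u w B. x # W = A @ u # w # B \<and> apart u w"
proof (induction W arbitrary: x)
  case (Cons y W)
  show ?case
  proof (cases "apart x y")
    case True
    then show ?thesis by (metis append_Nil)
  next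
    case False
    then have "c \<in> set W" "apart y c" using Cons.prems apart_trans[of x y c] by auto
    then obtain A u w B where "y # W = A @ u # w # B" "apart u w" using Cons by force
    then have "x # y # W = (x # A) @ u # w # B" by simp
    then show ?thesis using \<open>apart u w\<close> by blast
  qed
qed simp

text \<open>Not being apart is transitive, so it cannot hold for all neighbours in the word.\<close>

lemma adjacent_apart:
  assumes "set W \<subseteq> S" "a \<in> set W" "b \<in> set W" "apart a b"
  obtains A u w B where "W = A @ u # w # B" "apart u w"
proof (cases W)
  case (Cons x V)
  have "\<not> apart x x" by (simp add: apart_def)
  have "apart x a \<or> apart x b"
    using apart_trans[of a x b] assms Cons apart_sym by auto
  then obtain c where "c \<in> set V" "apart x c" using assms Cons \<open>\<not> apart x x\<close> by auto
  then show ?thesis using adjacent_apart_aux[of x V c] assms Cons that by blast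
qed (use assms in simp)

end

text \<open>\<open>T\<close> is the copy (if any) of the central letter of order two that occurs in a shortest mixed word.\<close>

locale min_mixed = thin +
  fixes M :: nat and T :: "'a list"
  assumes M_le: "mixed W \<Longrightarrow> M \<le> length W"
    and T_cases: "T = [] \<or> (\<exists>s. s \<in> S \<and> e s = 1 \<and> T = [s])"
    and M_attained: "\<exists>W. set W \<subseteq> S0 \<and> mixed (W @ T) \<and> length W + length T = M"
begin

text \<open>Since \<open>T\<close> is central it is kept separate at the end, so that rotations and
  replacements act on letters of \<open>S0\<close> only.\<close>

definition min_word :: "'a list \<Rightarrow> bool" where
  "min_word W \<longleftrightarrow> set W \<subseteq> S0 \<and> mixed (W @ T) \<and> length W + length T = M"

lemma T_letters: "set T \<subseteq> S" and T_not_S0: "set T \<inter> S0 = {}"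
  and T_central: "a \<in> S \<Longrightarrow> sum_list T + a = a + sum_list T"
  using T_cases involution_central by (auto simp: S0_def)

lemma T_commute_word: "set W \<subseteq> S \<Longrightarrow> sum_list T + sum_list W = sum_list W + sum_list T"
  using T_central by (intro add_commute_sum_list) auto

lemma min_word_iff: "min_word W \<longleftrightarrow> set W \<subseteq> S0 \<and> sum_list W + sum_list T = 0 \<and> length W + length T = M \<and>
    (\<exists>u \<in> set W. \<exists>w \<in> set W. apart u w)"
proof (cases "set W \<subseteq> S0")
  case True
  then have "(set W \<union> set T) \<inter> S0 = set W" using T_not_S0 by auto
  moreover have "set W \<subseteq> S" using True S0_subset by auto
  ultimately show ?thesis using True T_letters by (auto simp: min_word_def mixed_def)
qed (simp add: min_word_def)

lemma min_word_letters: "min_word W \<Longrightarrow> a \<in> set W \<Longrightarrow> a \<in> S0" "min_word W \<Longrightarrow> a \<in> set W \<Longrightarrow> a \<in> S"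
  by (auto simp: min_word_def S0_def)

lemma min_word_rotate: "min_word (A @ B) \<Longrightarrow> min_word (B @ A)"
proof -
  assume r: "min_word (A @ B)"
  then have "sum_list A + (sum_list B + sum_list T) = 0" by (simp add: min_word_iff add.assoc)
  then have "sum_list B + (sum_list T + sum_list A) = 0"
    using add_eq_zero_commute[of "sum_list A" "sum_list B + sum_list T"] by (simp add: add.assoc)
  moreover have "sum_list T + sum_list A = sum_list A + sum_list T"
    using r by (intro T_commute_word) (auto simp: min_word_def S0_def)
  ultimately show ?thesis using r by (auto simp: min_word_iff add.assoc)
qed

lemma min_word_replace:
  assumes "min_word W" "set V \<subseteq> S0" "sum_list V = sum_list W" "length V = length W"
    "u \<in> set V" "w \<in> set V" "apart u w"
  shows "min_word V"
  using assms unfolding min_word_iff by auto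

text \<open>The letters \<open>u\<close> and \<open>w\<close> alone make every circuit starting with
  them mixed, so minimality of \<open>M\<close> takes the role that \<open>e y\<close> has for
  circuits through one letter.\<close>

lemma e_apart_pair:
  assumes "u \<in> S0" "w \<in> S0" "apart u w" "set R \<subseteq> S" "u + w + sum_list R = 0" "length R + 2 = M"
  shows "e (u + w) = M - 2"
proof -
  have uw: "u \<in> S" "w \<in> S" using assms S0_subset by auto
  have "e (u + w) \<le> length R" using assms by (intro e_le) auto
  moreover obtain Q where Q: "set Q \<subseteq> S" "length Q = e (u + w)" "u + w + sum_list Q = 0"
    using e_word[of "u + w"] uw by auto
  then have "mixed (u # w # Q)"
    using assms uw by (intro mixedI[of _ u w]) (auto simp: add.assoc)
  then have "M \<le> length (u # w # Q)" by (rule M_le)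
  ultimately show ?thesis using assms Q by simp
qed

text \<open>\<open>R\<close> is a shortest word closing the letter \<open>l = u + w\<close>, so it
  may be taken to consist of copies of \<open>l\<close>, or of one \<open>l\<close> and copies of
  \<open>l + l\<close>. Rotations of this circuit exhibit further apart pairs. Their sums have the
  value \<open>M - 2\<close> of \<open>e\<close>, which among letters only \<open>l\<close> takes;
  so these sums are no letters, must coincide, and cancellation gives a contradiction.\<close>

lemma apart_pair_not_letter:
  assumes u: "u \<in> S0" and w: "w \<in> S0" and uw: "apart u w"
    and R: "set R \<subseteq> S" "u + w + sum_list R = 0" "length R + 2 = M"
  shows "u + w \<notin> S"
proof
  define l where "l = u + w"
  assume "u + w \<in> S"
  then have l: "l \<in> S" by (simp add: l_def)
  have uS: "u \<in> S" and wS: "w \<in> S" using u w S0_subset by auto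
  have el: "e l = M - 2" using e_apart_pair[OF assms] by (simp add: l_def)
  have lenR: "length R = e l" using R el by simp
  have nz: "u \<noteq> 0" "w \<noteq> 0" "l \<noteq> 0" using uS wS l zero_notin by auto
  have lu: "l \<noteq> u" "l \<noteq> w" "u \<noteq> w" using nz uw by (auto simp: l_def apart_def)
  have letter: "g = l" if "g \<in> S" "e g = M - 2" for g
    using e_letter_inj[OF that(1) l] that el by simp
  have "u + w + sum_list R = l + sum_list R" by (simp add: l_def)
  then have lR: "l + sum_list R = 0" using R by simp
  have e2: "Suc (e u) \<le> M" "Suc (e w) \<le> M"
    using e_le_circuit[of "u # w # R"] R uS wS by (auto simp: add.assoc)
  show False
  proof (cases "l + l \<in> S")
    case False
    have "R = replicate (e l) l"
      using pure_circuit[OF l False R(1) lR lenR] lenR by (intro replicate_eqI) auto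
    then have sR: "sum_list R = rep (e l) l" by (metis sum_list_replicate_rep)
    \<comment> \<open>Otherwise \<open>M = 3\<close>, which leaves only the value 2 for both
      \<open>e u\<close> and \<open>e w\<close>.\<close>
    have "e l \<noteq> 1"
    proof
      assume "e l = 1"
      then have "e u = 2" "e w = 2" using S0_e[OF u] S0_e[OF w] e2 R lenR by auto
      then show False using e_letter_inj uS wS lu by metis
    qed
    then have l0: "l \<in> S0" using l by (simp add: S0_def)
    obtain k where k: "e l = Suc (Suc k)" using S0_e[OF l0] by (intro that[of "e l - 2"]) simp
    have M: "M = Suc (Suc (Suc (Suc k)))" using R lenR k by simp
    have c: "u + (w + (l + (l + rep k l))) = 0" using R(2) sR by (simp add: k add.assoc)
    have wl: "apart w l" using lu uw nz False wS by (auto simp: apart_def l_def)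
    have al: "apart l u" using lu uw nz False uS by (auto simp: apart_def l_def)
    have "w + l + sum_list (replicate (Suc k) l @ [u]) = 0"
      using add_eq_zero_commute[OF c] by (simp add: add.assoc)
    from e_apart_pair[OF w l0 wl _ this] have ewl: "e (w + l) = M - 2" using l uS M by auto
    have "l + u + sum_list (w # replicate (Suc k) l) = 0"
      using c add_eq_zero_commute[of "u + (w + (l + rep k l))" l] by (simp add: add.assoc)
    from e_apart_pair[OF l0 u al _ this] have elu: "e (l + u) = M - 2" using l wS M by auto
    have wlS: "w + l \<notin> S" using letter[OF _ ewl] nz by auto
    have luS: "l + u \<notin> S" using letter[OF _ elu] nz by auto
    have eq: "w + l = l + u"
      using pair_unique[of w l l u] wS l uS wlS luS ewl elu S0_add_ne_0 w u by simp
    have "u + (w + l) + (l + rep k l) = 0" using c by (simp add: add.assoc)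
    then have "u + l + sum_list (u # replicate (Suc k) l) = 0" unfolding eq by (simp add: add.assoc)
    from e_apart_pair[OF u l0 apart_sym[OF al] _ this] have eul: "e (u + l) = M - 2" using l uS M by auto
    have ulS: "u + l \<notin> S" using letter[OF _ eul] nz by auto
    have "u + l = l + u"
      using pair_unique[of u l l u] l uS ulS luS eul elu S0_add_ne_0 u by simp
    then show False using eq lu by (metis add_right_cancel)
  next
    case True
    define x where "x = l + l"
    have x: "x \<in> S" "Suc (e x) = e l" "rep (e l) x = 0" "x + x \<notin> S" "e l \<ge> 2"
      using root_props[OF l True] True by (auto simp: x_def)
    have l0: "l \<in> S0" using l x(5) by (simp add: S0_def)
    have ux: "u \<noteq> x"
    proof
      assume "u = x"
      then have "u + w = l + l + w" by (simp only: x_def)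
      then have "l = l + (l + w)" unfolding l_def[symmetric] by (simp only: add.assoc)
      then show False using S0_add_ne_0[OF w l] by simp
    qed
    \<comment> \<open>Otherwise \<open>M = 4\<close>, and as \<open>l\<close> already takes the
      value 2, both \<open>e u\<close> and \<open>e w\<close> would be 3.\<close>
    have "e x \<noteq> 1"
    proof
      assume "e x = 1"
      then have "e l = 2" "M = 4" using x R lenR by auto
      moreover have "e u \<noteq> e l" "e w \<noteq> e l" using e_letter_inj[OF _ l] uS wS lu by metis+
      ultimately have "e u = 3" "e w = 3" using S0_e[OF u] S0_e[OF w] e2 by auto
      then show False using e_letter_inj uS wS lu by metis
    qed
    then have x0: "x \<in> S0" using x by (simp add: S0_def)
    obtain k where k: "e l = Suc (Suc k)" using x(5) by (intro that[of "e l - 2"]) simp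
    have M: "M = Suc (Suc (Suc (Suc k)))" using R lenR k by simp
    have "l + (l + (x + rep k x)) = 0"
      using x(3) by (simp add: k x_def add.assoc)
    then have "u + w + (l + (x + rep k x)) = 0" unfolding l_def[symmetric] .
    then have c: "u + (w + (l + (x + rep k x))) = 0" by (simp add: add.assoc)
    have lxk: "l + (x + rep k x) = x + (rep k x + l)"
      using add_commute_rep[of l x "Suc k"] by (simp add: x_def add.assoc)
    have lu_apart: "apart l u" using lu uw nz ux by (auto simp: apart_def x_def) (simp add: l_def)
    have "l + u + sum_list (w # replicate (Suc k) x) = 0"
      using c add_eq_zero_commute[of "u + (w + (x + rep k x))" l] lxk by (simp add: add.assoc)
    from e_apart_pair[OF l0 u lu_apart _ this] have elu: "e (l + u) = M - 2" using x wS M by auto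
    have xu_apart: "apart x u" using ux x(4) uS root_unique[of u l] l lu True by (auto simp: apart_def x_def)
    have "x + u + sum_list (w # l # replicate k x) = 0"
      using c add_eq_zero_commute[of "u + (w + (l + rep k x))" x] by (simp add: add.assoc)
    from e_apart_pair[OF x0 u xu_apart _ this] have exu: "e (x + u) = M - 2" using x l wS M by auto
    have luS: "l + u \<notin> S" using letter[OF _ elu] nz by auto
    have "x + u \<notin> S"
    proof
      assume "x + u \<in> S"
      from letter[OF this exu] have "l + (l + u) = l" unfolding x_def add.assoc .
      then show False using S0_add_ne_0[OF u l] by simp
    qed
    then have "x + u = l + u"
      using pair_unique[of x u l u] x l uS luS exu elu S0_add_ne_0 u by simp
    then show False using nz by (simp add: x_def)
  qed
qed

lemma min_word_pair:
  assumes "min_word (u # w # R)" "apart u w"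
  shows "e (u + w) = M - 2" "u + w \<notin> S" "u + w \<noteq> 0"
proof -
  have "set (R @ T) \<subseteq> S" "u + w + sum_list (R @ T) = 0" "length (R @ T) + 2 = M" "u \<in> S0" "w \<in> S0"
    using assms T_letters by (auto simp: min_word_iff add.assoc S0_def)
  then show "e (u + w) = M - 2" "u + w \<notin> S" "u + w \<noteq> 0"
    using e_apart_pair apart_pair_not_letter assms(2) S0_add_ne_0 S0_subset by blast+
qed

lemma min_word_pair_unique:
  assumes "min_word (u # w # R)" "apart u w" "min_word (u' # w' # R')" "apart u' w'"
  shows "u + w = u' + w'"
  using min_word_pair[OF assms(1,2)] min_word_pair[OF assms(3,4)] min_word_letters[OF assms(1)] min_word_letters[OF assms(3)]
  by (intro pair_unique) auto

end

context min_mixed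
begin

text \<open>A letter \<open>t\<close> not apart from \<open>b\<close> commutes with it and could be
  moved next to \<open>a\<close>, giving \<open>a + t = a + b\<close>.\<close>

lemma min_word_skip:
  assumes min_word: "min_word (a # replicate (Suc i) b @ t # B)" and ab: "apart a b" and t: "t \<noteq> b"
  shows "apart b t"
proof (rule ccontr)
  assume nb: "\<not> apart b t"
  have S: "a \<in> S" "b \<in> S" "t \<in> S" using min_word_letters(2)[OF min_word] by auto
  have at: "apart a t" using apart_trans[OF S(1,3,2)] nb ab apart_sym by blast
  have "t + rep (Suc i) b = rep (Suc i) b + t"
    using not_apart_commute[OF nb] by (intro add_commute_rep) simp
  then have *: "t + (rep (Suc i) b + g) = rep (Suc i) b + (t + g)" for g by (metis add.assoc)
  have "sum_list (a # t # replicate (Suc i) b @ B) = sum_list (a # replicate (Suc i) b @ t # B)"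
    using * by (simp del: rep.simps replicate.simps)
  then have "min_word (a # t # replicate (Suc i) b @ B)"
    using min_word_letters[OF min_word] at by (intro min_word_replace[OF min_word, of _ a t]) auto
  moreover have "min_word (a # b # replicate i b @ t # B)" using min_word by simp
  ultimately have "a + t = a + b" using min_word_pair_unique at ab by blast
  then show False using t by simp
qed

text \<open>All apart neighbours have the sum \<open>a + b\<close>, so the two leading letters may
  be exchanged for any other such pair. The aim is to reach \<open>t + b = a + b\<close>, which
  gives \<open>t = a\<close>.\<close>

lemma min_word_third_letter:
  assumes min_word: "min_word (a # replicate (Suc i) b @ t # B)" and ab: "apart a b" and t: "t \<noteq> a" "t \<noteq> b"
  shows False
proof -
  have bt: "apart b t" using min_word_skip[OF min_word ab t(2)] .
  have min_word1: "min_word (a # b # replicate i b @ t # B)" using min_word by simp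
  have "min_word ((a # replicate i b) @ b # t # B)" using min_word by (simp add: replicate_append_same[symmetric])
  then have min_word2: "min_word (b # t # B @ a # replicate i b)" using min_word_rotate by fastforce
  have bt_eq: "b + t = a + b" using min_word_pair_unique[OF min_word2 bt min_word1 ab] .
  show False
  proof (cases i)
    \<comment> \<open>Exchanging the leading \<open>a b\<close> for \<open>b t\<close> puts
      \<open>t\<close> in front of the next \<open>b\<close>.\<close>
    case (Suc j)
    have "b + (t + g) = a + (b + g)" for g using bt_eq by (metis add.assoc)
    then have "sum_list ([b] @ t # b # replicate j b @ t # B) = sum_list (a # replicate (Suc i) b @ t # B)"
      by (simp add: Suc add.assoc)
    then have "min_word ([b] @ t # b # replicate j b @ t # B)"
      using min_word_letters[OF min_word] bt Suc by (intro min_word_replace[OF min_word, of _ b t]) auto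
    then have "min_word (t # b # replicate j b @ t # B @ [b])" using min_word_rotate by fastforce
    then have "t + b = a + b" using min_word_pair_unique[OF _ apart_sym[OF bt] min_word1 ab] by blast
    then show False using t by simp
  next
    \<comment> \<open>No second \<open>b\<close> follows. Instead let \<open>x\<close> end the run
      of \<open>t\<close>; it exists because the cyclic word contains \<open>a\<close>. Exchanging
      \<open>a b\<close> for \<open>t x\<close> puts \<open>x\<close> in front of \<open>t\<close>,
      so \<open>x + t = b + t\<close> and \<open>x = b\<close>.\<close>
    case 0
    have "a \<in> set (B @ [a])" "a \<noteq> t" using t by auto
    then obtain A x C where AC: "B @ [a] = A @ x # C" "x \<noteq> t" "\<forall>c \<in> set A. \<not> c \<noteq> t"
      using split_list_first_prop[of "B @ [a]" "\<lambda>c. c \<noteq> t"] by blast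
    define j where "j = length A"
    have A: "A = replicate j t" using AC(3) by (intro replicate_eqI) (auto simp: j_def)
    have min_word3: "min_word (b # replicate (Suc j) t @ x # C)"
      using min_word2 AC(1) by (simp add: 0 A)
    have tx: "apart t x" using min_word_skip[OF min_word3 bt AC(2)] .
    have "min_word ((b # replicate j t) @ t # x # C)" using min_word3 by (simp add: replicate_append_same[symmetric])
    then have min_word4: "min_word (t # x # C @ b # replicate j t)" using min_word_rotate by fastforce
    then have tx_eq: "t + x = a + b" using min_word_pair_unique[OF _ tx min_word1 ab] by blast
    have "t + (x + g) = a + (b + g)" for g using tx_eq by (metis add.assoc)
    then have "sum_list ([t] @ x # t # B) = sum_list (a # replicate (Suc i) b @ t # B)"
      by (simp add: 0)
    then have "min_word ([t] @ x # t # B)"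
      using min_word_letters[OF min_word] min_word_letters[OF min_word4] tx 0 by (intro min_word_replace[OF min_word, of _ t x]) auto
    then have "min_word (x # t # B @ [t])" using min_word_rotate by fastforce
    then have "x + t = b + t" using min_word_pair_unique[OF _ apart_sym[OF tx] min_word2 bt] by blast
    then have "t + b = a + b" using tx_eq by simp
    then show False using t by simp
  qed
qed

text \<open>A first letter other than \<open>u\<close> and \<open>w\<close> would follow a run of
  one of them that is preceded by the other, which is the excluded configuration. With two letters
  only, \<open>w\<close> is followed by \<open>u\<close> somewhere on the cycle, so
  \<open>w + u\<close> and \<open>u + w\<close> coincide.\<close>

lemma two_letter_relation:
  obtains u w p q where "u \<in> S0" "w \<in> S0" "apart u w" "u + w = w + u" "p \<ge> 1" "q \<ge> 1"
    "rep p u + rep q w + sum_list T = 0" "p + q + length T = M" "e (u + w) = M - 2" "u + w \<notin> S"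
proof -
  obtain W where W: "min_word W" using M_attained by (auto simp: min_word_def)
  then obtain a b where "a \<in> set W" "b \<in> set W" "apart a b" by (auto simp: min_word_iff)
  moreover have "set W \<subseteq> S" using min_word_letters[OF W] by auto
  ultimately obtain A u w B where "W = A @ u # w # B" and uw: "apart u w"
    using adjacent_apart by metis
  then have "min_word (u # w # B @ A)" using W min_word_rotate by fastforce
  then obtain R where R: "min_word (u # w # R)" by blast
  have ne: "u \<noteq> w" using uw by (simp add: apart_def)
  have sub: "set R \<subseteq> {u, w}"
  proof (rule ccontr)
    assume "\<not> set R \<subseteq> {u, w}"
    then have "\<exists>t \<in> set R. t \<noteq> u \<and> t \<noteq> w" by auto
    then obtain A t B where AB: "R = A @ t # B" "t \<noteq> u \<and> t \<noteq> w" "\<forall>c \<in> set A. \<not> (c \<noteq> u \<and> c \<noteq> w)"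
      using split_list_first_prop[of R "\<lambda>t. t \<noteq> u \<and> t \<noteq> w"] by blast
    obtain X' a b i where X: "u # w # A = X' @ a # replicate (Suc i) b" "a = u \<and> b = w \<or> a = w \<and> b = u"
      by (rule two_letter_suffix[of "u # w # A" u w]) (use AB ne in auto)
    have "u # w # R = X' @ a # replicate (Suc i) b @ t # B" using X(1) AB(1)
      by (metis append.assoc append_Cons)
    then have "min_word (a # replicate (Suc i) b @ t # B @ X')"
      using R min_word_rotate[of X' "a # replicate (Suc i) b @ t # B"] by simp
    then show False using min_word_third_letter[of a i b t] X(2) uw apart_sym AB(2) by blast
  qed
  have "u + w = w + u"
  proof -
    have 1: "min_word (w # R @ [u])" using R min_word_rotate[of "[u]" "w # R"] by simp
    obtain A B where AB: "R @ [u] = A @ u # B" "u \<notin> set A"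
      using split_list_first[of u "R @ [u]"] by auto
    have "set A \<subseteq> set (R @ [u])" unfolding AB(1) by auto
    then have "set (w # A) \<subseteq> {w}" using AB(2) sub by auto
    then have "last (w # A) = w" using last_in_set[of "w # A"] by blast
    then have "w # R @ [u] = butlast (w # A) @ w # u # B"
      using append_butlast_last_id[of "w # A"] AB(1) by (metis append.assoc append_Cons append_Nil list.distinct(1))
    then have "min_word (w # u # B @ butlast (w # A))"
      using 1 min_word_rotate[of "butlast (w # A)" "w # u # B"] by simp
    then show ?thesis using min_word_pair_unique[OF R uw] apart_sym[OF uw] by blast
  qed
  moreover have "sum_list (u # w # R) + sum_list T = 0" "length (u # w # R) + length T = M"
    using R by (auto simp: min_word_iff)
  ultimately show ?thesis
    using that[of u w "count_list (u # w # R) u" "count_list (u # w # R) w"]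
      sum_list_two_letters[of u w "u # w # R"] sub ne uw min_word_pair[OF R uw] min_word_letters(1)[OF R]
    by (auto simp: ne)
qed

end

section \<open>Relations between two commuting letters\<close>

context thin
begin

lemma pure_rep: "w \<in> S \<Longrightarrow> w + w \<notin> S \<Longrightarrow> rep (Suc (e w)) w = 0"
  using pure_letter_iff[of w] by (simp add: pure_letter_def)

lemma pure_d_rep: "w \<in> S \<Longrightarrow> w + w \<notin> S \<Longrightarrow> j \<le> e w \<Longrightarrow> d (rep j w) = j"
  using d_rep_pure pure_rep by blast

lemma pure_rep_eq_0:
  assumes "w \<in> S" "w + w \<notin> S" "rep j w = 0"
  shows "Suc (e w) dvd j"
proof -
  have "rep (j mod Suc (e w)) w = 0" using rep_mod[OF pure_rep, of w j] assms by simp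
  moreover have "j mod Suc (e w) \<le> e w" using mod_less_divisor[of "Suc (e w)" j] by linarith
  ultimately show ?thesis using pure_d_rep[of w "j mod Suc (e w)"] assms by (simp add: dvd_eq_mod_eq_0)
qed

text \<open>Below the order of \<open>w\<close> the length of \<open>rep j w\<close> is
  \<open>j\<close>, so only \<open>j = 1\<close> yields a letter.\<close>

lemma pure_rep_letter:
  assumes "w \<in> S" "w + w \<notin> S" "rep j w \<in> S"
  shows "rep j w = w"
proof -
  have 1: "rep (j mod Suc (e w)) w = rep j w" using rep_mod[OF pure_rep, of w j] assms by simp
  have "j mod Suc (e w) \<le> e w" using mod_less_divisor[of "Suc (e w)" j] by linarith
  then have "j mod Suc (e w) = 1" using pure_d_rep[of w "j mod Suc (e w)"] assms 1 by simp
  then show ?thesis using 1 by simp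
qed

end

context min_mixed
begin

text \<open>The outcome of \<open>two_letter_relation\<close>, named so that it can be used with
  \<open>u\<close> and \<open>w\<close> exchanged.\<close>

definition relation :: "'a \<Rightarrow> 'a \<Rightarrow> nat \<Rightarrow> nat \<Rightarrow> bool" where
  "relation u w p q \<longleftrightarrow> u \<in> S0 \<and> w \<in> S0 \<and> apart u w \<and> u + w = w + u \<and> p \<ge> 1 \<and> q \<ge> 1 \<and>
    rep p u + rep q w + sum_list T = 0 \<and> p + q + length T = M \<and> e (u + w) = M - 2 \<and> u + w \<notin> S"

lemma relation_sym: "relation u w p q \<Longrightarrow> relation w u q p"
  using apart_sym rep_commute_rep[of u w p q] by (auto simp: relation_def)

lemma relation_letters:
  assumes "relation u w p q"
  shows "u \<in> S0" "w \<in> S0" "u \<in> S" "w \<in> S" "u \<noteq> w" "u + u \<noteq> w" "w + w \<noteq> u" "apart u w"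
  using assms by (auto simp: relation_def apart_def S0_def)

lemma relation_min:
  assumes "relation u w p q" "set W \<subseteq> S" "sum_list W = 0" "u \<in> set W" "w \<in> set W"
  shows "M \<le> length W"
  using M_le mixedI[OF assms(2-5)] relation_letters[OF assms(1)] by blast

text \<open>Otherwise a full circuit of copies of \<open>w\<close> could be removed with some
  \<open>w\<close> still left, and the shorter word would be mixed.\<close>

lemma relation_pure_le:
  assumes r: "relation u w p q" and pure: "w + w \<notin> S"
  shows "q \<le> Suc (e w)"
proof (rule ccontr)
  assume "\<not> q \<le> Suc (e w)"
  then obtain k where k: "q = Suc (e w) + Suc k" using less_imp_Suc_add[of "Suc (e w)" q] by auto
  have "rep q w = rep (Suc k) w"
    using pure_rep[OF relation_letters(4)[OF r] pure] by (simp only: k rep_add add_0)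
  then have "sum_list (replicate p u @ replicate (Suc k) w @ T) = 0"
    using r by (simp add: relation_def add.assoc)
  then have "M \<le> length (replicate p u @ replicate (Suc k) w @ T)"
    using relation_letters[OF r] r T_letters by (intro relation_min[OF r]) (auto simp: relation_def)
  then show False using r by (simp add: relation_def k)
qed

text \<open>Merging two copies of \<open>u\<close> shortens the relation. The result is still mixed
  if another \<open>u\<close> remains, or if \<open>u + u\<close> is not of order two, since
  \<open>u + u\<close> is apart from \<open>w\<close>.\<close>

lemma relation_root:
  assumes r: "relation u w p q" and root: "u + u \<in> S"
  shows "p = 1 \<or> p = 2 \<and> e (u + u) = 1"
proof (rule ccontr)
  assume n: "\<not> ?thesis"
  have p: "p \<ge> 1" using r by (simp add: relation_def)
  then obtain k where k: "p = Suc (Suc k)" using n by (intro that[of "p - 2"]) auto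
  let ?W = "(u + u) # replicate k u @ replicate q w @ T"
  note l = relation_letters[OF r]
  have W: "set ?W \<subseteq> S" "sum_list ?W = 0" "w \<in> set ?W"
    using l root T_letters r by (auto simp: relation_def k add.assoc)
  have "M \<le> length ?W"
  proof (cases "e (u + u) = 1")
    case True
    then have "k \<noteq> 0" using n k by auto
    then show ?thesis using W by (intro relation_min[OF r]) auto
  next
    case False
    have "apart (u + u) w"
      using l root_props(3)[OF l(3) root] root_unique[of u w] root by (auto simp: apart_def)
    then show ?thesis
      using W l False root by (intro M_le mixedI[of _ "u + u" w]) (auto simp: S0_def)
  qed
  then show False using r by (simp add: relation_def k)
qed

text \<open>Both halves of the circuit contain \<open>u\<close> and \<open>w\<close>, so a shorter
  word for either half would leave a mixed word. Sums of three letters are used because the pair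
  \<open>u\<close>, \<open>w\<close> yields nothing beyond \<open>u + w = w + u\<close>.\<close>

lemma relation_triple:
  assumes r: "relation u w p q" and abc: "{a, b, c} \<subseteq> S" "set R \<subseteq> S" "a + (b + (c + sum_list R)) = 0"
    "length R + 3 = M" "{u, w} \<subseteq> {a, b, c}" "{u, w} \<subseteq> set R"
  shows "d (a + (b + c)) = 3" "e (a + (b + c)) = M - 3"
proof -
  have sp: "a + (b + c) \<in> grp" using abc(1) by auto
  obtain L where L: "set L \<subseteq> S" "length L = d (a + (b + c))" "sum_list L = a + (b + c)"
    using d_word[OF sp] by auto
  have "M \<le> length (L @ R)"
    using L abc by (intro relation_min[OF r]) (auto simp: add.assoc)
  moreover have "d (a + (b + c)) \<le> length [a, b, c]" using abc by (intro d_le) auto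
  ultimately show "d (a + (b + c)) = 3" using L abc by simp
  obtain Q where Q: "set Q \<subseteq> S" "length Q = e (a + (b + c))" "a + (b + c) + sum_list Q = 0"
    using e_word[OF sp] by auto
  have "M \<le> length (a # b # c # Q)"
    using Q abc by (intro relation_min[OF r]) (auto simp: add.assoc)
  moreover have "e (a + (b + c)) \<le> length R"
    using abc by (intro e_le) (auto simp: add.assoc)
  ultimately show "e (a + (b + c)) = M - 3" using Q abc by simp
qed

lemma triple_unique:
  assumes r: "relation u w p q" and abc: "{a, b, c} \<subseteq> S" "set R \<subseteq> S" "a + (b + (c + sum_list R)) = 0"
    "length R + 3 = M" "{u, w} \<subseteq> {a, b, c}" "{u, w} \<subseteq> set R"
    and abc': "{a', b', c'} \<subseteq> S" "set R' \<subseteq> S" "a' + (b' + (c' + sum_list R')) = 0"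
    "length R' + 3 = M" "{u, w} \<subseteq> {a', b', c'}" "{u, w} \<subseteq> set R'"
  shows "a + (b + c) = a' + (b' + c')"
proof (rule thin_inj)
  show "a + (b + c) \<in> grp" "a' + (b' + c') \<in> grp" using abc(1) abc'(1) by auto
qed (simp_all add: relation_triple[OF r abc] relation_triple[OF r abc'])

text \<open>Each exponent is 1, or 2 with a double of order two. The latter cannot happen on both
  sides, because a double determines its root. The relations that remain have at most four
  letters.\<close>

lemma no_double_root:
  assumes r: "relation u w p q" and root: "u + u \<in> S" "w + w \<in> S"
  shows False
proof -
  note l = relation_letters[OF r]
  have nz: "u \<noteq> 0" "w \<noteq> 0" using l zero_notin by auto
  have sum: "rep p u + rep q w + sum_list T = 0" using r by (simp add: relation_def)
  have *: False if r: "relation u w 2 1" "e (u + u) = 1" "u + u \<in> S" for u w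
  proof -
    note l = relation_letters[OF r(1)]
    have sum: "u + u + (w + sum_list T) = 0" using r(1) by (simp add: relation_def numeral_2_eq_2 add.assoc)
    from T_cases show False
    proof
      assume "T = []"
      then show False using sum S0_add_ne_0(2)[OF l(2) r(3)] by simp
    next
      assume "\<exists>s. s \<in> S \<and> e s = 1 \<and> T = [s]"
      then obtain s where s: "s \<in> S" "e s = 1" "T = [s]" by blast
      have us: "u + u = s" using e_letter_inj[OF r(3) s(1)] r(2) s(2) by simp
      have "s + (s + w) = 0" using sum involution_central[OF s(1,2) l(4)] unfolding us s(3) by simp
      then have "w = 0" using involution_if_e_eq_1[OF s(1,2)] by (simp add: add.assoc[symmetric])
      then show False using l(4) zero_notin by simp
    qed
  qed
  have "\<not> (e (u + u) = 1 \<and> e (w + w) = 1)"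
    using e_letter_inj[OF root] root_unique[OF l(3,4)] root l(5) by auto
  then consider "p = 1" "q = 1" | "p = 2" "q = 1" "e (u + u) = 1" | "p = 1" "q = 2" "e (w + w) = 1"
    using relation_root[OF r root(1)] relation_root[OF relation_sym[OF r] root(2)] by blast
  then show False
  proof cases
    case 1
    from T_cases show False
    proof
      assume "T = []"
      then show False using sum 1 S0_add_ne_0[OF l(1,4)] by simp
    next
      assume "\<exists>s. s \<in> S \<and> e s = 1 \<and> T = [s]"
      then obtain s where s: "s \<in> S" "T = [s]" by blast
      then have "sum_list [u, w, s] = 0" using sum 1 by (simp add: add.assoc)
      then have "e u = 2" "e w = 2"
        using e_le_circuit[of "[u, w, s]" u] e_le_circuit[of "[u, w, s]" w] S0_e[OF l(1)] S0_e[OF l(2)] s l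
        by auto
      then show False using e_letter_inj[OF l(3,4)] l by simp
    qed
  qed (use * r relation_sym[OF r] root in auto)
qed

text \<open>Most cases make a letter other than \<open>w\<close> a multiple of the pure letter
  \<open>w\<close>. The exception is \<open>p = 2\<close> with \<open>T = [u + u]\<close>, where
  \<open>rep q w = 0\<close> and sums of three letters are compared.\<close>

lemma no_root_pure:
  assumes r: "relation u w p q" and root: "u + u \<in> S" and pure: "w + w \<notin> S"
  shows False
proof -
  note l = relation_letters[OF r]
  define n where "n = Suc (e w)"
  have nz: "u \<noteq> 0" "w \<noteq> 0" using l zero_notin by auto
  have n: "rep n w = 0" "q \<le> n" "q \<ge> 1" "n \<ge> 3"
    using pure_rep[OF l(4) pure] relation_pure_le[OF r pure] r S0_e[OF l(2)]
    by (auto simp: n_def relation_def simp del: rep.simps)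
  have sum: "rep p u + rep q w + sum_list T = 0" using r by (simp add: relation_def)
  have not_s: "rep j w \<noteq> s" if "s \<in> S" "e s = 1" for j s
    using pure_rep_letter[OF l(4) pure, of j] that l(2) by (auto simp: S0_def)
  from relation_root[OF r root] show False
  proof
    assume p: "p = 1"
    have qw: "rep (n - q) w + rep q w = 0" using n by (simp add: rep_add[symmetric])
    from T_cases show False
    proof
      assume "T = []"
      then have "u + rep q w = rep (n - q) w + rep q w" using sum p qw by simp
      then have "u = rep (n - q) w" by (rule add_right_imp_eq)
      then show False using pure_rep_letter[OF l(4) pure, of "n - q"] l by simp
    next
      assume "\<exists>s. s \<in> S \<and> e s = 1 \<and> T = [s]"
      then obtain s where s: "s \<in> S" "e s = 1" "T = [s]" by blast
      have ss: "s + s = 0" using involution_if_e_eq_1 s by blast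
      have sw: "s + rep j w = rep j w + s" for j
        using involution_central[OF s(1,2) l(4)] by (rule add_commute_rep)
      have "u + rep q w + s = rep (n - q) w + rep q w" using sum p s qw by simp
      also have "\<dots> = rep (n - q) w + s + rep q w + s"
        using ss sw[of q] by (metis add.assoc add.right_neutral)
      finally have u: "u = rep (n - q) w + s" by simp
      \<comment> \<open>Doubling cancels \<open>s\<close> and makes the letter \<open>u + u\<close>
        a multiple of \<open>w\<close>.\<close>
      have "u + u = rep (n - q) w + (s + rep (n - q) w) + s" by (simp add: u add.assoc)
      also have "\<dots> = rep (n - q) w + rep (n - q) w + (s + s)" unfolding sw by (simp only: add.assoc)
      also have "\<dots> = rep (n - q + (n - q)) w" by (simp only: ss rep_add) simp
      finally have "u + u = w" using pure_rep_letter[OF l(4) pure] root by metis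
      then show False using l by simp
    qed
  next
    assume p: "p = 2 \<and> e (u + u) = 1"
    define s where "s = u + u"
    have s: "s \<in> S" "e s = 1" "s + s = 0" using p root involution_if_e_eq_1 by (auto simp: s_def)
    have sum: "s + rep q w + sum_list T = 0" using sum p by (simp add: s_def numeral_2_eq_2 add.assoc)
    from T_cases show False
    proof
      assume "T = []"
      then have "s + rep q w = s + s" using sum s by simp
      then have "rep q w = s" by (rule add_left_imp_eq)
      then show False using not_s s by blast
    next
      assume "\<exists>s. s \<in> S \<and> e s = 1 \<and> T = [s]"
      then have T: "T = [s]" using e_letter_inj s by auto
      have sw: "s + rep j w = rep j w + s" for j
        using involution_central[OF s(1,2) l(4)] by (rule add_commute_rep)
      have "rep q w = 0" using sum s unfolding sw by (simp add: T add.assoc)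
      then have "q = n" using pure_rep_eq_0[OF l(4) pure] n dvd_imp_le[of n q] by (simp add: n_def)
      obtain k where k: "n = Suc (Suc (Suc k))" using n(4) by (intro that[of "n - 3"]) simp
      have M: "M = k + 6" using r p \<open>q = n\<close> k T unfolding relation_def by simp
      have w0: "w + (w + (w + (rep k w + g))) = g" for g
        using n(1) by (simp add: k add.assoc[symmetric])
      have us: "u + (s + u) = 0"
        using s(3) by (simp add: s_def add.assoc)
      have us': "u + (u + s) = 0"
        using s(3) by (simp add: s_def add.assoc)
      \<comment> \<open>The word has two copies of \<open>u\<close> and at least three of
        \<open>w\<close>, so the complements of both sums still contain \<open>u\<close> and
        \<open>w\<close>.\<close>
      have "u + (s + w) = u + (w + w)"
      proof (rule triple_unique[OF r])
        show "u + (s + (w + sum_list (replicate (Suc (Suc k)) w @ [u]))) = 0"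
          using us by (simp add: w0 add.assoc)
        show "u + (w + (w + sum_list (replicate (Suc k) w @ [u, s]))) = 0"
          using us' by (simp add: w0 add.assoc)
      qed (use l s M in auto)
      then have "s = w" by simp
      then show False using s l(2) by (simp add: S0_def)
    qed
  qed
qed

text \<open>If the copies of \<open>u\<close> already sum to 0, so do the other letters. With a
  letter of order two this makes it a multiple of \<open>w\<close>; without one, the relation splits
  into two pure circuits, and the two ways to mix three letters coincide.\<close>

lemma no_full_pure:
  assumes r: "relation u w p q" and pure: "u + u \<notin> S" "w + w \<notin> S"
  shows "p \<noteq> Suc (e u)"
proof
  assume p: "p = Suc (e u)"
  note l = relation_letters[OF r]
  have pu: "rep p u = 0" using pure_rep[OF l(3) pure(1)] p by simp
  have sum: "rep q w + sum_list T = 0" using r pu by (simp add: relation_def)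
  from T_cases show False
  proof
    assume "\<exists>s. s \<in> S \<and> e s = 1 \<and> T = [s]"
    then obtain s where s: "s \<in> S" "e s = 1" "T = [s]" by blast
    then have "rep q w + s = s + s" using sum involution_if_e_eq_1 by simp
    then have "rep q w = s" by (rule add_right_imp_eq)
    then show False using pure_rep_letter[OF l(4) pure(2), of q] s l(2) by (simp add: S0_def)
  next
    assume T: "T = []"
    have qw: "rep q w = 0" using sum T by simp
    then have "Suc (e w) dvd q" using pure_rep_eq_0[OF l(4) pure(2)] by simp
    then have q: "q = Suc (e w)"
      using relation_pure_le[OF r pure(2)] dvd_imp_le[of "Suc (e w)" q] r by (simp add: relation_def)
    obtain i where i: "p = Suc (Suc (Suc i))" using S0_e[OF l(1)] p by (intro that[of "p - 3"]) simp
    obtain j where j: "q = Suc (Suc (Suc j))" using S0_e[OF l(2)] q by (intro that[of "q - 3"]) simp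
    have M: "M = i + j + 6" using r i j T unfolding relation_def by simp
    have u0: "u + (u + (u + (rep i u + g))) = g" for g using pu by (simp add: i add.assoc[symmetric])
    have u1: "u + (u + (u + rep i u)) = 0" using pu by (simp add: i add.assoc)
    have w0: "w + (w + (w + rep j w)) = 0" using qw by (simp add: j add.assoc)
    have wu: "w + (u + g) = u + (w + g)" for g using r by (metis relation_def add.assoc)
    have wui: "w + (rep i u + g) = rep i u + (w + g)" for g
      using add_commute_rep[of w u i] r by (metis relation_def add.assoc)
    have "u + (u + w) = u + (w + w)"
    proof (rule triple_unique[OF r])
      show "u + (u + (w + sum_list (replicate (Suc i) u @ replicate (Suc (Suc j)) w))) = 0"
        by (simp add: add.assoc wu wui u0 u1 w0)
      show "u + (w + (w + sum_list (replicate (Suc (Suc i)) u @ replicate (Suc j) w))) = 0"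
        by (simp add: add.assoc wu wui u0 u1 w0)
    qed (use l M in auto)
    then show False using l by simp
  qed
qed

text \<open>The bounds on the order of \<open>w\<close> give \<open>e (w + s) = M - 2\<close>, the
  value at \<open>u + w\<close>. If \<open>w + s\<close> is no letter, the two sums coincide. If it
  is a letter, \<open>q - 1\<close> copies of \<open>w\<close> and \<open>p\<close> copies of
  \<open>u\<close> complete a shortest circuit through it, whose shape is known.\<close>

lemma no_long_pure:
  assumes r: "relation u w p q" and pure: "u + u \<notin> S" "w + w \<notin> S"
    and T: "T = [s]" "s \<in> S" "e s = 1"
    and le: "Suc (e u) \<ge> p + q - 1" "Suc (e w) \<ge> p + q" "Suc (e w) \<le> p + q + 1"
  shows False
proof -
  note l = relation_letters[OF r]
  have ss: "s + s = 0" using involution_if_e_eq_1 T by blast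
  have sw: "s + g = g + s" if "g \<in> S" for g using involution_central[OF T(2,3) that] .
  have nz: "u \<noteq> 0" "w \<noteq> 0" "s \<noteq> 0" using l T zero_notin by auto
  have ne: "s \<noteq> u" "s \<noteq> w" using l T by (auto simp: S0_def)
  have pq: "p \<ge> 1" "q \<ge> 1" "p + q + 1 = M" using r T unfolding relation_def by auto
  have uw: "u + w = w + u" using r by (simp add: relation_def)
  obtain q' where q': "q = Suc q'" using pq by (cases q) auto
  have "rep q w + rep p u + s = 0"
    using r rep_commute_rep[OF uw, of p q] T(1) unfolding relation_def by simp
  then have "s + (rep q w + rep p u) = 0" using add_eq_zero_commute by blast
  then have "s + w + (rep q' w + rep p u) = 0" by (simp add: q' add.assoc)
  then have c: "w + s + (rep q' w + rep p u) = 0" using sw[OF l(4)] by simp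
  then have "e (w + s) \<le> length (replicate q' w @ replicate p u)"
    using l by (intro e_le) auto
  then have "e (w + s) \<le> M - 2" using pq q' by simp
  moreover have "e w \<le> 1 + e (w + s)" using e_add_right[of w s] l T by (simp add: grp_letter)
  \<comment> \<open>Equality would put \<open>s\<close> on a shortest circuit through the pure
    letter \<open>w\<close>.\<close>
  moreover have "Suc (e (w + s)) \<noteq> e w"
  proof
    assume e: "Suc (e (w + s)) = e w"
    obtain R where R: "set R \<subseteq> S" "length R = e (w + s)" "w + s + sum_list R = 0"
      using e_word[of "w + s"] l T by auto
    have "set (s # R) \<subseteq> {w}"
      using R e T by (intro pure_circuit[OF l(4) pure(2)]) (auto simp: add.assoc)
    then show False using ne by simp
  qed
  ultimately have ews: "e (w + s) = M - 2" using le pq by linarith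
  have "w + s \<noteq> 0" using S0_add_ne_0[OF l(2) T(2)] by simp
  show False
  proof (cases "w + s \<in> S")
    case False
    moreover have "e (u + w) = M - 2" "u + w \<notin> S" using r by (auto simp: relation_def)
    ultimately have "w + s = u + w"
      using \<open>w + s \<noteq> 0\<close> S0_add_ne_0[OF l(1,4)] ews l(3,4) T(2) by (intro pair_unique) auto
    then have "w + s = w + u" unfolding uw .
    then show False using ne by simp
  next
    case True
    define t where "t = w + s"
    have t: "t \<in> S" "e t = M - 2" using True ews by (auto simp: t_def)
    have tw: "t \<noteq> w" using nz by (simp add: t_def)
    let ?R = "replicate q' w @ replicate p u"
    have R: "set ?R \<subseteq> S" "t + sum_list ?R = 0" "length ?R = e t"
      using c l t(2) pq q' by (auto simp: t_def)
    have u_in: "u \<in> set ?R" using pq by auto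
    show False
    proof (cases "t + t \<in> S")
      case False
      have "set ?R \<subseteq> {t}" by (rule pure_circuit[OF t(1) False R])
      then have ut: "u = t" and "q' = 0" using u_in tw by auto
      then have q: "q = 1" by (simp add: q')
      have eu: "e u = p" using t(2) ut pq q by simp
      then have "e w = Suc p" using le q e_letter_inj[OF l(3,4)] l(5) by fastforce
      \<comment> \<open>As \<open>u = w + s\<close>, the letters \<open>u\<close> and
        \<open>w\<close> have the same double. So the order \<open>p + 2\<close> of \<open>w\<close>
        divides twice the order \<open>p + 1\<close> of \<open>u\<close>, and therefore divides
        2.\<close>
      have "u + u = w + w + (s + s)" using sw[OF l(4)] by (simp add: ut t_def add.assoc) (metis add.assoc)
      then have uu: "u + u = w + w" using ss by simp
      have "rep (Suc p) (u + u) = 0"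
        using pure_rep[OF l(3) pure(1)] rep_rep[of 2 "Suc p" u] unfolding rep_double eu
        by (metis rep_zero)
      then have "Suc (e w) dvd 2 * Suc p" unfolding uu rep_double
        using pure_rep_eq_0[OF l(4) pure(2)] by blast
      then have "Suc (Suc p) dvd 2 * Suc (Suc p) - 2 * Suc p" using \<open>e w = Suc p\<close>
        by (metis dvd_diff_nat dvd_triv_right)
      then have "Suc (Suc p) dvd 2" by simp
      then show False using dvd_imp_le[of "Suc (Suc p)" 2] pq by simp
    next
      \<comment> \<open>Here \<open>u\<close> must be \<open>t + t\<close> and no \<open>w\<close>
        is left, so \<open>t + rep p u = 0\<close> with \<open>p = e t\<close>; but
        \<open>e t\<close> copies of \<open>t + t\<close> already sum to 0.\<close>
      case True
      have sub: "set ?R \<subseteq> {t, t + t}" using circuit_letters[OF t(1) R] by auto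
      have "u \<noteq> t" using True pure(1) by auto
      then have ut: "u = t + t" using sub u_in by auto
      have "q' = 0"
      proof (rule ccontr)
        assume "q' \<noteq> 0"
        then have "w \<in> set ?R" by auto
        then show False using sub tw ut l by auto
      qed
      then have "e t = p" "t + rep p u = 0" using R by auto
      then have "t = 0" using root_props(2)[OF t(1) True] ut by simp
      then show False using t zero_notin by auto
    qed
  qed
qed

text \<open>\<open>rep q w\<close> and the complementary multiple of \<open>u\<close> are words of
  known length that differ by \<open>sum_list T\<close>. If \<open>T\<close> is empty, both letters
  have order \<open>p + q\<close>. Otherwise the lengths differ by at most 1, so both orders are
  within 1 of \<open>p + q\<close>; being different, one of them is at least
  \<open>p + q\<close>.\<close>

lemma no_pure_pure:
  assumes r: "relation u w p q" and pure: "u + u \<notin> S" "w + w \<notin> S"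
  shows False
proof -
  note l = relation_letters[OF r]
  have pq: "p \<ge> 1" "q \<ge> 1" using r by (auto simp: relation_def)
  have p: "p \<le> e u" using relation_pure_le[OF relation_sym[OF r] pure(1)] no_full_pure[OF r pure] by simp
  have q: "q \<le> e w"
    using relation_pure_le[OF r pure(2)] no_full_pure[OF relation_sym[OF r] pure(2,1)] by simp
  have opposite: "rep (Suc (e u) - p) u = rep q w + sum_list T"
    if r: "relation u w p q" and pure: "u + u \<notin> S" and p: "p \<le> e u" for u w p q
  proof -
    have "rep p u + rep (Suc (e u) - p) u = 0"
      using pure_rep[OF relation_letters(3)[OF r] pure] p by (simp add: rep_add[symmetric])
    also have "\<dots> = rep p u + (rep q w + sum_list T)" using r by (simp add: relation_def add.assoc)
    finally show ?thesis by simp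
  qed
  have du: "d (rep (Suc (e u) - p) u) = Suc (e u) - p" "d (rep p u) = p"
    and dw: "d (rep (Suc (e w) - q) w) = Suc (e w) - q" "d (rep q w) = q"
    using pure_d_rep[OF l(3) pure(1)] pure_d_rep[OF l(4) pure(2)] p q pq by auto
  from T_cases show False
  proof
    assume T: "T = []"
    have "Suc (e u) - p = q" using opposite[OF r pure(1) p] du dw T by simp
    moreover have "Suc (e w) - q = p" using opposite[OF relation_sym[OF r] pure(2) q] du dw T by simp
    ultimately have "e u = e w" using p q by simp
    then show False using e_letter_inj[OF l(3,4)] l by simp
  next
    assume "\<exists>s. s \<in> S \<and> e s = 1 \<and> T = [s]"
    then obtain s where s: "s \<in> S" "e s = 1" "T = [s]" by blast
    have ss: "s + s = 0" using involution_if_e_eq_1 s by blast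
    have step: "d (g + s) \<le> Suc (d g)" if "g \<in> grp" for g
      using d_add[OF that, of s] s by (simp add: grp_letter)
    have near: "Suc (e u) \<le> p + q + 1" "p + q \<le> Suc (Suc (e u))"
      if r: "relation u w p q" and pure: "u + u \<notin> S" "w + w \<notin> S" and p: "p \<le> e u" and q: "q \<le> e w" for u w p q
    proof -
      note l = relation_letters[OF r]
      have o: "rep (Suc (e u) - p) u = rep q w + s" using opposite[OF r pure(1) p] s by simp
      then have o': "rep q w = rep (Suc (e u) - p) u + s" using ss by (simp add: add.assoc)
      have "p \<ge> 1" using r by (simp add: relation_def)
      then have "d (rep (Suc (e u) - p) u) = Suc (e u) - p" "d (rep q w) = q"
        using pure_d_rep[OF l(3) pure(1)] pure_d_rep[OF l(4) pure(2)] p q by auto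
      then have "Suc (e u) - p \<le> Suc q" "q \<le> Suc (Suc (e u) - p)"
        using step[of "rep q w"] step[of "rep (Suc (e u) - p) u"] l o o' by (metis grp_letter grp_rep)+
      then show "Suc (e u) \<le> p + q + 1" "p + q \<le> Suc (Suc (e u))" using p by auto
    qed
    note nu = near[OF r pure p q] and nw = near[OF relation_sym[OF r] pure(2,1) q p]
    have "e u \<noteq> e w" using e_letter_inj[OF l(3,4)] l by auto
    then consider "Suc (e w) \<ge> p + q" | "Suc (e u) \<ge> q + p" using nu nw by linarith
    then show False
    proof cases
      case 1
      show False by (rule no_long_pure[OF r pure s(3,1,2)]) (use 1 nu nw in auto)
    next
      case 2
      show False by (rule no_long_pure[OF relation_sym[OF r] pure(2,1) s(3,1,2)]) (use 2 nu nw in auto)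
    qed
  qed
qed

lemma no_min_mixed: False
proof -
  obtain u w p q where r: "relation u w p q"
    using two_letter_relation unfolding relation_def by metis
  then show False
    using no_double_root[OF r] no_root_pure[OF r] no_root_pure[OF relation_sym[OF r]] no_pure_pure[OF r] by blast
qed

end

section \<open>Classification of thin sets of letters\<close>

text \<open>For \<open>n = 0\<close> this holds trivially; \<open>classification\<close> supplies
  positive \<open>n\<close>.\<close>

definition has_order :: "'g::group_add \<Rightarrow> nat \<Rightarrow> bool" where
  "has_order a n \<longleftrightarrow> rep n a = 0 \<and> (\<forall>i. 0 < i \<and> i < n \<longrightarrow> rep i a \<noteq> 0)"

context thin
begin

text \<open>Injectivity of \<open>e\<close> on letters allows only one letter of order two; its
  copies are central and cancel in pairs.\<close>

lemma strip_involutions: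
  "set W \<subseteq> S \<Longrightarrow> \<exists>T. (T = [] \<or> (\<exists>s. s \<in> S \<and> e s = 1 \<and> T = [s])) \<and>
    sum_list W = sum_list (filter (\<lambda>a. e a \<noteq> 1) W) + sum_list T \<and>
    length (filter (\<lambda>a. e a \<noteq> 1) W) + length T \<le> length W"
proof (induction W)
  case (Cons a W)
  let ?F = "filter (\<lambda>a. e a \<noteq> 1) W"
  obtain T where T: "T = [] \<or> (\<exists>s. s \<in> S \<and> e s = 1 \<and> T = [s])"
      "sum_list W = sum_list ?F + sum_list T" "length ?F + length T \<le> length W"
    using Cons by auto
  show ?case
  proof (cases "e a = 1")
    case False
    then show ?thesis using T by (intro exI[of _ T]) (auto simp: add.assoc)
  next
    case True
    have aS: "a \<in> S" using Cons.prems by simp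
    have "a + sum_list ?F = sum_list ?F + a"
      using involution_central[OF aS True] Cons.prems by (intro add_commute_sum_list) auto
    then have sum: "sum_list (a # W) = sum_list ?F + (a + sum_list T)"
      using T(2) by (simp add: add.assoc[symmetric])
    from T(1) show ?thesis
    proof
      assume "T = []"
      then show ?thesis using sum T True aS by (intro exI[of _ "[a]"]) auto
    next
      assume "\<exists>s. s \<in> S \<and> e s = 1 \<and> T = [s]"
      then have "T = [a]" using e_letter_inj aS True by auto
      then show ?thesis
        using sum T involution_if_e_eq_1[OF aS True] True by (intro exI[of _ "[]"]) auto
    qed
  qed
qed simp

text \<open>Concatenating circuits through \<open>u\<close> and \<open>w\<close> gives a mixed word,
  so a shortest one exists. Stripping it of letters of order two yields an instance of the
  contradictory locale \<open>min_mixed\<close>.\<close>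

lemma not_apart_S0:
  assumes u: "u \<in> S0" and w: "w \<in> S0"
  shows "\<not> apart u w"
proof
  assume uw: "apart u w"
  obtain Q where Q: "set Q \<subseteq> S" "u + sum_list Q = 0" using e_word[of u] u S0_subset by blast
  obtain R where R: "set R \<subseteq> S" "w + sum_list R = 0" using e_word[of w] w S0_subset by blast
  have "sum_list (u # Q @ w # R) = (u + sum_list Q) + (w + sum_list R)" by (simp add: add.assoc)
  then have "mixed (u # Q @ w # R)"
    using Q R u w uw S0_subset by (intro mixedI[of _ u w]) auto
  then have ex: "\<exists>n W. mixed W \<and> length W = n" by blast
  define M where "M = (LEAST n. \<exists>W. mixed W \<and> length W = n)"
  obtain W where W: "mixed W" "length W = M" using LeastI_ex[OF ex] by (auto simp: M_def)
  have M_le: "M \<le> length V" if "mixed V" for V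
    unfolding M_def using that by (intro Least_le) blast
  let ?F = "filter (\<lambda>a. e a \<noteq> 1) W"
  obtain T where T: "T = [] \<or> (\<exists>s. s \<in> S \<and> e s = 1 \<and> T = [s])"
      "sum_list W = sum_list ?F + sum_list T" "length ?F + length T \<le> length W"
    using strip_involutions[of W] W by (auto simp: mixed_def)
  have F: "set ?F \<subseteq> S0" using W by (auto simp: mixed_def S0_def)
  obtain a b where "a \<in> set ?F" "b \<in> set ?F" "apart a b" "a \<in> S0" "b \<in> S0"
    using W by (auto simp: mixed_def S0_def)
  then have mixed: "mixed (?F @ T)"
    using W T F S0_subset by (intro mixedI[of _ a b]) (auto simp: mixed_def)
  then have "length ?F + length T = M" using M_le[OF mixed] T(3) W by simp
  then interpret min_mixed S M T
    using M_le T(1) F mixed by unfold_locales blast+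
  show False by (rule no_min_mixed)
qed

lemma pure_has_order: "x \<in> S \<Longrightarrow> x + x \<notin> S \<Longrightarrow> has_order x (Suc (e x))"
  using pure_rep[of x] pure_rep_eq_0[of x] dvd_imp_le[of "Suc (e x)"]
  unfolding has_order_def by (metis not_le)

lemma rep_Suc_double: "rep (Suc (2 * j)) y = y + rep j (y + y)"
  by (simp add: rep_double)

text \<open>Even multiples of \<open>y\<close> are multiples of \<open>y + y\<close>, which has
  order \<open>e y\<close>. An odd one that vanishes would close \<open>y\<close> by fewer than
  \<open>e y\<close> copies of \<open>y + y\<close>.\<close>

lemma root_has_order:
  assumes y: "y \<in> S" "y + y \<in> S"
  shows "has_order y (2 * e y)"
  unfolding has_order_def
proof (intro conjI allI impI)
  note p = root_props[OF y]
  show "rep (2 * e y) y = 0" using p(2) by (simp add: rep_double)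
  fix i assume i: "0 < i \<and> i < 2 * e y"
  show "rep i y \<noteq> 0"
  proof
    assume 0: "rep i y = 0"
    show False
    proof (cases "even i")
      case True
      then obtain j where j: "i = 2 * j" by (elim evenE)
      then have "rep j (y + y) = 0" using 0 by (simp add: rep_double)
      then have "e y dvd j" using pure_rep_eq_0[OF y(2) p(3)] p(1) by simp
      then show False using i j dvd_imp_le[of "e y" j] by simp
    next
      case False
      then obtain j where j: "i = Suc (2 * j)" using oddE by fastforce
      then have "y + rep j (y + y) = 0" using 0 by (simp only: rep_Suc_double)
      then have "e y \<le> length (replicate j (y + y))" using y by (intro e_le) auto
      then show False using i j by simp
    qed
  qed
qed

text \<open>Among even multiples only \<open>y + y\<close> is a letter. If
  \<open>y + rep j (y + y) = s\<close>, substituting into \<open>rep (e y) (y + y) = 0\<close>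
  writes \<open>- y\<close> as \<open>s\<close> plus copies of \<open>y + y\<close>, which is too
  short unless \<open>j = 0\<close>.\<close>

lemma root_multiples_ne_involution:
  assumes y: "y \<in> S" "y + y \<in> S0" and s: "s \<in> S" "e s = 1"
  shows "rep i y \<noteq> s"
proof
  assume "rep i y = s"
  have x: "y + y \<in> S" using y S0_subset by blast
  note p = root_props[OF y(1) x]
  define i' where "i' = i mod (2 * e y)"
  have "rep (2 * e y) y = 0" using root_has_order[OF y(1) x] by (simp add: has_order_def)
  then have i': "rep i' y = s" using rep_mod \<open>rep i y = s\<close> by (metis i'_def)
  have less: "i' < 2 * e y" using p(4) by (simp add: i'_def)
  show False
  proof (cases "even i'")
    case True
    then obtain j where "i' = 2 * j" by (elim evenE)
    then have "rep j (y + y) = s" using i' by (simp add: rep_double)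
    then have "y + y = s" using pure_rep_letter[OF x p(3), of j] s by simp
    then show False using y s by (simp add: S0_def)
  next
    case False
    then obtain j where j: "i' = Suc (2 * j)" using oddE by fastforce
    then have yj: "y + rep j (y + y) = s" using i' by (simp only: rep_Suc_double)
    obtain k where k: "e y = Suc (j + k)"
      using less j by (intro that[of "e y - Suc j"]) linarith
    have "y + (y + rep (j + k) (y + y)) = 0"
      using p(2) by (simp add: k add.assoc)
    moreover have "y + rep (j + k) (y + y) = s + rep k (y + y)"
      by (simp only: rep_add yj[symmetric] add.assoc)
    ultimately have "- y = s + rep k (y + y)" by (metis minus_unique)
    then have "e y \<le> d s + d (rep k (y + y))"
      using d_add[of s "rep k (y + y)"] s x by (simp add: grp_letter grp_rep)
    then have "j = 0" using d_rep_le[OF x, of k] s k by simp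
    then have "y = s" using yj by simp
    moreover have "e y \<ge> 2" using p(4) .
    ultimately show False using s by simp
  qed
qed

theorem classification:
  assumes "S \<noteq> {}"
  shows "(\<exists>x n. n \<ge> 2 \<and> S = {x} \<and> has_order x n) \<or>
    (\<exists>y n. n \<ge> 2 \<and> S = {y, y + y} \<and> has_order y (2 * n)) \<or>
    (\<exists>s x n. n \<ge> 3 \<and> S = {s, x} \<and> s + s = 0 \<and> s + x = x + s \<and> has_order x n \<and> (\<forall>i. rep i x \<noteq> s)) \<or>
    (\<exists>s y n. n \<ge> 3 \<and> S = {s, y, y + y} \<and> s + s = 0 \<and> s + y = y + s \<and> has_order y (2 * n) \<and>
      (\<forall>i. rep i y \<noteq> s))"
proof -
  have single: ?thesis if S: "S = {x}" for x
  proof -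
    have x: "x \<in> S" "x + x \<notin> S" using S zero_notin by auto
    have "Suc (e x) \<ge> 2" using e_letter_pos[OF x(1)] by simp
    then show ?thesis using pure_has_order[OF x] S
      by (intro disjI1 exI[of _ x] exI[of _ "Suc (e x)"] conjI)
  qed
  have S_eq: "S = S0 \<union> {s}" if "s \<in> S" "e s = 1" for s
  proof (intro equalityI subsetI)
    fix a assume a: "a \<in> S"
    show "a \<in> S0 \<union> {s}"
    proof (cases "e a = 1")
      case True
      then show ?thesis using e_letter_inj[OF a that(1)] that(2) by simp
    qed (simp add: a S0_def)
  next
    fix a assume "a \<in> S0 \<union> {s}"
    then show "a \<in> S" using that S0_subset by blast
  qed
  show ?thesis
  proof (cases "\<exists>y \<in> S0. y + y \<in> S0")
    case True
    then obtain y where y: "y \<in> S0" "y + y \<in> S0" by blast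
    then have yS: "y \<in> S" "y + y \<in> S" using S0_subset by auto
    note p = root_props[OF yS]
    have "z \<in> {y, y + y}" if "z \<in> S0" for z
      using not_apart_S0[OF y(1) that] root_props(3)[of z] that yS S0_subset[of z] by (auto simp: apart_def)
    then have S0: "S0 = {y, y + y}" using y by auto
    \<comment> \<open>\<open>e y\<close> exceeds \<open>e (y + y)\<close> by 1, and
      \<open>y + y\<close> is not of order two.\<close>
    have ey: "e y \<ge> 3" using p(1) S0_e[OF y(2)] by linarith
    note o = root_has_order[OF yS]
    show ?thesis
    proof (cases "\<exists>s \<in> S. e s = 1")
      case False
      then have "S = S0" by (auto simp: S0_def)
      then have "S = {y, y + y}" using S0 by (rule trans)
      then show ?thesis using o p(4) by (intro disjI2[OF disjI1] exI[of _ y] exI[of _ "e y"] conjI)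
    next
      case True
      then obtain s where s: "s \<in> S" "e s = 1" by blast
      have "S = {s, y, y + y}" using S_eq[OF s] unfolding S0 by (rule trans) blast
      then show ?thesis
        using o ey involution_if_e_eq_1[OF s] involution_central[OF s yS(1)]
          allI[OF root_multiples_ne_involution[OF yS(1) y(2) s]]
        by (intro disjI2[OF disjI2[OF disjI2]] exI[of _ s] exI[of _ y] exI[of _ "e y"] conjI)
    qed
  next
    case no_root: False
    show ?thesis
    proof (cases "S0 = {}")
      case True
      then obtain s where s: "s \<in> S" "e s = 1" using assms by (auto simp: S0_def)
      then show ?thesis using single S_eq[OF s] True by simp
    next
      case False
      then obtain x where x: "x \<in> S0" by blast
      then have xS: "x \<in> S" by (rule S0_subset)
      have S0: "S0 = {x}" using not_apart_S0[OF x] no_root x by (auto simp: apart_def)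
      show ?thesis
      proof (cases "\<exists>s \<in> S. e s = 1")
        case False
        then have "S = S0" by (auto simp: S0_def)
        then have "S = {x}" using S0 by (rule trans)
        then show ?thesis by (rule single)
      next
        case True
        then obtain s where s: "s \<in> S" "e s = 1" by blast
        have S: "S = {s, x}" using S_eq[OF s] unfolding S0 by (rule trans) blast
        show ?thesis
        proof (cases "x + x \<in> S")
          \<comment> \<open>Here \<open>e x = 2\<close>: this is \<open>Cay(Z_4, {1, 2})\<close>,
            which falls under the second form.\<close>
          case True
          then have "x + x = s" using S zero_notin by auto
          then have "S = {x, x + x}" using S by auto
          then show ?thesis
            using root_has_order[OF xS True] root_props(4)[OF xS True]
            by (intro disjI2[OF disjI1] exI[of _ x] exI[of _ "e x"] conjI)
        next
          case False
          have "s \<noteq> x" using s x by (auto simp: S0_def)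
          then have "\<forall>i. rep i x \<noteq> s" using pure_rep_letter[OF xS False] s(1) by metis
          moreover have "Suc (e x) \<ge> 3" using S0_e[OF x] by simp
          ultimately show ?thesis
            using S pure_has_order[OF xS False] involution_if_e_eq_1[OF s] involution_central[OF s xS]
            by (intro disjI2[OF disjI2[OF disjI1]] exI[of _ s] exI[of _ x] exI[of _ "Suc (e x)"] conjI)
        qed
      qed
    qed
  qed
qed

end

section \<open>Distances in digraphs and Cayley digraphs\<close>

text \<open>Counts walks instead of paths and sees only end pairs of arcs, which makes it easy to
  transport along bijections.\<close>

definition rdist :: "('a \<times> 'a) set \<Rightarrow> 'a \<Rightarrow> 'a \<Rightarrow> nat" where
  "rdist E u v = (LEAST n. (u, v) \<in> E ^^ n)"

text \<open>Applied with paths for \<open>P\<close> and walks for \<open>Q\<close>. If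
  \<open>Q\<close> is empty both sides are the same default value, which covers unreachable
  pairs.\<close>

lemma Least_eq_if_cofinal:
  fixes P Q :: "nat \<Rightarrow> bool"
  assumes "\<And>n. P n \<Longrightarrow> Q n" "\<And>n. Q n \<Longrightarrow> \<exists>m\<le>n. P m"
  shows "Least P = Least Q"
proof (cases "\<exists>n. Q n")
  case True
  then have Q: "Q (Least Q)" by (rule LeastI_ex)
  then obtain m where m: "m \<le> Least Q" "P m" using assms(2) by blast
  then have "Least P \<le> Least Q" using Least_le[of P m] by simp
  moreover have "Least Q \<le> Least P" using assms(1)[OF LeastI[of P m]] m by (intro Least_le) simp
  ultimately show ?thesis by simp
next
  case False
  then have "P = Q" using assms(1) by blast
  then show ?thesis by simp
qed

context wf_digraph
begin

lemma awalk_iff_relpow: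
  assumes "u \<in> verts G"
  shows "(\<exists>p. awalk u p v \<and> length p = n) \<longleftrightarrow> (u, v) \<in> arcs_ends G ^^ n"
  using assms
proof (induction n arbitrary: u)
  case 0
  then show ?case by (auto simp: awalk_Nil_iff)
next
  case (Suc n)
  show ?case
  proof
    assume "\<exists>p. awalk u p v \<and> length p = Suc n"
    then obtain a p where ap: "awalk u (a # p) v" "length p = n" by (auto simp: length_Suc_conv)
    then have a: "a \<in> arcs G" "u = tail G a" "awalk (head G a) p v" by (auto simp: awalk_Cons_iff)
    then have "(head G a, v) \<in> arcs_ends G ^^ n" using Suc.IH[of "head G a"] ap by auto
    moreover have "(u, head G a) \<in> arcs_ends G" using a by (auto simp: arcs_ends_conv)
    ultimately show "(u, v) \<in> arcs_ends G ^^ Suc n" by (rule relpow_Suc_I2[rotated])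
  next
    assume "(u, v) \<in> arcs_ends G ^^ Suc n"
    then obtain w where w: "(u, w) \<in> arcs_ends G" "(w, v) \<in> arcs_ends G ^^ n"
      by (rule relpow_Suc_E2)
    then obtain p where p: "awalk w p v" "length p = n" using Suc.IH[of w] adj_in_verts by blast
    obtain a where "a \<in> arcs G" "tail G a = u" "head G a = w" using w(1) by (auto simp: arcs_ends_conv)
    then have "awalk u (a # p) v" using p by (auto simp: awalk_Cons_iff)
    then show "\<exists>p. awalk u p v \<and> length p = Suc n" using p by (metis length_Cons)
  qed
qed

lemma apath_not_longer:
  "awalk u p v \<Longrightarrow> \<exists>q. apath u q v \<and> length q \<le> length p"
proof (induction "length p" arbitrary: p rule: less_induct)
  case less
  show ?case
  proof (cases "distinct (awalk_verts u p)")
    case True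
    then show ?thesis using less.prems by (auto simp: apath_def)
  next
    case False
    then obtain q r s w where "p = q @ r @ s" "0 < length r" "awalk u q w" "awalk w s v"
      using awalk_not_distinct_decomp[OF less.prems] by blast
    then have "awalk u (q @ s) v" "length (q @ s) < length p" by (auto intro: awalk_appendI)
    then show ?thesis using less.hyps[of "q @ s"] by (meson less_le_trans order.strict_implies_order order.trans)
  qed
qed

lemma digraph_dist_eq:
  assumes "u \<in> verts G"
  shows "digraph_dist G u v = rdist (arcs_ends G) u v"
  unfolding digraph_dist_def rdist_def
proof (rule Least_eq_if_cofinal)
  fix n assume "\<exists>p. apath u p v \<and> length p = n"
  then show "(u, v) \<in> arcs_ends G ^^ n" unfolding awalk_iff_relpow[OF assms, symmetric]
    by (auto simp: apath_def)
next
  fix n assume "(u, v) \<in> arcs_ends G ^^ n"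
  then obtain p where "awalk u p v" "length p = n" using awalk_iff_relpow[OF assms] by blast
  then show "\<exists>m\<le>n. \<exists>p. apath u p v \<and> length p = m" using apath_not_longer by blast
qed

lemma two_way_dist_eq:
  "u \<in> verts G \<Longrightarrow> v \<in> verts G \<Longrightarrow>
    two_way_dist G u v = (rdist (arcs_ends G) u v, rdist (arcs_ends G) v u)"
  by (simp add: two_way_dist_def digraph_dist_eq)

end

lemma relpow_rdist: "(u, v) \<in> E\<^sup>* \<Longrightarrow> (u, v) \<in> E ^^ rdist E u v"
  unfolding rdist_def by (rule LeastI_ex) (simp add: rtrancl_power[symmetric])

lemma rdist_le: "(u, v) \<in> E ^^ n \<Longrightarrow> rdist E u v \<le> n"
  unfolding rdist_def by (rule Least_le)

text \<open>The minimum is attained because the whole vertex set resolves: only the vertex itself is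
  at distance 0. It is not 0 because the empty set does not separate two vertices.\<close>

lemma (in wf_digraph) weak_metric_dim_eq_1_iff:
  assumes "strongly_connected G" "card (verts G) \<ge> 2"
  shows "weak_metric_dim G = 1 \<longleftrightarrow>
    (\<exists>w \<in> verts G. inj_on (\<lambda>u. (rdist (arcs_ends G) w u, rdist (arcs_ends G) u w)) (verts G))"
proof -
  let ?E = "arcs_ends G"
  let ?P = "\<lambda>m. \<exists>W. weakly_resolving G W \<and> card W = m"
  have fin: "finite (verts G)" using assms(2) card.infinite by fastforce
  have "\<not> card (verts G) \<le> Suc 0" using assms(2) by simp
  then obtain u v where "u \<in> verts G" "v \<in> verts G" "u \<noteq> v"
    using card_le_Suc0_iff_eq[OF fin] by blast
  then have not0: "\<not> ?P 0" unfolding weakly_resolving_def by (metis card_0_eq empty_iff)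
  have "weakly_resolving G (verts G)"
    unfolding weakly_resolving_def
  proof (intro conjI ballI impI)
    fix u v assume uv: "u \<in> verts G" "v \<in> verts G" "u \<noteq> v"
    have "(u, v) \<in> ?E\<^sup>*" using assms(1) uv by (auto simp: strongly_connected_def intro: reachable_rtranclI)
    then have "rdist ?E u v \<noteq> 0" using relpow_rdist[of u v ?E] uv(3) by (cases "rdist ?E u v") auto
    moreover have "rdist ?E u u = 0" using rdist_le[of u u 0 ?E] by simp
    ultimately show "\<exists>w \<in> verts G. two_way_dist G w u \<noteq> two_way_dist G w v"
      using uv by (intro bexI[of _ u]) (auto simp: two_way_dist_eq)
  qed (use fin in auto)
  then have "?P (card (verts G))" by (intro exI[of _ "verts G"]) simp
  then have P: "?P (LEAST m. ?P m)" by (rule LeastI)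
  have "(LEAST m. ?P m) = 1 \<longleftrightarrow> ?P 1"
  proof
    assume "?P 1"
    then have "(LEAST m. ?P m) \<le> 1" by (rule Least_le)
    moreover have "(LEAST m. ?P m) \<noteq> 0"
    proof
      assume "(LEAST m. ?P m) = 0"
      with P have "?P 0" by (rule subst[rotated])
      then show False using not0 by contradiction
    qed
    ultimately show "(LEAST m. ?P m) = 1" by simp
  next
    assume "(LEAST m. ?P m) = 1"
    then show "?P 1" using P by (rule subst)
  qed
  also have "?P 1 \<longleftrightarrow> (\<exists>w. weakly_resolving G {w})"
    by (metis card_1_singletonE is_singletonI is_singleton_altdef)
  also have "\<dots> \<longleftrightarrow> (\<exists>w \<in> verts G. inj_on (\<lambda>u. (rdist ?E w u, rdist ?E u w)) (verts G))"
  proof -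
    have "weakly_resolving G {w} \<longleftrightarrow>
        w \<in> verts G \<and> inj_on (\<lambda>u. (rdist ?E w u, rdist ?E u w)) (verts G)" for w
    proof (cases "w \<in> verts G")
      case True
      then show ?thesis
        unfolding weakly_resolving_def inj_on_def by (auto simp: two_way_dist_eq)
    qed (simp add: weakly_resolving_def)
    then show ?thesis by blast
  qed
  finally show ?thesis unfolding weak_metric_dim_def .
qed

section \<open>Isomorphisms onto Cayley digraphs\<close>

lemma Cay_simps [simp]: "verts (Cay K T) = carrier K" "tail (Cay K T) = fst" "head (Cay K T) = snd"
  by (simp_all add: Cay_def)

lemma arcs_ends_Cay: "arcs_ends (Cay K T) = arcs (Cay K T)"
  by (auto simp: arcs_ends_conv image_iff)

text \<open>Arcs of \<open>G\<close> are abstract, so each is sent to the pair of images of its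
  ends; absence of parallel arcs makes this injective.\<close>

lemma (in nomulti_digraph) digraph_iso_CayI:
  assumes bij: "bij_betw \<chi> (carrier K) (verts G)"
    and arcs: "\<And>x y. x \<in> carrier K \<Longrightarrow> y \<in> carrier K \<Longrightarrow>
      (\<chi> x, \<chi> y) \<in> arcs_ends G \<longleftrightarrow> (x, y) \<in> arcs (Cay K T)"
    and sub: "arcs (Cay K T) \<subseteq> carrier K \<times> carrier K"
  shows "digraph_iso G (Cay K T)"
proof -
  define \<phi> where "\<phi> = the_inv_into (carrier K) \<chi>"
  have inj: "inj_on \<chi> (carrier K)" and im: "\<chi> ` carrier K = verts G" using bij by (auto simp: bij_betw_def)
  have \<phi>\<chi>: "\<phi> (\<chi> x) = x" if "x \<in> carrier K" for x
    using the_inv_into_f_f[OF inj that] by (simp add: \<phi>_def)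
  have \<chi>\<phi>: "\<chi> (\<phi> v) = v" "\<phi> v \<in> carrier K" if "v \<in> verts G" for v
    using that \<phi>\<chi> unfolding im[symmetric] by auto
  have \<phi>_bij: "bij_betw \<phi> (verts G) (carrier K)"
    unfolding \<phi>_def by (rule bij_betw_the_inv_into[OF bij])
  define f where "f = \<lparr>iso_verts = \<phi>, iso_arcs = \<lambda>a. (\<phi> (tail G a), \<phi> (head G a)), iso_head = snd, iso_tail = fst\<rparr>"
  have "digraph_isomorphism f"
    unfolding digraph_isomorphism_def
  proof (intro conjI ballI)
    show "wf_digraph G" by unfold_locales
    show "inj_on (iso_verts f) (verts G)" using \<phi>_bij by (simp add: f_def bij_betw_def)
    show "inj_on (iso_arcs f) (arcs G)"
    proof (rule inj_onI)
      fix a b assume ab: "a \<in> arcs G" "b \<in> arcs G" "iso_arcs f a = iso_arcs f b"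
      then have "\<chi> (\<phi> (tail G a)) = \<chi> (\<phi> (tail G b))" "\<chi> (\<phi> (head G a)) = \<chi> (\<phi> (head G b))"
        by (auto simp: f_def)
      then have "arc_to_ends G a = arc_to_ends G b" using ab \<chi>\<phi> by (simp add: arc_to_ends_def)
      then show "a = b" using no_multi_arcs ab by blast
    qed
  qed (auto simp: f_def)
  moreover have "Cay K T = app_iso f G"
  proof (intro pre_digraph.equality)
    show "verts (Cay K T) = verts (app_iso f G)" using \<phi>_bij by (simp add: f_def bij_betw_def)
    show "arcs (Cay K T) = arcs (app_iso f G)"
    proof (intro equalityI subsetI)
      fix z assume z: "z \<in> arcs (Cay K T)"
      then obtain x y where xy: "z = (x, y)" "x \<in> carrier K" "y \<in> carrier K" using sub by auto
      then have "(\<chi> x, \<chi> y) \<in> arcs_ends G" using arcs z by simp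
      then obtain a where "a \<in> arcs G" "tail G a = \<chi> x" "head G a = \<chi> y" by (rule reachableE)
      then show "z \<in> arcs (app_iso f G)" using xy by (auto simp: f_def \<phi>\<chi> intro!: image_eqI[of _ _ a])
    next
      fix z assume "z \<in> arcs (app_iso f G)"
      then obtain a where a: "a \<in> arcs G" "z = (\<phi> (tail G a), \<phi> (head G a))" by (auto simp: f_def)
      then have "(\<chi> (\<phi> (tail G a)), \<chi> (\<phi> (head G a))) \<in> arcs_ends G"
        by (auto simp: \<chi>\<phi> arcs_ends_conv)
      then show "z \<in> arcs (Cay K T)"
        using a arcs[OF \<chi>\<phi>(2)[of "tail G a"] \<chi>\<phi>(2)[of "head G a"]] by simp
    qed
  qed (simp_all add: f_def)
  ultimately show ?thesis unfolding digraph_iso_def by blast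
qed

lemma (in wf_digraph) digraph_iso_CayE:
  assumes "digraph_iso G (Cay K T)"
  obtains \<phi> where "bij_betw \<phi> (verts G) (carrier K)"
    "\<And>u v. u \<in> verts G \<Longrightarrow> v \<in> verts G \<Longrightarrow> (u, v) \<in> arcs_ends G \<longleftrightarrow> (\<phi> u, \<phi> v) \<in> arcs (Cay K T)"
proof -
  obtain f where f: "digraph_isomorphism f" "Cay K T = app_iso f G"
    using assms by (auto simp: digraph_iso_def)
  have inj: "inj_on (iso_verts f) (verts G)" by (rule digraph_isomorphism_inj_on_verts[OF f(1)])
  have "verts (Cay K T) = iso_verts f ` verts G" unfolding f(2) by simp
  then have "bij_betw (iso_verts f) (verts G) (carrier K)" using inj by (simp add: bij_betw_def)
  moreover have "arcs (Cay K T) = (\<lambda>(u, v). (iso_verts f u, iso_verts f v)) ` arcs_ends G"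
    using arcs_ends_app_iso_eq[OF f(1)] f(2) arcs_ends_Cay by metis
  then have "(u, v) \<in> arcs_ends G \<longleftrightarrow> (iso_verts f u, iso_verts f v) \<in> arcs (Cay K T)"
    if "u \<in> verts G" "v \<in> verts G" for u v
    using that inj adj_in_verts by (auto simp: inj_on_eq_iff)
  ultimately show ?thesis using that by blast
qed

section \<open>Distances in the four families\<close>

text \<open>These conditions characterise the distance from \<open>z\<close> within \<open>C\<close>.\<close>

definition potential :: "('a \<times> 'a) set \<Rightarrow> 'a set \<Rightarrow> 'a \<Rightarrow> ('a \<Rightarrow> nat) \<Rightarrow> bool" where
  "potential R C z f \<longleftrightarrow> f z = 0 \<and> (\<forall>x y. (x, y) \<in> R \<longrightarrow> f y \<le> Suc (f x)) \<and>
    (\<forall>y \<in> C. y \<noteq> z \<longrightarrow> (\<exists>x \<in> C. (x, y) \<in> R \<and> f y = Suc (f x)))"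

text \<open>Predecessors of smaller value trace a walk of length \<open>f v\<close>, and no walk
  raises \<open>f\<close> by more than 1 per arc.\<close>

lemma potential_rdist:
  assumes p: "potential R C z f" and v: "v \<in> C"
  shows "rdist R z v = f v"
proof (rule antisym)
  have "(z, v) \<in> R ^^ f v"
    using v
  proof (induction "f v" arbitrary: v)
    case 0
    then have "v = z" using p by (auto simp: potential_def)
    then show ?case using p by (simp add: potential_def)
  next
    case (Suc n)
    then have "v \<noteq> z" using p by (auto simp: potential_def)
    then obtain x where x: "x \<in> C" "(x, v) \<in> R" "f v = Suc (f x)" using p Suc.prems by (auto simp: potential_def)
    then have "(z, x) \<in> R ^^ f x" using Suc by simp
    then show ?case unfolding x(3) using x(2) by (rule relpow_Suc_I)
  qed
  then show "rdist R z v \<le> f v" by (rule rdist_le)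
  have le: "f y \<le> n" if "(z, y) \<in> R ^^ n" for n y
    using that
  proof (induction n arbitrary: y)
    case 0
    then show ?case using p by (simp add: potential_def)
  next
    case (Suc n)
    then obtain x where "(z, x) \<in> R ^^ n" "(x, y) \<in> R" by (elim relpow_Suc_E)
    then have "f x \<le> n" "f y \<le> Suc (f x)" using Suc.IH p by (auto simp: potential_def)
    then show ?case by simp
  qed
  have "(z, v) \<in> R ^^ rdist R z v"
    using \<open>(z, v) \<in> R ^^ f v\<close> by (intro relpow_rdist) (rule relpow_imp_rtrancl)
  then show "f v \<le> rdist R z v" by (rule le)
qed

lemma relpow_converse: "(E\<inverse>) ^^ n = (E ^^ n :: ('a \<times> 'a) set)\<inverse>"
proof (induction n)
  case (Suc n)
  then show ?case by (simp add: converse_relcomp relpow_commute flip: Suc)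
qed simp

lemma rdist_converse: "rdist (E\<inverse>) u v = rdist E v u"
  by (simp add: rdist_def relpow_converse)

lemma (in wf_digraph) weak_metric_dim_eq_1_if_potentials:
  assumes conn: "strongly_connected G" "card (verts G) \<ge> 2"
    and iso: "digraph_iso G (Cay K T)" and z: "z \<in> carrier K"
    and f: "potential (arcs (Cay K T)) (carrier K) z f"
    and g: "potential ((arcs (Cay K T))\<inverse>) (carrier K) z g"
    and inj: "inj_on (\<lambda>x. (f x, g x)) (carrier K)"
  shows "weak_metric_dim G = 1"
proof -
  obtain \<phi> where bij: "bij_betw \<phi> (verts G) (carrier K)"
    and arcs: "\<And>u v. u \<in> verts G \<Longrightarrow> v \<in> verts G \<Longrightarrow> (u, v) \<in> arcs_ends G \<longleftrightarrow> (\<phi> u, \<phi> v) \<in> arcs (Cay K T)"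
    using digraph_iso_CayE[OF iso] by blast
  have im: "\<phi> ` verts G = carrier K" and inj_\<phi>: "inj_on \<phi> (verts G)" using bij by (auto simp: bij_betw_def)
  obtain w where w: "w \<in> verts G" "\<phi> w = z" using z unfolding im[symmetric] by blast
  have transport: "potential E (verts G) w (h \<circ> \<phi>)"
    if h: "potential R (carrier K) z h" and E: "E \<subseteq> verts G \<times> verts G"
      "\<And>u v. u \<in> verts G \<Longrightarrow> v \<in> verts G \<Longrightarrow> (u, v) \<in> E \<longleftrightarrow> (\<phi> u, \<phi> v) \<in> R" for E R h
    unfolding potential_def
  proof (intro conjI allI impI ballI)
    show "(h \<circ> \<phi>) w = 0" using h w by (simp add: potential_def)
    fix u v assume "(u, v) \<in> E"
    then show "(h \<circ> \<phi>) v \<le> Suc ((h \<circ> \<phi>) u)" using E h by (fastforce simp: potential_def)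
  next
    fix v assume v: "v \<in> verts G" "v \<noteq> w"
    then have "\<phi> v \<in> carrier K" "\<phi> v \<noteq> z" using im w inj_\<phi> by (auto dest: inj_onD)
    then obtain x where x: "x \<in> carrier K" "(x, \<phi> v) \<in> R" "h (\<phi> v) = Suc (h x)"
      using h by (auto simp: potential_def)
    then obtain u where "u \<in> verts G" "\<phi> u = x" unfolding im[symmetric] by blast
    then show "\<exists>u \<in> verts G. (u, v) \<in> E \<and> (h \<circ> \<phi>) v = Suc ((h \<circ> \<phi>) u)"
      using x E(2) v by (intro bexI[of _ u]) auto
  qed
  have sub: "arcs_ends G \<subseteq> verts G \<times> verts G" using adj_in_verts by auto
  have "potential (arcs_ends G) (verts G) w (f \<circ> \<phi>)" using sub arcs by (rule transport[OF f])
  moreover have "potential ((arcs_ends G)\<inverse>) (verts G) w (g \<circ> \<phi>)"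
    using sub arcs by (intro transport[OF g]) auto
  ultimately have d: "rdist (arcs_ends G) w u = f (\<phi> u)" "rdist (arcs_ends G) u w = g (\<phi> u)" if "u \<in> verts G" for u
    using potential_rdist[of "arcs_ends G" "verts G" w _ u]
      potential_rdist[of "(arcs_ends G)\<inverse>" "verts G" w _ u] that by (auto simp: rdist_converse)
  have "inj_on ((\<lambda>x. (f x, g x)) \<circ> \<phi>) (verts G)" using inj inj_\<phi> im by (simp add: comp_inj_on)
  then have "inj_on (\<lambda>u. (rdist (arcs_ends G) w u, rdist (arcs_ends G) u w)) (verts G)"
    by (rule inj_on_cong[THEN iffD1, rotated]) (simp add: d)
  then show ?thesis using weak_metric_dim_eq_1_iff[OF conn] w by blast
qed

section \<open>Adding a factor of order two\<close>

text \<open>The Cartesian product with two opposite arcs between 0 and 1; \<open>1 - j\<close> is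
  the other element of the first factor.\<close>

definition double_rel :: "'a set \<Rightarrow> ('a \<times> 'a) set \<Rightarrow> ((int \<times> 'a) \<times> (int \<times> 'a)) set" where
  "double_rel C R = {((j, x), (1 - j, x)) | j x. j \<in> {0, 1} \<and> x \<in> C} \<union>
    {((j, x), (j, y)) | j x y. j \<in> {0, 1} \<and> (x, y) \<in> R}"

lemma double_rel_converse: "(double_rel C R)\<inverse> = double_rel C (R\<inverse>)"
  unfolding double_rel_def by force

lemma potential_double:
  assumes f: "potential R C z f" and z: "z \<in> C"
  shows "potential (double_rel C R) ({0, 1} \<times> C) (0, z) (\<lambda>(j, x). nat j + f x)"
  unfolding potential_def
proof (intro conjI allI impI ballI)
  show "(case (0, z) of (j, x) \<Rightarrow> nat j + f x) = 0" using f by (simp add: potential_def)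
  fix p q assume "(p, q) \<in> double_rel C R"
  then show "(case q of (j, x) \<Rightarrow> nat j + f x) \<le> Suc (case p of (j, x) \<Rightarrow> nat j + f x)"
    using f by (auto simp: double_rel_def potential_def)
next
  fix q assume q: "q \<in> {0 :: int, 1} \<times> C" "q \<noteq> (0, z)"
  then obtain j y where jy: "q = (j, y)" "j \<in> {0, 1}" "y \<in> C" by auto
  show "\<exists>p \<in> {0, 1} \<times> C. (p, q) \<in> double_rel C R \<and>
      (case q of (j, x) \<Rightarrow> nat j + f x) = Suc (case p of (j, x) \<Rightarrow> nat j + f x)"
  proof (cases "y = z")
    case True
    then have "j = 1" using q jy by auto
    then show ?thesis using jy True z by (intro bexI[of _ "(0, z)"]) (auto simp: double_rel_def)
  next
    case False
    then obtain x where "x \<in> C" "(x, y) \<in> R" "f y = Suc (f x)" using f jy by (auto simp: potential_def)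
    then show ?thesis using jy by (intro bexI[of _ "(j, x)"]) (auto simp: double_rel_def)
  qed
qed

text \<open>A collision between the two copies means that \<open>f\<close> and \<open>g\<close> both
  drop by 1 from \<open>x\<close> to \<open>y\<close>. This contradicts \<open>near\<close> unless
  \<open>y = z\<close>, where it contradicts \<open>not_1\<close>.\<close>

lemma inj_on_double:
  assumes inj: "inj_on (\<lambda>x. (f x, g x)) C"
    and near: "\<And>x y. x \<in> C \<Longrightarrow> y \<in> C \<Longrightarrow> y \<noteq> z \<Longrightarrow> f x + g x < f y + g y + 2"
    and not_1: "\<And>x. x \<in> C \<Longrightarrow> \<not> (f x = 1 \<and> g x = 1)" and z: "f z = 0" "g z = 0"
  shows "inj_on (\<lambda>p. (case p of (j, x) \<Rightarrow> nat j + f x, case p of (j, x) \<Rightarrow> nat j + g x)) ({0 :: int, 1} \<times> C)"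
proof -
  have False if "x \<in> C" "y \<in> C" "f x = Suc (f y)" "g x = Suc (g y)" for x y
  proof (cases "y = z")
    case True
    then show ?thesis using that not_1[of x] z by simp
  next
    case False
    then show ?thesis using that near[of x y] by simp
  qed
  then show ?thesis using inj unfolding inj_on_def by (auto; metis)
qed

lemma arcs_Cay: "arcs (Cay K T) = {(x, x \<otimes>\<^bsub>K\<^esub> t) | x t. x \<in> carrier K \<and> t \<in> T}"
  by (simp add: Cay_def)

lemma int_01_iff: "0 \<le> j \<and> j < 2 \<longleftrightarrow> j = 0 \<or> j = (1 :: int)"
  by auto

lemma Cay_double:
  assumes "n > 0"
  shows "arcs (Cay (integer_mod_group 2 \<times>\<times> integer_mod_group n) (insert (1, 0) (Pair 0 ` T))) =
    double_rel (carrier (integer_mod_group n)) (arcs (Cay (integer_mod_group n) T))" (is "?L = ?R")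
    and "carrier (integer_mod_group 2 \<times>\<times> integer_mod_group n) = {0, 1} \<times> carrier (integer_mod_group n)"
proof -
  show "?L = ?R"
  proof (intro equalityI subsetI)
    fix a assume "a \<in> ?L"
    then obtain j x s t where a: "a = ((j, x), ((j + s) mod 2, (x + t) mod int n))"
      and jx: "j = 0 \<or> j = 1" "0 \<le> x" "x < int n" and st: "s = 1 \<and> t = 0 \<or> s = 0 \<and> t \<in> T"
      using assms by (auto simp: arcs_Cay DirProd_def carrier_integer_mod_group int_01_iff)
    then show "a \<in> ?R"
      using assms by (auto simp: double_rel_def arcs_Cay carrier_integer_mod_group)
  next
    fix a assume "a \<in> ?R"
    then consider (1) j x where "a = ((j, x), (1 - j, x))" "j = 0 \<or> j = 1" "0 \<le> x" "x < int n"
      | (2) j x t where "a = ((j, x), (j, (x + t) mod int n))" "j = 0 \<or> j = 1" "0 \<le> x" "x < int n" "t \<in> T"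
      using assms by (auto simp: double_rel_def arcs_Cay carrier_integer_mod_group)
    then show "a \<in> ?L"
    proof cases
      case 1
      then have "a = ((j, x), (j, x) \<otimes>\<^bsub>integer_mod_group 2 \<times>\<times> integer_mod_group n\<^esub> (1, 0))"
        by (auto simp: DirProd_def)
      moreover have "(j, x) \<in> carrier (integer_mod_group 2 \<times>\<times> integer_mod_group n)"
        using 1 assms by (auto simp: DirProd_def carrier_integer_mod_group)
      ultimately show ?thesis unfolding arcs_Cay by blast
    next
      case 2
      then have "a = ((j, x), (j, x) \<otimes>\<^bsub>integer_mod_group 2 \<times>\<times> integer_mod_group n\<^esub> (0, t))"
        by (auto simp: DirProd_def)
      moreover have "(j, x) \<in> carrier (integer_mod_group 2 \<times>\<times> integer_mod_group n)"
        using 2 assms by (auto simp: DirProd_def carrier_integer_mod_group)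
      ultimately show ?thesis using 2 unfolding arcs_Cay by blast
    qed
  qed
  show "carrier (integer_mod_group 2 \<times>\<times> integer_mod_group n) = {0, 1} \<times> carrier (integer_mod_group n)"
    by (auto simp: DirProd_def carrier_integer_mod_group)
qed

lemma mod_add_cases:
  fixes x t N :: int
  assumes "0 \<le> x" "x < N" "0 \<le> t" "t \<le> N"
  shows "(x + t) mod N = (if x + t < N then x + t else x + t - N)"
  using assms mod_add_self2[of "x + t - N" N] mod_pos_pos_trivial[of "x + t - N" N]
    mod_pos_pos_trivial[of "x + t" N] by simp

text \<open>These four functions are the distances from and to 0 in \<open>Cay(Z_n, {1})\<close>
  and, with halves rounded up, in \<open>Cay(Z_2n, {1, 2})\<close>. Distances to 0 treat
  \<open>i = 0\<close> separately, as the formula would give a full turn there.\<close>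

definition "cyc_out i = nat i"
definition "cyc_in n i = (if i = 0 then 0 else nat (int n - i))"
definition "sq_out i = nat ((i + 1) div 2)"
definition "sq_in n i = (if i = 0 then 0 else nat ((2 * int n - i + 1) div 2))"

lemma potential_cyc:
  assumes "n \<ge> 2"
  shows "potential (arcs (Cay (integer_mod_group n) {1})) (carrier (integer_mod_group n)) 0 cyc_out"
    and "potential ((arcs (Cay (integer_mod_group n) {1}))\<inverse>) (carrier (integer_mod_group n)) 0 (cyc_in n)"
    and "inj_on (\<lambda>x. (cyc_out x, cyc_in n x)) (carrier (integer_mod_group n))"
proof -
  have R: "arcs (Cay (integer_mod_group n) {1}) = {(x, if x + 1 < int n then x + 1 else 0) | x. 0 \<le> x \<and> x < int n}"
    using assms by (auto simp: arcs_Cay carrier_integer_mod_group mod_add_cases)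
  have C: "carrier (integer_mod_group n) = {0..<int n}" using assms by (simp add: carrier_integer_mod_group)
  show "potential (arcs (Cay (integer_mod_group n) {1})) (carrier (integer_mod_group n)) 0 cyc_out"
    unfolding R C potential_def
  proof (intro conjI ballI impI)
    fix y assume y: "y \<in> {0..<int n}" "y \<noteq> 0"
    then show "\<exists>x \<in> {0..<int n}. (x, y) \<in> {(x, if x + 1 < int n then x + 1 else 0) | x. 0 \<le> x \<and> x < int n} \<and>
        cyc_out y = Suc (cyc_out x)"
      by (intro bexI[of _ "y - 1"]) (auto simp: cyc_out_def)
  qed (auto simp: cyc_out_def)
  show "potential ((arcs (Cay (integer_mod_group n) {1}))\<inverse>) (carrier (integer_mod_group n)) 0 (cyc_in n)"
    unfolding R C potential_def
  proof (intro conjI ballI impI)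
    fix y assume y: "y \<in> {0..<int n}" "y \<noteq> 0"
    then show "\<exists>x \<in> {0..<int n}. (x, y) \<in> {(x, if x + 1 < int n then x + 1 else 0) | x. 0 \<le> x \<and> x < int n}\<inverse> \<and>
        cyc_in n y = Suc (cyc_in n x)"
      by (intro bexI[of _ "if y + 1 < int n then y + 1 else 0"]) (auto simp: cyc_in_def)
  qed (auto simp: cyc_in_def)
  show "inj_on (\<lambda>x. (cyc_out x, cyc_in n x)) (carrier (integer_mod_group n))"
    unfolding C by (auto simp: inj_on_def cyc_out_def)
qed

lemma potential_sq:
  assumes "n \<ge> 2"
  shows "potential (arcs (Cay (integer_mod_group (2 * n)) {1, 2})) (carrier (integer_mod_group (2 * n))) 0 sq_out"
    and "potential ((arcs (Cay (integer_mod_group (2 * n)) {1, 2}))\<inverse>) (carrier (integer_mod_group (2 * n))) 0 (sq_in n)"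
    and "inj_on (\<lambda>x. (sq_out x, sq_in n x)) (carrier (integer_mod_group (2 * n)))"
proof -
  define N where "N = 2 * int n"
  have N: "N \<ge> 4" "even N" using assms by (auto simp: N_def)
  define st where "st x t = (if x + t < N then x + t else x + t - N)" for x t
  have C: "carrier (integer_mod_group (2 * n)) = {0..<N}"
    using assms by (simp add: carrier_integer_mod_group N_def)
  have mod_st: "(x + 1) mod N = st x 1" "(x + 2) mod N = st x 2" if "0 \<le> x" "x < N" for x
    using that N by (auto simp: mod_add_cases st_def)
  let ?R = "{(x, st x t) | x t. 0 \<le> x \<and> x < N \<and> (t = 1 \<or> t = 2)}"
  have R: "arcs (Cay (integer_mod_group (2 * n)) {1, 2}) = ?R"
    unfolding arcs_Cay C by (intro Collect_cong iff_exI) (auto simp: mod_st N_def[symmetric])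
  have sq_in: "sq_in n x = (if x = 0 then 0 else nat ((N - x + 1) div 2))" for x by (simp add: sq_in_def N_def)
  show "potential (arcs (Cay (integer_mod_group (2 * n)) {1, 2})) (carrier (integer_mod_group (2 * n))) 0 sq_out"
    unfolding R C potential_def
  proof (intro conjI ballI impI)
    fix y assume y: "y \<in> {0..<N}" "y \<noteq> 0"
    \<comment> \<open>The last step has length 2 exactly for even \<open>y\<close>, so the
      predecessor is even in both cases.\<close>
    define x where "x = (if even y then y - 2 else y - 1)"
    define t :: int where "t = (if even y then 2 else 1)"
    have "x \<in> {0..<N}" "y = st x t" "sq_out y = Suc (sq_out x)"
      using y by (auto simp: x_def t_def st_def sq_out_def elim!: evenE oddE)
    moreover have "t = 1 \<or> t = 2" by (simp add: t_def)
    ultimately have "(x, y) \<in> ?R" by (intro CollectI exI[of _ x] exI[of _ t]) simp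
    then show "\<exists>x \<in> {0..<N}. (x, y) \<in> ?R \<and> sq_out y = Suc (sq_out x)"
      using \<open>x \<in> {0..<N}\<close> \<open>sq_out y = Suc (sq_out x)\<close> by blast
  qed (use N in \<open>auto simp: sq_out_def st_def\<close>)
  show "potential ((arcs (Cay (integer_mod_group (2 * n)) {1, 2}))\<inverse>) (carrier (integer_mod_group (2 * n))) 0 (sq_in n)"
    unfolding R C potential_def
  proof (intro conjI ballI impI)
    fix y assume y: "y \<in> {0..<N}" "y \<noteq> 0"
    \<comment> \<open>An odd vertex steps to an even one; from there steps of length 2 end exactly
      at 0 because \<open>N\<close> is even.\<close>
    define t :: int where "t = (if even y then 2 else 1)"
    have t: "t = 1 \<or> t = 2" and st: "st y t \<in> {0..<N}" using y N by (auto simp: t_def st_def)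
    have "sq_in n y = Suc (sq_in n (st y t))"
      using y N by (auto simp: t_def st_def sq_in elim!: evenE oddE)
    moreover have "(y, st y t) \<in> ?R" using y t by (intro CollectI exI[of _ y] exI[of _ t]) simp
    ultimately show "\<exists>x \<in> {0..<N}. (x, y) \<in> ?R\<inverse> \<and> sq_in n y = Suc (sq_in n x)"
      using st by blast
  qed (use N in \<open>auto simp: sq_in st_def\<close>)
  show "inj_on (\<lambda>x. (sq_out x, sq_in n x)) (carrier (integer_mod_group (2 * n)))"
    unfolding C
  proof (rule inj_onI)
    fix x y assume xy: "x \<in> {0..<N}" "y \<in> {0..<N}" "(sq_out x, sq_in n x) = (sq_out y, sq_in n y)"
    then have out: "(x + 1) div 2 = (y + 1) div 2" by (auto simp: sq_out_def eq_nat_nat_iff)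
    show "x = y"
    proof (cases "x = 0 \<or> y = 0")
      case True
      then show ?thesis using out xy(1,2) by auto
    next
      case False
      then have "(N - x + 1) div 2 = (N - y + 1) div 2" using xy by (auto simp: sq_in eq_nat_nat_iff)
      \<comment> \<open>Equal \<open>sq_out\<close> leaves only the pairs \<open>2m - 1\<close>,
        \<open>2m\<close>, which \<open>sq_in\<close> separates.\<close>
      then show ?thesis using out unfolding N_def by presburger
    qed
  qed
qed

lemma (in wf_digraph) weak_metric_dim_Cay:
  assumes conn: "strongly_connected G" "card (verts G) \<ge> 2"
  shows "n \<ge> 2 \<Longrightarrow> digraph_iso G (Cay (integer_mod_group n) {1}) \<Longrightarrow> weak_metric_dim G = 1"
    and "n \<ge> 2 \<Longrightarrow> digraph_iso G (Cay (integer_mod_group (2 * n)) {1, 2}) \<Longrightarrow> weak_metric_dim G = 1"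
    and "n \<ge> 3 \<Longrightarrow> digraph_iso G (Cay (integer_mod_group 2 \<times>\<times> integer_mod_group n) {(1, 0), (0, 1)})
      \<Longrightarrow> weak_metric_dim G = 1"
    and "n \<ge> 3 \<Longrightarrow> digraph_iso G (Cay (integer_mod_group 2 \<times>\<times> integer_mod_group (2 * n)) {(1, 0), (0, 1), (0, 2)})
      \<Longrightarrow> weak_metric_dim G = 1"
proof -
  note dim = weak_metric_dim_eq_1_if_potentials[OF conn]
  show "n \<ge> 2 \<Longrightarrow> digraph_iso G (Cay (integer_mod_group n) {1}) \<Longrightarrow> weak_metric_dim G = 1"
    using dim[OF _ _ potential_cyc] by simp
  show "n \<ge> 2 \<Longrightarrow> digraph_iso G (Cay (integer_mod_group (2 * n)) {1, 2}) \<Longrightarrow> weak_metric_dim G = 1"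
    using dim[OF _ _ potential_sq] by simp
  have double: "weak_metric_dim G = 1"
    if iso: "digraph_iso G (Cay (integer_mod_group 2 \<times>\<times> integer_mod_group m) (insert (1, 0) (Pair 0 ` T)))"
      and m: "m > 0"
      and f: "potential (arcs (Cay (integer_mod_group m) T)) (carrier (integer_mod_group m)) 0 f"
      and g: "potential ((arcs (Cay (integer_mod_group m) T))\<inverse>) (carrier (integer_mod_group m)) 0 g"
      and inj: "inj_on (\<lambda>x. (f x, g x)) (carrier (integer_mod_group m))"
      and near: "\<And>x y. x \<in> carrier (integer_mod_group m) \<Longrightarrow> y \<in> carrier (integer_mod_group m) \<Longrightarrow> y \<noteq> 0 \<Longrightarrow>
        f x + g x < f y + g y + 2"
      and not_1: "\<And>x. x \<in> carrier (integer_mod_group m) \<Longrightarrow> \<not> (f x = 1 \<and> g x = 1)" for m T f g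
  proof (rule dim[OF iso])
    show "(0, 0) \<in> carrier (integer_mod_group 2 \<times>\<times> integer_mod_group m)"
      unfolding Cay_double(2)[OF m] by simp
    show "potential (arcs (Cay (integer_mod_group 2 \<times>\<times> integer_mod_group m) (insert (1, 0) (Pair 0 ` T))))
        (carrier (integer_mod_group 2 \<times>\<times> integer_mod_group m)) (0, 0) (\<lambda>(j, x). nat j + f x)"
      unfolding Cay_double[OF m] by (rule potential_double[OF f]) simp
    show "potential ((arcs (Cay (integer_mod_group 2 \<times>\<times> integer_mod_group m) (insert (1, 0) (Pair 0 ` T))))\<inverse>)
        (carrier (integer_mod_group 2 \<times>\<times> integer_mod_group m)) (0, 0) (\<lambda>(j, x). nat j + g x)"
      unfolding Cay_double[OF m] double_rel_converse by (rule potential_double[OF g]) simp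
    show "inj_on (\<lambda>x. (case x of (j, x) \<Rightarrow> nat j + f x, case x of (j, x) \<Rightarrow> nat j + g x))
        (carrier (integer_mod_group 2 \<times>\<times> integer_mod_group m))"
      unfolding Cay_double(2)[OF m]
      by (rule inj_on_double[OF inj near not_1]) (use f g in \<open>auto simp: potential_def\<close>)
  qed
  show "weak_metric_dim G = 1"
    if n: "n \<ge> 3" and iso: "digraph_iso G (Cay (integer_mod_group 2 \<times>\<times> integer_mod_group n) {(1, 0), (0, 1)})"
  proof (rule double[of n "{1}" cyc_out "cyc_in n"])
    show "potential (arcs (Cay (integer_mod_group n) {1})) (carrier (integer_mod_group n)) 0 cyc_out"
      "potential ((arcs (Cay (integer_mod_group n) {1}))\<inverse>) (carrier (integer_mod_group n)) 0 (cyc_in n)"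
      "inj_on (\<lambda>x. (cyc_out x, cyc_in n x)) (carrier (integer_mod_group n))"
      using potential_cyc[of n] n by auto
  qed (use n iso in \<open>auto simp: carrier_integer_mod_group cyc_out_def cyc_in_def\<close>)
  show "weak_metric_dim G = 1"
    if n: "n \<ge> 3" and iso: "digraph_iso G (Cay (integer_mod_group 2 \<times>\<times> integer_mod_group (2 * n)) {(1, 0), (0, 1), (0, 2)})"
  proof (rule double[of "2 * n" "{1, 2}" sq_out "sq_in n"])
    show "potential (arcs (Cay (integer_mod_group (2 * n)) {1, 2})) (carrier (integer_mod_group (2 * n))) 0 sq_out"
      "potential ((arcs (Cay (integer_mod_group (2 * n)) {1, 2}))\<inverse>) (carrier (integer_mod_group (2 * n))) 0 (sq_in n)"
      "inj_on (\<lambda>x. (sq_out x, sq_in n x)) (carrier (integer_mod_group (2 * n)))"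
      using potential_sq[of n] n by auto
  next
    fix x y :: int
    assume x: "x \<in> carrier (integer_mod_group (2 * n))" and y: "y \<in> carrier (integer_mod_group (2 * n))" "y \<noteq> 0"
    \<comment> \<open>The sum is \<open>n\<close> for even nonzero \<open>x\<close>,
      \<open>n + 1\<close> for odd \<open>x\<close>, and 0 at 0.\<close>
    have "sq_out x + sq_in n x \<le> Suc n"
      using x n by (auto simp: carrier_integer_mod_group sq_out_def sq_in_def)
    moreover have "sq_out y + sq_in n y \<ge> n"
      using y n by (auto simp: carrier_integer_mod_group sq_out_def sq_in_def)
    ultimately show "sq_out x + sq_in n x < sq_out y + sq_in n y + 2" by simp
  next
    fix x :: int
    assume "x \<in> carrier (integer_mod_group (2 * n))"
    \<comment> \<open>For \<open>n = 2\<close> the element 2 would have both values equal to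
      1.\<close>
    then show "\<not> (sq_out x = 1 \<and> sq_in n x = 1)"
      using n by (auto simp: carrier_integer_mod_group sq_out_def sq_in_def)
  qed (use n iso in auto)
qed

section \<open>The regular action of the automorphism group\<close>

text \<open>The class \<^class>\<open>group_add\<close> does not assume commutativity: here \<open>+\<close> is composition.\<close>

typedef 'a gperm = "{f :: 'a \<Rightarrow> 'a. bij f}" morphisms papp Gperm
  by (rule exI[of _ id]) simp

lemma bij_papp: "bij (papp a)"
  using papp[of a] by simp

instantiation gperm :: (type) group_add
begin

definition "0 = Gperm id"
definition "a + b = Gperm (papp a \<circ> papp b)"
definition "- a = Gperm (inv_into UNIV (papp a))"
definition "a - b = a + - (b :: 'a gperm)"

instance
proof
  fix a b c :: "'a gperm"
  have [simp]: "papp (Gperm f) = f" if "bij f" for f :: "'a \<Rightarrow> 'a"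
    using that by (simp add: Gperm_inverse)
  have [simp]: "bij (papp x \<circ> papp y)" "bij (inv_into UNIV (papp x))" for x y :: "'a gperm"
    by (simp_all add: bij_comp bij_papp bij_imp_bij_inv)
  show "a + b + c = a + (b + c)" by (simp add: plus_gperm_def comp_assoc)
  show "0 + a = a" "a + 0 = a" by (simp_all add: plus_gperm_def zero_gperm_def papp_inverse)
  show "- a + a = 0"
    by (simp add: plus_gperm_def zero_gperm_def uminus_gperm_def bij_papp bij_is_inj)
  show "a + - b = a - b" by (simp add: minus_gperm_def)
qed

end

lemma papp_0 [simp]: "papp 0 v = v"
  by (simp add: zero_gperm_def Gperm_inverse)

lemma papp_add [simp]: "papp (a + b) v = papp a (papp b v)"
  by (simp add: plus_gperm_def Gperm_inverse bij_comp bij_papp)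

lemma papp_minus [simp]: "papp a (papp (- a) v) = v" "papp (- a) (papp a v) = v"
  by (simp_all add: papp_add[symmetric] del: papp_add)

lemma gperm_eqI: "(\<And>v. papp a v = papp b v) \<Longrightarrow> a = b"
  by (metis ext papp_inject)

locale resolved_digraph = digraph +
  fixes z
  assumes conn: "strongly_connected G"
    and trans: "vertex_transitive G"
    and z: "z \<in> verts G"
    and resolved: "inj_on (\<lambda>u. (rdist (arcs_ends G) z u, rdist (arcs_ends G) u z)) (verts G)"
begin

text \<open>Fixing everything outside \<open>verts G\<close> makes an element determined by its
  values on vertices. Only end pairs of arcs are tracked.\<close>

definition Aut :: "'a gperm set" where
  "Aut = {a. (\<forall>v. v \<notin> verts G \<longrightarrow> papp a v = v) \<and>
    (\<forall>u v. (papp a u, papp a v) \<in> arcs_ends G \<longleftrightarrow> (u, v) \<in> arcs_ends G)}"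

lemma Aut_0: "0 \<in> Aut"
  by (simp add: Aut_def)

lemma Aut_add: "a \<in> Aut \<Longrightarrow> b \<in> Aut \<Longrightarrow> a + b \<in> Aut"
  by (simp add: Aut_def)

lemma Aut_minus:
  assumes "a \<in> Aut"
  shows "- a \<in> Aut"
  unfolding Aut_def
proof (intro CollectI conjI allI impI)
  fix v assume "v \<notin> verts G"
  then have "papp a v = v" using assms by (simp add: Aut_def)
  then show "papp (- a) v = v" by (metis papp_minus(2))
next
  fix u v
  have "(papp a (papp (- a) u), papp a (papp (- a) v)) \<in> arcs_ends G \<longleftrightarrow>
      (papp (- a) u, papp (- a) v) \<in> arcs_ends G"
    using assms unfolding Aut_def by blast
  then show "(papp (- a) u, papp (- a) v) \<in> arcs_ends G \<longleftrightarrow> (u, v) \<in> arcs_ends G" by simp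
qed

lemma Aut_verts: "a \<in> Aut \<Longrightarrow> v \<in> verts G \<Longrightarrow> papp a v \<in> verts G"
proof (rule ccontr)
  assume a: "a \<in> Aut" "v \<in> verts G" "papp a v \<notin> verts G"
  then have "papp (- a) (papp a v) = papp a v" using Aut_minus[OF a(1)] unfolding Aut_def by blast
  then show False using a by simp
qed

lemma Aut_relpow:
  assumes "a \<in> Aut"
  shows "(papp a u, papp a v) \<in> arcs_ends G ^^ n \<longleftrightarrow> (u, v) \<in> arcs_ends G ^^ n"
proof -
  have *: "(papp b u, papp b v) \<in> arcs_ends G ^^ n" if "b \<in> Aut" "(u, v) \<in> arcs_ends G ^^ n" for b u v n
    using that(2)
  proof (induction n arbitrary: v)
    case (Suc n)
    then obtain w where w: "(u, w) \<in> arcs_ends G ^^ n" "(w, v) \<in> arcs_ends G" by (elim relpow_Suc_E)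
    then have "(papp b w, papp b v) \<in> arcs_ends G" using that(1) by (simp add: Aut_def)
    then show ?case using Suc.IH[OF w(1)] by (rule relpow_Suc_I[rotated])
  qed simp
  show ?thesis using *[OF assms, of u v n] *[OF Aut_minus[OF assms], of "papp a u" "papp a v" n] by auto
qed

lemma Aut_rdist: "a \<in> Aut \<Longrightarrow> rdist (arcs_ends G) (papp a u) (papp a v) = rdist (arcs_ends G) u v"
  by (simp add: rdist_def Aut_relpow)

lemma Aut_unique:
  assumes a: "a \<in> Aut" and b: "b \<in> Aut" and eq: "papp a z = papp b z"
  shows "a = b"
proof -
  define c where "c = - a + b"
  have c: "c \<in> Aut" using a b by (simp add: c_def Aut_add Aut_minus)
  have cz: "papp c z = z" by (simp add: c_def eq[symmetric])
  have "papp c v = v" for v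
  proof (cases "v \<in> verts G")
    case True
    have "rdist (arcs_ends G) z (papp c v) = rdist (arcs_ends G) z v"
      "rdist (arcs_ends G) (papp c v) z = rdist (arcs_ends G) v z"
      using Aut_rdist[OF c, of z v] Aut_rdist[OF c, of v z] cz by simp_all
    then show ?thesis using inj_onD[OF resolved _ Aut_verts[OF c True] True] by simp
  next
    case False
    then show ?thesis using c by (simp add: Aut_def)
  qed
  then have "c = 0" by (intro gperm_eqI) simp
  then have "- a + b = 0" by (simp add: c_def)
  then show ?thesis using minus_unique[of "- a" b] by simp
qed

lemma Aut_transitive:
  assumes v: "v \<in> verts G"
  shows "\<exists>a \<in> Aut. papp a z = v"
proof -
  obtain f where f: "digraph_isomorphism f" "app_iso f G = G" "iso_verts f z = v"
    using trans z v by (auto simp: vertex_transitive_def digraph_automorphism_def)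
  \<comment> \<open>Outside \<open>verts G\<close> the map \<open>iso_verts f\<close> is
    unconstrained, so the identity is used there.\<close>
  define h where "h = (\<lambda>x. if x \<in> verts G then iso_verts f x else x)"
  have inj: "inj_on (iso_verts f) (verts G)" by (rule digraph_isomorphism_inj_on_verts[OF f(1)])
  have im: "iso_verts f ` verts G = verts G" using verts_app_iso[of f G] f(2) by simp
  have "bij_betw h (verts G) (verts G)"
    using inj im by (auto simp: bij_betw_def h_def inj_on_def)
  moreover have "bij_betw h (- verts G) (- verts G)"
    by (auto simp: bij_betw_def h_def inj_on_def)
  ultimately have "bij_betw h (verts G \<union> - verts G) (verts G \<union> - verts G)"
    by (rule bij_betw_combine) simp
  then have bij: "bij h" by simp
  have E: "arcs_ends G = (\<lambda>(u, v). (iso_verts f u, iso_verts f v)) ` arcs_ends G"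
    using arcs_ends_app_iso_eq[OF f(1)] f(2) by simp
  have hE: "(h u, h v) \<in> arcs_ends G \<longleftrightarrow> (u, v) \<in> arcs_ends G" for u v
  proof
    assume uv: "(u, v) \<in> arcs_ends G"
    then have "(h u, h v) = (\<lambda>(u, v). (iso_verts f u, iso_verts f v)) (u, v)"
      using adj_in_verts by (simp add: h_def)
    then show "(h u, h v) \<in> arcs_ends G" using uv by (subst E) blast
  next
    assume "(h u, h v) \<in> arcs_ends G"
    then obtain x y where xy: "(x, y) \<in> arcs_ends G" "h u = iso_verts f x" "h v = iso_verts f y"
      by (subst (asm) E) auto
    then have "h u = h x" "h v = h y" using adj_in_verts[OF xy(1)] by (simp_all add: h_def)
    then show "(u, v) \<in> arcs_ends G" using bij xy(1) by (simp add: bij_is_inj inj_eq)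
  qed
  have "Gperm h \<in> Aut" using hE bij by (simp add: Aut_def Gperm_inverse) (simp add: h_def)
  moreover have "papp (Gperm h) z = v" using bij f(3) z by (simp add: Gperm_inverse) (simp add: h_def)
  ultimately show ?thesis by blast
qed

definition S :: "'a gperm set" where
  "S = {a \<in> Aut. (z, papp a z) \<in> arcs_ends G}"

text \<open>The prefixes of a word, applied to \<open>z\<close>, trace a walk: each prefix is an
  automorphism and carries the arc from \<open>z\<close> to \<open>papp s z\<close> to the next arc
  of the walk.\<close>

lemma words_iff:
  assumes "a \<in> Aut"
  shows "(\<exists>W. set W \<subseteq> S \<and> length W = n \<and> sum_list W = a) \<longleftrightarrow> (z, papp a z) \<in> arcs_ends G ^^ n"
proof
  have "(z, papp (sum_list W) z) \<in> arcs_ends G ^^ length W" if "set W \<subseteq> S" for W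
    using that
  proof (induction W)
    case (Cons s W)
    then have s: "s \<in> Aut" "(z, papp s z) \<in> arcs_ends G" by (auto simp: S_def)
    have "(papp s z, papp s (papp (sum_list W) z)) \<in> arcs_ends G ^^ length W"
      using Cons Aut_relpow[OF s(1)] by simp
    then show ?case using relpow_Suc_I2[OF s(2)] by simp
  qed simp
  then show "\<exists>W. set W \<subseteq> S \<and> length W = n \<and> sum_list W = a \<Longrightarrow> (z, papp a z) \<in> arcs_ends G ^^ n" by blast
next
  assume "(z, papp a z) \<in> arcs_ends G ^^ n"
  then show "\<exists>W. set W \<subseteq> S \<and> length W = n \<and> sum_list W = a"
    using assms
  proof (induction n arbitrary: a)
    case 0
    then have "a = 0" using Aut_unique[OF _ Aut_0] by simp
    then show ?case by simp
  next
    case (Suc n)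
    obtain v where v: "(z, v) \<in> arcs_ends G" "(v, papp a z) \<in> arcs_ends G ^^ n"
      using Suc.prems(1) by (rule relpow_Suc_E2)
    obtain s where s: "s \<in> Aut" "papp s z = v" using Aut_transitive adj_in_verts(2)[OF v(1)] by blast
    have sa: "- s + a \<in> Aut" using s Suc.prems by (simp add: Aut_add Aut_minus)
    have "(papp s z, papp s (papp (- s + a) z)) \<in> arcs_ends G ^^ n" using v s by simp
    then have "(z, papp (- s + a) z) \<in> arcs_ends G ^^ n" using Aut_relpow[OF s(1)] by blast
    then obtain W where W: "set W \<subseteq> S" "length W = n" "sum_list W = - s + a" using Suc.IH sa by blast
    moreover have "s \<in> S" using s v by (simp add: S_def)
    moreover have "s + (- s + a) = a" by (simp add: add.assoc[symmetric])
    ultimately show ?case by (intro exI[of _ "s # W"]) simp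
  qed
qed

lemma wlen_S: "a \<in> Aut \<Longrightarrow> wlen S a = rdist (arcs_ends G) z (papp a z)"
  by (simp add: wlen_def words_iff rdist_def)

lemma words_span_S: "words_span S = Aut"
proof (intro equalityI subsetI)
  fix a assume "a \<in> words_span S"
  then obtain W where W: "set W \<subseteq> S" "a = sum_list W" by (auto simp: words_span_def)
  have "sum_list W \<in> Aut" using W(1) by (induction W) (auto simp: S_def Aut_0 Aut_add)
  then show "a \<in> Aut" using W by simp
next
  fix a assume a: "a \<in> Aut"
  have "(z, papp a z) \<in> (arcs_ends G)\<^sup>*"
    using conn z Aut_verts[OF a z] by (auto simp: strongly_connected_def intro: reachable_rtranclI)
  then obtain n where "(z, papp a z) \<in> arcs_ends G ^^ n" by (auto simp: rtrancl_power)
  then show "a \<in> words_span S" using words_iff[OF a] by (auto simp: words_span_def)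
qed

sublocale grp: thin S
proof
  show "0 \<notin> S" using adj_not_same by (auto simp: S_def)
next
  fix a assume "a \<in> words_span S"
  then show "- a \<in> words_span S" by (simp add: words_span_S Aut_minus)
next
  fix a b assume "a \<in> words_span S" "b \<in> words_span S" and w: "wlen S a = wlen S b" "wlen S (- a) = wlen S (- b)"
  then have ab: "a \<in> Aut" "b \<in> Aut" by (auto simp: words_span_S)
  have m: "wlen S (- c) = rdist (arcs_ends G) (papp c z) z" if "c \<in> Aut" for c
    using wlen_S[OF Aut_minus[OF that]] Aut_rdist[OF that, of z "papp (- c) z"] by simp
  have "papp a z = papp b z"
    using w ab m wlen_S Aut_verts[OF _ z] by (intro inj_onD[OF resolved]) auto
  then show "a = b" using Aut_unique ab by blast
qed

lemma S_nonempty: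
  assumes "card (verts G) \<ge> 2"
  shows "S \<noteq> {}"
proof -
  have "\<not> verts G \<subseteq> {z}" using assms card_mono[of "{z}" "verts G"] by auto
  then obtain v where v: "v \<in> verts G" "v \<noteq> z" by blast
  have "(z, v) \<in> (arcs_ends G)\<^sup>*" using conn z v by (auto simp: strongly_connected_def intro: reachable_rtranclI)
  then obtain w where w: "(z, w) \<in> arcs_ends G" using v(2) by (metis converse_rtranclE)
  then obtain s where "s \<in> Aut" "papp s z = w" using Aut_transitive adj_in_verts(2) by blast
  then show ?thesis using w by (auto simp: S_def)
qed

text \<open>The vertex belonging to \<open>x\<close> is the image of \<open>z\<close> under
  \<open>\<psi> x\<close>, and \<open>- \<psi> x\<close> moves arcs leaving it to arcs leaving
  \<open>z\<close>. The image of \<open>\<psi>\<close> is all of \<open>Aut\<close>, because it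
  contains \<open>S\<close> and is closed under addition.\<close>

lemma iso_CayI:
  assumes K: "group K" and T: "T \<subseteq> carrier K"
    and hom: "\<And>x y. x \<in> carrier K \<Longrightarrow> y \<in> carrier K \<Longrightarrow> \<psi> (x \<otimes>\<^bsub>K\<^esub> y) = \<psi> x + \<psi> y"
    and inj: "inj_on \<psi> (carrier K)" and \<psi>S: "\<psi> ` T = S" and Aut: "\<psi> ` carrier K \<subseteq> words_span S"
  shows "digraph_iso G (Cay K T)"
proof -
  interpret K: group K by (rule K)
  have one: "\<psi> \<one>\<^bsub>K\<^esub> = 0" using hom[of "\<one>\<^bsub>K\<^esub>" "\<one>\<^bsub>K\<^esub>"] by simp
  have "sum_list W \<in> \<psi> ` carrier K" if "set W \<subseteq> S" for W
    using that
  proof (induction W)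
    case Nil
    then show ?case using one by (intro image_eqI[of _ _ "\<one>\<^bsub>K\<^esub>"]) auto
  next
    case (Cons s W)
    then obtain x where x: "x \<in> carrier K" "sum_list W = \<psi> x" by auto
    obtain t where "t \<in> carrier K" "s = \<psi> t" using Cons.prems T unfolding \<psi>S[symmetric] by auto
    then show ?case using x hom by (intro image_eqI[of _ _ "t \<otimes>\<^bsub>K\<^esub> x"]) auto
  qed
  then have im: "\<psi> ` carrier K = Aut" using Aut unfolding words_span_S[symmetric] by (auto simp: words_span_def)
  have \<psi>_Aut: "\<psi> x \<in> Aut" if "x \<in> carrier K" for x using that im by blast
  define \<chi> where "\<chi> x = papp (\<psi> x) z" for x
  show ?thesis
  proof (rule digraph_iso_CayI[of \<chi>])
    show "bij_betw \<chi> (carrier K) (verts G)"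
      unfolding bij_betw_def
    proof
      show "inj_on \<chi> (carrier K)"
        using Aut_unique \<psi>_Aut inj by (auto simp: inj_on_def \<chi>_def)
      show "\<chi> ` carrier K = verts G"
      proof (intro equalityI subsetI)
        fix v assume "v \<in> \<chi> ` carrier K"
        then show "v \<in> verts G" using \<psi>_Aut Aut_verts[OF _ z] by (auto simp: \<chi>_def)
      next
        fix v assume "v \<in> verts G"
        then obtain a where "a \<in> Aut" "papp a z = v" using Aut_transitive by blast
        then show "v \<in> \<chi> ` carrier K" unfolding im[symmetric] by (auto simp: \<chi>_def)
      qed
    qed
    show "arcs (Cay K T) \<subseteq> carrier K \<times> carrier K" using T by (auto simp: Cay_def)
    fix x y assume x: "x \<in> carrier K" and y: "y \<in> carrier K"
    let ?a = "- \<psi> x + \<psi> y"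
    have a: "?a \<in> Aut" using x y \<psi>_Aut Aut_add Aut_minus by blast
    have "(\<chi> x, \<chi> y) = (papp (\<psi> x) z, papp (\<psi> x) (papp ?a z))" by (simp add: \<chi>_def)
    then have "(\<chi> x, \<chi> y) \<in> arcs_ends G \<longleftrightarrow> (z, papp ?a z) \<in> arcs_ends G"
      using \<psi>_Aut[OF x] by (simp only:) (simp only: Aut_def mem_Collect_eq)
    also have "\<dots> \<longleftrightarrow> ?a \<in> \<psi> ` T" using a by (simp add: \<psi>S S_def)
    also have "\<dots> \<longleftrightarrow> (\<exists>t \<in> T. \<psi> y = \<psi> (x \<otimes>\<^bsub>K\<^esub> t))"
    proof -
      have *: "?a = g \<longleftrightarrow> \<psi> y = \<psi> x + g" for g by auto
      have "?a \<in> \<psi> ` T \<longleftrightarrow> (\<exists>t \<in> T. ?a = \<psi> t)" by blast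
      also have "\<dots> \<longleftrightarrow> (\<exists>t \<in> T. \<psi> y = \<psi> (x \<otimes>\<^bsub>K\<^esub> t))"
        unfolding * by (rule bex_cong[OF refl]) (use hom[OF x] T in auto)
      finally show ?thesis .
    qed
    also have "\<dots> \<longleftrightarrow> (\<exists>t \<in> T. y = x \<otimes>\<^bsub>K\<^esub> t)"
      by (rule bex_cong[OF refl], rule inj_on_eq_iff[OF inj y]) (use x T in auto)
    also have "\<dots> \<longleftrightarrow> (x, y) \<in> arcs (Cay K T)" using x by (auto simp: Cay_def)
    finally show "(\<chi> x, \<chi> y) \<in> arcs_ends G \<longleftrightarrow> (x, y) \<in> arcs (Cay K T)" .
  qed
qed

end

section \<open>Identifying the automorphism group with the four groups\<close>

lemma has_order_inj:
  assumes "has_order a n" "i < n" "j < n" "rep i a = rep j a"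
  shows "i = j"
proof -
  have "\<not> i' < j'" if "i' < n" "j' < n" "rep i' a = rep j' a" for i' j'
  proof
    assume less: "i' < j'"
    have "rep i' a + rep (j' - i') a = rep j' a" using less by (simp add: rep_add[symmetric])
    then have "rep i' a + rep (j' - i') a = rep i' a" using that(3) by simp
    then have "rep (j' - i') a = 0" by simp
    then show False using assms(1) less that(2) by (auto simp: has_order_def)
  qed
  from this[of i j] this[of j i] show ?thesis using assms by auto
qed

lemma rep_nat_mod:
  assumes "rep n a = 0" "0 \<le> x" "0 \<le> y"
  shows "rep (nat ((x + y) mod int n)) a = rep (nat x) a + rep (nat y) a"
proof -
  have "nat ((x + y) mod int n) = (nat x + nat y) mod n"
    using assms by (simp add: nat_mod_distrib nat_add_distrib)
  then show ?thesis using rep_mod[OF assms(1)] by (simp add: rep_add)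
qed

context resolved_digraph
begin

lemma iso_Cay_cyclic:
  assumes y: "y \<in> S" "has_order y N" "N > 0"
    and T: "T \<subseteq> {0..<int N}" "(\<lambda>i. rep (nat i) y) ` T = S"
  shows "digraph_iso G (Cay (integer_mod_group N) T)"
proof (rule iso_CayI[where \<psi> = "\<lambda>i. rep (nat i) y"])
  have C: "carrier (integer_mod_group N) = {0..<int N}" using y(3) by (simp add: carrier_integer_mod_group)
  show "inj_on (\<lambda>i. rep (nat i) y) (carrier (integer_mod_group N))"
    unfolding C
  proof (rule inj_onI)
    fix i j assume ij: "i \<in> {0..<int N}" "j \<in> {0..<int N}" "rep (nat i) y = rep (nat j) y"
    then have "nat i = nat j" by (intro has_order_inj[OF y(2)]) auto
    then show "i = j" using ij by auto
  qed
  show "(\<lambda>i. rep (nat i) y) ` carrier (integer_mod_group N) \<subseteq> words_span S"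
    using y by (auto intro: grp.grp_rep grp.grp_letter)
  show "rep (nat (i \<otimes>\<^bsub>integer_mod_group N\<^esub> j)) y = rep (nat i) y + rep (nat j) y"
    if "i \<in> carrier (integer_mod_group N)" "j \<in> carrier (integer_mod_group N)" for i j
    using that y(2) rep_nat_mod[of N y i j] unfolding C by (simp add: has_order_def)
  show "T \<subseteq> carrier (integer_mod_group N)" unfolding C by (rule T)
qed (simp_all add: T)

lemma iso_Cay_double:
  assumes s: "s \<in> S" "s + s = 0" and y: "y \<in> S" "has_order y N" "N > 0"
    and comm: "s + y = y + s" and ne: "\<forall>i. rep i y \<noteq> s"
    and T: "T \<subseteq> {0, 1} \<times> {0..<int N}" "(\<lambda>(j, i). rep (nat j) s + rep (nat i) y) ` T = S"
  shows "digraph_iso G (Cay (integer_mod_group 2 \<times>\<times> integer_mod_group N) T)"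
proof (rule iso_CayI[where \<psi> = "\<lambda>(j, i). rep (nat j) s + rep (nat i) y"])
  let ?K = "integer_mod_group 2 \<times>\<times> integer_mod_group N"
  let ?\<psi> = "\<lambda>(j, i). rep (nat j) s + rep (nat i) y"
  have C: "carrier ?K = {0, 1} \<times> {0..<int N}"
    unfolding Cay_double(2)[OF y(3)] using y(3) by (simp add: carrier_integer_mod_group)
  show "group ?K" by (rule DirProd_group) simp_all
  show "T \<subseteq> carrier ?K" unfolding C by (rule T)
  show "?\<psi> ` carrier ?K \<subseteq> words_span S"
    using grp.grp_add[OF grp.grp_rep[OF grp.grp_letter[OF s(1)]] grp.grp_rep[OF grp.grp_letter[OF y(1)]]] by auto
  have s2: "rep 2 s = 0" using s by (simp add: numeral_2_eq_2)
  have yN: "rep N y = 0" using y by (simp add: has_order_def)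
  show "?\<psi> (p \<otimes>\<^bsub>?K\<^esub> q) = ?\<psi> p + ?\<psi> q" if pq: "p \<in> carrier ?K" "q \<in> carrier ?K" for p q
  proof -
    obtain j i j' i' where p: "p = (j, i)" "0 \<le> j" "0 \<le> i" and q: "q = (j', i')" "0 \<le> j'" "0 \<le> i'"
      using pq unfolding C by auto
    have "rep (nat j') s + rep (nat i) y = rep (nat i) y + rep (nat j') s"
      using comm by (rule rep_commute_rep)
    then have *: "rep (nat j') s + (rep (nat i) y + g) = rep (nat i) y + (rep (nat j') s + g)" for g
      by (metis add.assoc)
    have "?\<psi> (p \<otimes>\<^bsub>?K\<^esub> q) = rep (nat ((j + j') mod int 2)) s + rep (nat ((i + i') mod int N)) y"
      by (simp add: p q)
    also have "\<dots> = ?\<psi> p + ?\<psi> q"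
      using rep_nat_mod[OF s2 p(2) q(2)] rep_nat_mod[OF yN p(3) q(3)] by (simp add: p(1) q(1) add.assoc *)
    finally show ?thesis .
  qed
  \<comment> \<open>Adding the complementary multiple of \<open>y\<close> would make
    \<open>s\<close> a multiple of \<open>y\<close>.\<close>
  have not_s: "rep (nat i) y \<noteq> s + rep (nat i') y" if "i' < int N" for i i'
  proof
    assume eq: "rep (nat i) y = s + rep (nat i') y"
    have "rep (nat i + (N - nat i')) y = s + rep (nat i' + (N - nat i')) y"
      by (simp add: rep_add eq add.assoc)
    also have "nat i' + (N - nat i') = N" using that by simp
    finally show False using ne yN by simp
  qed
  show "inj_on ?\<psi> (carrier ?K)"
    unfolding C
  proof (rule inj_onI)
    fix p q assume pq: "p \<in> {0 :: int, 1} \<times> {0..<int N}" "q \<in> {0 :: int, 1} \<times> {0..<int N}" "?\<psi> p = ?\<psi> q"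
    obtain j i j' i' where p: "p = (j, i)" "j = 0 \<or> j = 1" "0 \<le> i" "i < int N"
      and q: "q = (j', i')" "j' = 0 \<or> j' = 1" "0 \<le> i'" "i' < int N"
      using pq(1,2) by auto
    have eq: "rep (nat j) s + rep (nat i) y = rep (nat j') s + rep (nat i') y" using pq(3) p q by simp
    have j: "j = j'"
      using p(2) q(2) eq not_s[of i' i] not_s[of i i'] p q by auto
    then have "rep (nat i) y = rep (nat i') y" using eq by simp
    then have "nat i = nat i'" using p q by (intro has_order_inj[OF y(2)]) auto
    then show "p = q" using p q j by simp
  qed
qed (rule T)

lemma iso_Cay_cases:
  assumes "card (verts G) \<ge> 2"
  shows "(\<exists>n::nat. n \<ge> 2 \<and> digraph_iso G (Cay (integer_mod_group n) {1})) \<or>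
    (\<exists>n::nat. n \<ge> 2 \<and> digraph_iso G (Cay (integer_mod_group (2 * n)) {1, 2})) \<or>
    (\<exists>n::nat. n \<ge> 3 \<and> digraph_iso G
       (Cay (integer_mod_group 2 \<times>\<times> integer_mod_group n) {(1, 0), (0, 1)})) \<or>
    (\<exists>n::nat. n \<ge> 3 \<and> digraph_iso G
       (Cay (integer_mod_group 2 \<times>\<times> integer_mod_group (2 * n)) {(1, 0), (0, 1), (0, 2)}))"
proof -
  have two: "rep 2 y = y + y" for y :: "'a gperm" by (simp add: numeral_2_eq_2)
  from grp.classification[OF S_nonempty[OF assms]] show ?thesis
  proof (elim disjE exE conjE, goal_cases)
    case (1 x n)
    have "digraph_iso G (Cay (integer_mod_group n) {1})"
    proof (rule iso_Cay_cyclic[OF _ 1(3)])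
      show "x \<in> S" "(\<lambda>i. rep (nat i) x) ` {1} = S" unfolding 1(2) by simp_all
    qed (use 1(1) in auto)
    then show ?thesis using 1(1) by blast
  next
    case (2 y n)
    have "digraph_iso G (Cay (integer_mod_group (2 * n)) {1, 2})"
    proof (rule iso_Cay_cyclic[OF _ 2(3)])
      show "y \<in> S" "(\<lambda>i. rep (nat i) y) ` {1, 2} = S" unfolding 2(2) by (simp_all add: two)
    qed (use 2(1) in auto)
    then show ?thesis using 2(1) by blast
  next
    case (3 s x n)
    have "digraph_iso G (Cay (integer_mod_group 2 \<times>\<times> integer_mod_group n) {(1, 0), (0, 1)})"
    proof (rule iso_Cay_double[OF _ 3(3) _ 3(5) _ 3(4,6)])
      show "s \<in> S" "x \<in> S" "(\<lambda>(j, i). rep (nat j) s + rep (nat i) x) ` {(1, 0), (0, 1)} = S"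
        unfolding 3(2) by simp_all
    qed (use 3(1) in auto)
    then show ?thesis using 3(1) by blast
  next
    case (4 s y n)
    have "digraph_iso G (Cay (integer_mod_group 2 \<times>\<times> integer_mod_group (2 * n)) {(1, 0), (0, 1), (0, 2)})"
    proof (rule iso_Cay_double[OF _ 4(3) _ 4(5) _ 4(4,6)])
      show "s \<in> S" "y \<in> S" "(\<lambda>(j, i). rep (nat j) s + rep (nat i) y) ` {(1, 0), (0, 1), (0, 2)} = S"
        unfolding 4(2) by (simp_all add: two)
    qed (use 4(1) in auto)
    then show ?thesis using 4(1) by blast
  qed
qed

end

theorem theorem3p3:
  fixes G :: "('a, 'b) pre_digraph"
  assumes "digraph G"
    and "strongly_connected G"
    and "card (verts G) \<ge> 2"
    and "vertex_transitive G"
  shows "weak_metric_dim G = 1 \<longleftrightarrow>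
    (\<exists>n::nat. n \<ge> 2 \<and> digraph_iso G (Cay (integer_mod_group n) {1})) \<or>
    (\<exists>n::nat. n \<ge> 2 \<and> digraph_iso G (Cay (integer_mod_group (2 * n)) {1, 2})) \<or>
    (\<exists>n::nat. n \<ge> 3 \<and> digraph_iso G
       (Cay (integer_mod_group 2 \<times>\<times> integer_mod_group n) {(1, 0), (0, 1)})) \<or>
    (\<exists>n::nat. n \<ge> 3 \<and> digraph_iso G
       (Cay (integer_mod_group 2 \<times>\<times> integer_mod_group (2 * n)) {(1, 0), (0, 1), (0, 2)}))"
proof -
  interpret digraph G by (rule assms(1))
  show ?thesis
  proof (rule iffI, goal_cases)
    case 1
    then obtain z where "z \<in> verts G"
        "inj_on (\<lambda>u. (rdist (arcs_ends G) z u, rdist (arcs_ends G) u z)) (verts G)"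
      using weak_metric_dim_eq_1_iff[OF assms(2,3)] by blast
    then interpret resolved_digraph G z
      using assms by unfold_locales
    show ?case by (rule iso_Cay_cases[OF assms(3)])
  next
    case 2
    then show ?case using weak_metric_dim_Cay[OF assms(2,3)] by blast
  qed
qed

end
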